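(* Let $A$ be a nontrivial prime associative superalgebra over $\Phi$ (where $\frac12\in\Phi$) such that $A$ is not a central order in $C(n)$ for $n=1,2,3$. Let $L$ be a Lie ideal of $A$ and let $V$ be a (graded) $\Phi$-submodule of $A$ such that $[V,L]\subseteq V$. Then either $L\subseteq Z$, or $V\subseteq Z$, or there exists an ideal $M$ of $A$ such that $0\neq[M,A]\subseteq V$.
   Context: $\Phi$ is a commutative unital ring of scalars with $\frac12\in\Phi$. An associative superalgebra over $\Phi$ is a $\mathbb{Z}/2$-graded associative $\Phi$-algebra $A=A_0+A_1$ (direct sum, $A_iA_j\subseteq A_{i+j}$); it is nontrivial if $A_1\neq 0$. Elements of $A_0\cup A_1$ are called homogeneous, and $\bar a$ denotes the degree of a homogeneous element $a$. "Subalgebra", "submodule", "ideal" always mean graded subalgebra, graded submodule, graded (two-sided) ideal. $A$ is prime if the product of any two nonzero (graded) ideals of $A$ is nonzero. The superbracket is $[a,b]=ab-(-1)^{\bar a\bar b}ba$ for homogeneous $a,b$, extended bilinearly; for submodules $M,N$, $[M,N]$ is the $\Phi$-span of all $[m,n]$ with $m\in M$, $n\in N$. A Lie ideal of $A$ is a (graded) $\Phi$-submodule $L$ with $[L,A]\subseteq L$. $Z$ denotes the even part of the center of $A$. If $A$ is prime and $Z\neq0$, one forms the localization $Z^{-1}A=\{z^{-1}a: 0\neq z\in Z,\ a\in A\}$, a superalgebra over the field $Z^{-1}Z$. $A$ is called a central order in $C(n)$ if $Z\neq 0$ and $Z^{-1}A$ is isomorphic, as a superalgebra over $Z^{-1}Z$,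 to the Clifford superalgebra of a non-degenerate quadratic space of dimension $n$ over $Z^{-1}Z$ (with its usual $\mathbb{Z}/2$-grading in which vectors are odd). *)

theory Defs
  imports Complex_Main "HOL-Algebra.QuotRing" "HOL-Algebra.Module"
begin

section \<open>Associative superalgebras\<close>

text \<open>
  A superalgebra is the whole of a type of class \<open>ring\<close>, hence not assumed unital or commutative.
  The scalars are a type of class \<open>comm_ring_1\<close>, acting by \<open>scale\<close>. The qualified name
  \<open>Modules.module\<close> is the (type-based) locale from \<open>Complex_Main\<close>, not the one of HOL-Algebra.
\<close>

locale assoc_superalgebra = Modules.module scale
  for scale :: "'k::comm_ring_1 \<Rightarrow> 'a::ring \<Rightarrow> 'a" +
  fixes A0 A1 :: "'a set"
  assumes scale_mult_left: "scale r (x * y) = scale r x * y"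
    and scale_mult_right: "scale r (x * y) = x * scale r y"
    and subspace_A0: "subspace A0"
    and subspace_A1: "subspace A1"
    and A0_inter_A1: "A0 \<inter> A1 = {0}"
    and A0_plus_A1: "\<exists>x0\<in>A0. \<exists>x1\<in>A1. x = x0 + x1"
    and A0_A0: "x \<in> A0 \<Longrightarrow> y \<in> A0 \<Longrightarrow> x * y \<in> A0"
    and A0_A1: "x \<in> A0 \<Longrightarrow> y \<in> A1 \<Longrightarrow> x * y \<in> A1"
    and A1_A0: "x \<in> A1 \<Longrightarrow> y \<in> A0 \<Longrightarrow> x * y \<in> A1"
    and A1_A1: "x \<in> A1 \<Longrightarrow> y \<in> A1 \<Longrightarrow> x * y \<in> A0"

definition graded_submodule ::
  "('k::comm_ring_1 \<Rightarrow> 'a::ring \<Rightarrow> 'a) \<Rightarrow> 'a set \<Rightarrow> 'a set \<Rightarrow> 'a set \<Rightarrow> bool" where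
  "graded_submodule scale A0 A1 S \<longleftrightarrow>
     Modules.module.subspace scale S \<and>
     (\<forall>x0\<in>A0. \<forall>x1\<in>A1. x0 + x1 \<in> S \<longrightarrow> x0 \<in> S \<and> x1 \<in> S)"

definition graded_ideal ::
  "('k::comm_ring_1 \<Rightarrow> 'a::ring \<Rightarrow> 'a) \<Rightarrow> 'a set \<Rightarrow> 'a set \<Rightarrow> 'a set \<Rightarrow> bool" where
  "graded_ideal scale A0 A1 I \<longleftrightarrow>
     graded_submodule scale A0 A1 I \<and> (\<forall>x\<in>I. \<forall>a. a * x \<in> I \<and> x * a \<in> I)"

definition ideal_product ::
  "('k::comm_ring_1 \<Rightarrow> 'a::ring \<Rightarrow> 'a) \<Rightarrow> 'a set \<Rightarrow> 'a set \<Rightarrow> 'a set" where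
  "ideal_product scale I J = Modules.module.span scale {x * y | x y. x \<in> I \<and> y \<in> J}"

definition prime_superalgebra ::
  "('k::comm_ring_1 \<Rightarrow> 'a::ring \<Rightarrow> 'a) \<Rightarrow> 'a set \<Rightarrow> 'a set \<Rightarrow> bool" where
  "prime_superalgebra scale A0 A1 \<longleftrightarrow>
     (\<forall>I J. graded_ideal scale A0 A1 I \<and> graded_ideal scale A0 A1 J \<and> I \<noteq> {0} \<and> J \<noteq> {0}
        \<longrightarrow> ideal_product scale I J \<noteq> {0})"

definition even_component :: "'a::ring set \<Rightarrow> 'a set \<Rightarrow> 'a \<Rightarrow> 'a" where
  "even_component A0 A1 x = (THE x0. x0 \<in> A0 \<and> x - x0 \<in> A1)"

definition odd_component :: "'a::ring set \<Rightarrow> 'a set \<Rightarrow> 'a \<Rightarrow> 'a" where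
  "odd_component A0 A1 x = x - even_component A0 A1 x"

definition superbracket :: "'a::ring set \<Rightarrow> 'a set \<Rightarrow> 'a \<Rightarrow> 'a \<Rightarrow> 'a" where
  "superbracket A0 A1 x y =
     (let x0 = even_component A0 A1 x; x1 = odd_component A0 A1 x;
          y0 = even_component A0 A1 y; y1 = odd_component A0 A1 y
      in (x0 * y0 - y0 * x0) + (x0 * y1 - y1 * x0) + (x1 * y0 - y0 * x1) + (x1 * y1 + y1 * x1))"

definition bracket_span ::
  "('k::comm_ring_1 \<Rightarrow> 'a::ring \<Rightarrow> 'a) \<Rightarrow> 'a set \<Rightarrow> 'a set \<Rightarrow> 'a set \<Rightarrow> 'a set \<Rightarrow> 'a set" where
  "bracket_span scale A0 A1 M N =
     Modules.module.span scale {superbracket A0 A1 m n | m n. m \<in> M \<and> n \<in> N}"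

definition Lie_ideal ::
  "('k::comm_ring_1 \<Rightarrow> 'a::ring \<Rightarrow> 'a) \<Rightarrow> 'a set \<Rightarrow> 'a set \<Rightarrow> 'a set \<Rightarrow> bool" where
  "Lie_ideal scale A0 A1 L \<longleftrightarrow>
     graded_submodule scale A0 A1 L \<and> bracket_span scale A0 A1 L UNIV \<subseteq> L"

definition even_center :: "'a::ring set \<Rightarrow> 'a set" where
  "even_center A0 = {z \<in> A0. \<forall>a. z * a = a * z}"


section \<open>Central localization\<close>

text \<open>
  The class of \<open>(a, z)\<close> is the fraction \<open>z\<inverse>a\<close>. In a prime superalgebra the nonzero elements of
  \<open>Z\<close> are not zero divisors, so cross-multiplication is already transitive and the
  operations below do not depend on representatives.
\<close>

definition locrel :: "'a::ring set \<Rightarrow> (('a \<times> 'a) \<times> ('a \<times> 'a)) set" where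
  "locrel Z = {((a, z), (b, w)). z \<in> Z - {0} \<and> w \<in> Z - {0} \<and> w * a = z * b}"

definition fractions :: "'a::ring set \<Rightarrow> 'a set \<Rightarrow> ('a \<times> 'a) set set" where
  "fractions Z B = {locrel Z `` {(a, z)} | a z. a \<in> B \<and> z \<in> Z - {0}}"

definition localization :: "'a::ring set \<Rightarrow> ('a \<times> 'a) set ring" where
  "localization Z =
     \<lparr>carrier = fractions Z UNIV,
      monoid.mult = (\<lambda>X Y. \<Union>(a, z)\<in>X. \<Union>(b, w)\<in>Y. locrel Z `` {(a * b, z * w)}),
      one = (\<Union>z\<in>Z - {0}. locrel Z `` {(z, z)}),
      zero = (\<Union>z\<in>Z - {0}. locrel Z `` {(0, z)}),
      add = (\<lambda>X Y. \<Union>(a, z)\<in>X. \<Union>(b, w)\<in>Y. locrel Z `` {(w * a + z * b, z * w)})\<rparr>"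

definition center_field :: "'a::ring set \<Rightarrow> ('a \<times> 'a) set ring" where
  "center_field Z = (localization Z)\<lparr>carrier := fractions Z Z\<rparr>"


section \<open>Clifford superalgebras\<close>

definition polar_form :: "('k, 'm) ring_scheme \<Rightarrow> ('k, 'v) module \<Rightarrow> ('v \<Rightarrow> 'k) \<Rightarrow> 'v \<Rightarrow> 'v \<Rightarrow> 'k" where
  "polar_form K V q u v = q (u \<oplus>\<^bsub>V\<^esub> v) \<ominus>\<^bsub>K\<^esub> q u \<ominus>\<^bsub>K\<^esub> q v"

text \<open>The polar form is symmetric, so linearity in the first argument is bilinearity.\<close>

definition quadratic_form :: "('k, 'm) ring_scheme \<Rightarrow> ('k, 'v) module \<Rightarrow> ('v \<Rightarrow> 'k) \<Rightarrow> bool" where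
  "quadratic_form K V q \<longleftrightarrow>
     q \<in> carrier V \<rightarrow> carrier K \<and>
     (\<forall>c\<in>carrier K. \<forall>v\<in>carrier V. q (c \<odot>\<^bsub>V\<^esub> v) = c \<otimes>\<^bsub>K\<^esub> c \<otimes>\<^bsub>K\<^esub> q v) \<and>
     (\<forall>u\<in>carrier V. \<forall>u'\<in>carrier V. \<forall>v\<in>carrier V.
        polar_form K V q (u \<oplus>\<^bsub>V\<^esub> u') v = polar_form K V q u v \<oplus>\<^bsub>K\<^esub> polar_form K V q u' v) \<and>
     (\<forall>c\<in>carrier K. \<forall>u\<in>carrier V. \<forall>v\<in>carrier V.
        polar_form K V q (c \<odot>\<^bsub>V\<^esub> u) v = c \<otimes>\<^bsub>K\<^esub> polar_form K V q u v)"

definition nondegenerate :: "('k, 'm) ring_scheme \<Rightarrow> ('k, 'v) module \<Rightarrow> ('v \<Rightarrow> 'k) \<Rightarrow> bool" where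
  "nondegenerate K V q \<longleftrightarrow>
     (\<forall>u\<in>carrier V. (\<forall>v\<in>carrier V. polar_form K V q u v = \<zero>\<^bsub>K\<^esub>) \<longrightarrow> u = \<zero>\<^bsub>V\<^esub>)"

text \<open>
  The \<open>n\<close>-dimensional coordinate space; the fields \<open>mult\<close> and \<open>one\<close>, which the record type
  \<open>module\<close> inherits from \<open>ring\<close>, play no role.
\<close>

definition coord_space :: "('k, 'm) ring_scheme \<Rightarrow> nat \<Rightarrow> ('k, nat \<Rightarrow> 'k) module" where
  "coord_space K n =
     \<lparr>carrier = {..<n} \<rightarrow>\<^sub>E carrier K,
      monoid.mult = undefined,
      one = undefined,
      zero = (\<lambda>i\<in>{..<n}. \<zero>\<^bsub>K\<^esub>),
      add = (\<lambda>u v. \<lambda>i\<in>{..<n}. u i \<oplus>\<^bsub>K\<^esub> v i),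
      smult = (\<lambda>c v. \<lambda>i\<in>{..<n}. c \<otimes>\<^bsub>K\<^esub> v i)\<rparr>"

text \<open>
  The tensor algebra of the coordinate space: the word \<open>[i\<^sub>1, \<dots>, i\<^sub>r]\<close> stands for the basis tensor
  \<open>e\<^bsub>i\<^sub>1\<^esub> \<otimes> \<dots> \<otimes> e\<^bsub>i\<^sub>r\<^esub>\<close>, elements are finitely supported coefficient functions on words, and the
  product extends concatenation of words.
\<close>

definition tensor_algebra :: "('k, 'm) ring_scheme \<Rightarrow> nat \<Rightarrow> (nat list \<Rightarrow> 'k) ring" where
  "tensor_algebra K n =
     \<lparr>carrier = {f. range f \<subseteq> carrier K \<and> finite {w. f w \<noteq> \<zero>\<^bsub>K\<^esub>} \<and>
                    (\<forall>w. f w \<noteq> \<zero>\<^bsub>K\<^esub> \<longrightarrow> set w \<subseteq> {..<n})},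
      monoid.mult = (\<lambda>f g w. \<Oplus>\<^bsub>K\<^esub>k\<in>{..length w}. f (take k w) \<otimes>\<^bsub>K\<^esub> g (drop k w)),
      one = (\<lambda>w. if w = [] then \<one>\<^bsub>K\<^esub> else \<zero>\<^bsub>K\<^esub>),
      zero = (\<lambda>w. \<zero>\<^bsub>K\<^esub>),
      add = (\<lambda>f g w. f w \<oplus>\<^bsub>K\<^esub> g w)\<rparr>"

definition tensor_scalar :: "('k, 'm) ring_scheme \<Rightarrow> 'k \<Rightarrow> nat list \<Rightarrow> 'k" where
  "tensor_scalar K c = (\<lambda>w. if w = [] then c else \<zero>\<^bsub>K\<^esub>)"

definition tensor_vector :: "('k, 'm) ring_scheme \<Rightarrow> nat \<Rightarrow> (nat \<Rightarrow> 'k) \<Rightarrow> nat list \<Rightarrow> 'k" where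
  "tensor_vector K n v = (\<lambda>w. if \<exists>i<n. w = [i] then v (hd w) else \<zero>\<^bsub>K\<^esub>)"

definition Clifford_ideal ::
  "('k, 'm) ring_scheme \<Rightarrow> nat \<Rightarrow> ((nat \<Rightarrow> 'k) \<Rightarrow> 'k) \<Rightarrow> (nat list \<Rightarrow> 'k) set" where
  "Clifford_ideal K n q =
     genideal (tensor_algebra K n)
       {(tensor_vector K n v \<otimes>\<^bsub>tensor_algebra K n\<^esub> tensor_vector K n v)
          \<ominus>\<^bsub>tensor_algebra K n\<^esub> tensor_scalar K (q v) | v. v \<in> carrier (coord_space K n)}"

definition Clifford_algebra ::
  "('k, 'm) ring_scheme \<Rightarrow> nat \<Rightarrow> ((nat \<Rightarrow> 'k) \<Rightarrow> 'k) \<Rightarrow> (nat list \<Rightarrow> 'k) set ring" where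
  "Clifford_algebra K n q = tensor_algebra K n Quot Clifford_ideal K n q"

definition Clifford_scalar ::
  "('k, 'm) ring_scheme \<Rightarrow> nat \<Rightarrow> ((nat \<Rightarrow> 'k) \<Rightarrow> 'k) \<Rightarrow> 'k \<Rightarrow> (nat list \<Rightarrow> 'k) set" where
  "Clifford_scalar K n q c = Clifford_ideal K n q +>\<^bsub>tensor_algebra K n\<^esub> tensor_scalar K c"

definition Clifford_even ::
  "('k, 'm) ring_scheme \<Rightarrow> nat \<Rightarrow> ((nat \<Rightarrow> 'k) \<Rightarrow> 'k) \<Rightarrow> (nat list \<Rightarrow> 'k) set set" where
  "Clifford_even K n q =
     {Clifford_ideal K n q +>\<^bsub>tensor_algebra K n\<^esub> f | f.
        f \<in> carrier (tensor_algebra K n) \<and> (\<forall>w. f w \<noteq> \<zero>\<^bsub>K\<^esub> \<longrightarrow> even (length w))}"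

definition Clifford_odd ::
  "('k, 'm) ring_scheme \<Rightarrow> nat \<Rightarrow> ((nat \<Rightarrow> 'k) \<Rightarrow> 'k) \<Rightarrow> (nat list \<Rightarrow> 'k) set set" where
  "Clifford_odd K n q =
     {Clifford_ideal K n q +>\<^bsub>tensor_algebra K n\<^esub> f | f.
        f \<in> carrier (tensor_algebra K n) \<and> (\<forall>w. f w \<noteq> \<zero>\<^bsub>K\<^esub> \<longrightarrow> odd (length w))}"


section \<open>Central orders in Clifford superalgebras\<close>

text \<open>
  Every quadratic space of dimension \<open>n\<close> is isometric to one on the coordinate space, so only these
  are considered. The scalar action of \<open>Z\<inverse>Z\<close> on \<open>Z\<inverse>A\<close> is multiplication in \<open>Z\<inverse>A\<close>.
\<close>

definition central_order_in_Clifford :: "'a::ring set \<Rightarrow> 'a set \<Rightarrow> nat \<Rightarrow> bool" where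
  "central_order_in_Clifford A0 A1 n \<longleftrightarrow>
     (let Z = even_center A0; R = localization Z; K = center_field Z in
        Z \<noteq> {0} \<and>
        (\<exists>q. quadratic_form K (coord_space K n) q \<and> nondegenerate K (coord_space K n) q \<and>
          (\<exists>\<phi>\<in>ring_iso R (Clifford_algebra K n q).
             \<phi> ` fractions Z A0 = Clifford_even K n q \<and>
             \<phi> ` fractions Z A1 = Clifford_odd K n q \<and>
             (\<forall>c\<in>carrier K. \<forall>x\<in>carrier R.
                \<phi> (c \<otimes>\<^bsub>R\<^esub> x) = Clifford_scalar K n q c \<otimes>\<^bsub>Clifford_algebra K n q\<^esub> \<phi> x))))"

end

theory Submission
  imports Defs "HOL-Algebra.Subrings"
begin

text \<open>
  Let \<open>M\<close> be a nonzero ideal and write \<open>[x, M]\<close> for superbrackets. For a graded submodule \<open>V\<close> with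
  \<open>[V, [M, A]] \<subseteq> V\<close> the set \<open>T = {x. [x, M] \<subseteq> V}\<close> is a subalgebra (because
  \<open>[x y, a] = [x, y a] \<plusminus> [y, a x]\<close>) normalized by \<open>[M, A]\<close>. If \<open>T\<close> has a noncentral even element \<open>t\<close>
  and \<open>d = [t, \<sqdot>]\<close>, then \<open>[t m, a] = t [m, a] \<plusminus> d(a) m\<close> forces \<open>d(A d(A) M) \<subseteq> T\<close>, hence
  \<open>d\<^sup>2(I) I \<subseteq> T\<close> for the ideal \<open>I = A d(A) M\<close>, and \<open>T\<close> contains a nonzero ideal of \<open>A\<close>. Otherwise the
  even part of \<open>T\<close> is central, and \<open>V\<close> is central unless some nonzero odd \<open>w\<close> satisfies
  \<open>[w, [M, A]\<^sub>1] \<subseteq> Z\<close>. A Lie ideal \<open>L\<close> lies in \<open>T = {x. [x, A] \<subseteq> L}\<close>, which contains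
  \<open>A [T, T] A\<close>; so either \<open>[M, A] \<subseteq> L\<close> for a nonzero ideal \<open>M\<close>, or \<open>[L, L] = 0\<close>, and then the even
  part of \<open>L\<close> is central.

  It remains to see that such a \<open>w\<close> exists only for central orders in \<open>C(1)\<close>, \<open>C(2)\<close>, \<open>C(3)\<close>. The square
  of \<open>w\<close> is central, and \<open>w\<close> can be chosen with \<open>w\<^sup>2 \<noteq> 0\<close>. Conjugation by \<open>w\<close> splits \<open>A\<^sub>0\<close>, up to central
  denominators, into a commuting part \<open>C\<close> and an anticommuting part \<open>C'\<close>; here \<open>C\<close> is commutative and
  \<open>a b + b a\<close> is central for \<open>a, b \<in> C'\<close>. If \<open>C'\<close> has an element \<open>a\<close> with \<open>a\<^sup>2 \<noteq> 0\<close>, the orthogonal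
  generators are \<open>w, w a\<close>, together with \<open>w a f\<close> when some nonzero \<open>f \<in> C\<close> anticommutes with \<open>a\<close>;
  otherwise \<open>A\<^sub>0\<close> is central and \<open>w\<close> is the only generator.
\<close>

section \<open>The tensor algebra\<close>

text \<open>The derivation arguments run through \<open>ad v\<close> with \<open>v\<close> even,
  where it is an ordinary derivation; odd elements are reached only by bracketing them. Once the
  even part of a Lie ideal or of \<open>V\<close> is central, bracketing its odd elements with odd
  brackets lands in \<open>Z\<close>; this is the origin of \<open>W M\<close>. Graded primeness is
  used for homogeneous elements only, and without a unit an ideal inside a submodule has to be
  tested by \<open>x\<close>, \<open>a x\<close>, \<open>x a\<close> and \<open>a x b\<close>.
  Nothing is divided inside \<open>A\<close>: the eigenprojections of conjugation by
  \<open>w\<close> and by \<open>a\<close> appear multiplied by \<open>2 w w\<close> and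
  \<open>2 a a\<close>, and generation holds up to a nonzero central factor. The number 3 is a size
  bound: over the central fractions, \<open>C\<close> is spanned by \<open>1\<close> and at most one
  further element \<open>f\<close>, \<open>C'\<close> is zero or \<open>a C\<close>, and the odd
  part is \<open>w A0\<close>, so the total dimension is 2, 4 or 8. That the Clifford algebra has
  exactly the right size is proved without counting dimensions: tensors are rewritten to increasing
  words, and the products over such words are separated by parity and by signs of
  commutation.\<close>

locale tensor_ring = ring K for K (structure) + fixes n :: nat
begin

abbreviation "T \<equiv> tensor_algebra K n"

definition conv :: "(nat list \<Rightarrow> 'a) \<Rightarrow> (nat list \<Rightarrow> 'a) \<Rightarrow> nat list \<Rightarrow> 'a" where
  "conv f g w = (\<Oplus>k\<in>{..length w}. f (take k w) \<otimes> g (drop k w))"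

definition mono :: "'a \<Rightarrow> nat list \<Rightarrow> nat list \<Rightarrow> 'a" where
  "mono c u = (\<lambda>w. if w = u then c else \<zero>)"

lemma T_simps:
  "\<zero>\<^bsub>T\<^esub> = (\<lambda>w. \<zero>)" "\<one>\<^bsub>T\<^esub> = mono \<one> []" "f \<oplus>\<^bsub>T\<^esub> g = (\<lambda>w. f w \<oplus> g w)" "f \<otimes>\<^bsub>T\<^esub> g = conv f g"
  by (auto simp: tensor_algebra_def conv_def mono_def fun_eq_iff)

lemma T_carrier:
  "f \<in> carrier T \<longleftrightarrow> (\<forall>w. f w \<in> carrier K) \<and> finite {w. f w \<noteq> \<zero>} \<and>
     (\<forall>w. f w \<noteq> \<zero> \<longrightarrow> set w \<subseteq> {..<n})"
  by (auto simp: tensor_algebra_def)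

lemma T_carrierD: "f \<in> carrier T \<Longrightarrow> f w \<in> carrier K"
  by (simp add: T_carrier)

lemma conv_Nil:
  assumes "f [] \<in> carrier K" "g [] \<in> carrier K"
  shows "conv f g [] = f [] \<otimes> g []"
  using assms by (simp add: conv_def)

text \<open>Splitting off the cut before the first letter leaves the convolution of the left
  quotient of \<open>f\<close> by that letter. This recursion lets the ring laws be proved by
  induction on the word with \<open>f\<close> generalized.\<close>

lemma conv_Cons:
  assumes "\<And>w. f w \<in> carrier K" "\<And>w. g w \<in> carrier K"
  shows "conv f g (a # w) = f [] \<otimes> g (a # w) \<oplus> conv (\<lambda>u. f (a # u)) g w"
proof -
  have "conv f g (a # w) = (\<Oplus>k\<in>{..Suc (length w)}. f (take k (a # w)) \<otimes> g (drop k (a # w)))"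
    by (simp add: conv_def)
  also have "\<dots> = (\<Oplus>k\<in>{..length w}. f (take (Suc k) (a # w)) \<otimes> g (drop (Suc k) (a # w))) \<oplus>
      f (take 0 (a # w)) \<otimes> g (drop 0 (a # w))"
    by (rule finsum_Suc2) (use assms in auto)
  also have "\<dots> = conv (\<lambda>u. f (a # u)) g w \<oplus> f [] \<otimes> g (a # w)"
    by (simp add: conv_def)
  finally show ?thesis
    using assms by (simp add: a_comm conv_def Pi_def)
qed

lemma conv_closed:
  assumes "\<And>w. f w \<in> carrier K" "\<And>w. g w \<in> carrier K"
  shows "conv f g w \<in> carrier K"
  using assms by (simp add: conv_def Pi_def)

lemma conv_add_left:
  assumes "\<And>w. f w \<in> carrier K" "\<And>w. f' w \<in> carrier K" "\<And>w. g w \<in> carrier K"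
  shows "conv (\<lambda>u. f u \<oplus> f' u) g w = conv f g w \<oplus> conv f' g w"
  using assms(1,2)
proof (induction w arbitrary: f f')
  case Nil
  then show ?case using assms(3) by (simp add: conv_Nil l_distr)
next
  case (Cons a w)
  note [simp] = Cons.prems assms(3)
  show ?case
    by (simp add: conv_Cons Cons.IH conv_closed l_distr a_ac)
qed

lemma conv_add_right:
  assumes "\<And>w. f w \<in> carrier K" "\<And>w. g w \<in> carrier K" "\<And>w. g' w \<in> carrier K"
  shows "conv f (\<lambda>u. g u \<oplus> g' u) w = conv f g w \<oplus> conv f g' w"
  using assms(1)
proof (induction w arbitrary: f)
  case Nil
  then show ?case using assms(2,3) by (simp add: conv_Nil r_distr)
next
  case (Cons a w)
  note [simp] = Cons.prems assms(2,3)
  show ?case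
    by (simp add: conv_Cons Cons.IH conv_closed r_distr a_ac)
qed

lemma conv_mult_left:
  assumes "c \<in> carrier K" "\<And>w. f w \<in> carrier K" "\<And>w. g w \<in> carrier K"
  shows "conv (\<lambda>u. c \<otimes> f u) g w = c \<otimes> conv f g w"
  using assms(2)
proof (induction w arbitrary: f)
  case Nil
  then show ?case using assms by (simp add: conv_Nil m_assoc)
next
  case (Cons a w)
  note [simp] = Cons.prems assms
  show ?case
    by (simp add: conv_Cons Cons.IH conv_closed r_distr m_assoc)
qed

lemma conv_assoc:
  assumes "\<And>w. f w \<in> carrier K" "\<And>w. g w \<in> carrier K" "\<And>w. h w \<in> carrier K"
  shows "conv (conv f g) h w = conv f (conv g h) w"
  using assms(1,2)
proof (induction w arbitrary: f g)
  case Nil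
  then show ?case using assms by (simp add: conv_Nil conv_closed m_assoc)
next
  case (Cons a w)
  note [simp] = Cons.prems assms
  have "conv (conv f g) h (a # w) = conv f g [] \<otimes> h (a # w) \<oplus>
      conv (\<lambda>u. f [] \<otimes> g (a # u) \<oplus> conv (\<lambda>u. f (a # u)) g u) h w"
    by (simp add: conv_Cons conv_closed)
  also have "conv (\<lambda>u. f [] \<otimes> g (a # u) \<oplus> conv (\<lambda>u. f (a # u)) g u) h w =
      f [] \<otimes> conv (\<lambda>u. g (a # u)) h w \<oplus> conv (\<lambda>u. f (a # u)) (conv g h) w"
    by (simp add: conv_add_left conv_mult_left conv_closed Cons.IH)
  finally show ?case
    by (simp add: conv_Cons conv_Nil conv_closed r_distr m_assoc a_assoc)
qed

lemma conv_zero_left: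
  assumes "\<And>w. g w \<in> carrier K" shows "conv (\<lambda>u. \<zero>) g w = \<zero>"
  using assms by (induction w) (simp_all add: conv_Nil conv_Cons)

lemma conv_mono_Nil:
  assumes "c \<in> carrier K" "\<And>w. g w \<in> carrier K"
  shows "conv (mono c []) g w = c \<otimes> g w"
proof (cases w)
  case Nil then show ?thesis using assms by (simp add: conv_Nil mono_def)
next
  case (Cons a u)
  then show ?thesis using assms by (simp add: conv_Cons mono_def conv_zero_left)
qed

lemma conv_mono:
  assumes "c \<in> carrier K" "d \<in> carrier K"
  shows "conv (mono c u) (mono d v) = mono (c \<otimes> d) (u @ v)"
proof (induction u)
  case Nil
  have "c \<otimes> mono d v w = mono (c \<otimes> d) v w" for w
    using assms by (simp add: mono_def)
  then show ?case
    using assms by (subst fun_eq_iff) (simp add: conv_mono_Nil[OF assms(1)] mono_def[of d])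
next
  case (Cons a u)
  show ?case
  proof
    fix w show "conv (mono c (a # u)) (mono d v) w = mono (c \<otimes> d) ((a # u) @ v) w"
    proof (cases w)
      case Nil then show ?thesis using assms by (simp add: conv_Nil mono_def)
    next
      case (Cons b w')
      have *: "(\<lambda>x. mono c (a # u) (b # x)) = (if b = a then mono c u else (\<lambda>x. \<zero>))"
        by (auto simp: mono_def fun_eq_iff)
      have "conv (mono c (a # u)) (mono d v) w =
          mono c (a # u) [] \<otimes> mono d v (b # w') \<oplus> conv (\<lambda>x. mono c (a # u) (b # x)) (mono d v) w'"
        unfolding Cons by (rule conv_Cons) (use assms in \<open>auto simp: mono_def\<close>)
      also have "\<dots> = (if b = a then conv (mono c u) (mono d v) w' else \<zero>)"
        using assms by (auto simp: * conv_zero_left conv_closed mono_def)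
      finally show ?thesis
        unfolding Cons.IH Cons by (auto simp: mono_def)
    qed
  qed
qed

lemma conv_mono_one_right:
  assumes "\<And>w. f w \<in> carrier K"
  shows "conv f (mono \<one> []) w = f w"
  using assms
proof (induction w arbitrary: f)
  case Nil then show ?case by (simp add: conv_Nil mono_def)
next
  case (Cons a w)
  then show ?case by (subst conv_Cons) (auto simp: mono_def)
qed

lemma conv_support:
  assumes "\<And>w. f w \<in> carrier K" "\<And>w. g w \<in> carrier K" "conv f g w \<noteq> \<zero>"
  shows "\<exists>u v. w = u @ v \<and> f u \<noteq> \<zero> \<and> g v \<noteq> \<zero>"
proof (rule ccontr)
  assume *: "\<not> ?thesis"
  have "f (take k w) \<otimes> g (drop k w) = \<zero>" for k
    using * assms(1,2) append_take_drop_id[of k w, symmetric] by (metis l_null r_null)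
  then have "conv f g w = \<zero>"
    by (simp add: conv_def)
  with assms(3) show False by simp
qed

lemma mono_closed: "c \<in> carrier K \<Longrightarrow> set u \<subseteq> {..<n} \<Longrightarrow> mono c u \<in> carrier T"
  by (auto simp: T_carrier mono_def)

lemma conv_T_closed: "f \<in> carrier T \<Longrightarrow> g \<in> carrier T \<Longrightarrow> conv f g \<in> carrier T"
proof -
  assume f: "f \<in> carrier T" and g: "g \<in> carrier T"
  then have c: "\<And>w. f w \<in> carrier K" "\<And>w. g w \<in> carrier K" by (auto simp: T_carrier)
  have sub: "{w. conv f g w \<noteq> \<zero>} \<subseteq> (\<lambda>(u, v). u @ v) ` ({w. f w \<noteq> \<zero>} \<times> {w. g w \<noteq> \<zero>})"
    using conv_support[OF c] by fastforce
  have "finite {w. conv f g w \<noteq> \<zero>}"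
    by (rule finite_subset[OF sub]) (use f g in \<open>auto simp: T_carrier\<close>)
  moreover have "set w \<subseteq> {..<n}" if w: "conv f g w \<noteq> \<zero>" for w
    using conv_support[OF c w] f g by (fastforce simp: T_carrier)
  ultimately show "conv f g \<in> carrier T"
    using c by (simp add: T_carrier conv_closed)
qed

lemma add_T_closed: "f \<in> carrier T \<Longrightarrow> g \<in> carrier T \<Longrightarrow> (\<lambda>w. f w \<oplus> g w) \<in> carrier T"
proof -
  assume f: "f \<in> carrier T" and g: "g \<in> carrier T"
  have "{w. f w \<oplus> g w \<noteq> \<zero>} \<subseteq> {w. f w \<noteq> \<zero>} \<union> {w. g w \<noteq> \<zero>}"
    by auto
  then have "finite {w. f w \<oplus> g w \<noteq> \<zero>}"
    by (rule finite_subset) (use f g in \<open>auto simp: T_carrier\<close>)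
  moreover have "set w \<subseteq> {..<n}" if "f w \<oplus> g w \<noteq> \<zero>" for w
    using that f g by (metis T_carrier l_zero zero_closed)
  ultimately show ?thesis
    using f g by (simp add: T_carrier)
qed

lemma neg_T_closed: "f \<in> carrier T \<Longrightarrow> (\<lambda>w. \<ominus> f w) \<in> carrier T"
proof -
  assume f: "f \<in> carrier T"
  have "(\<ominus> f w \<noteq> \<zero>) = (f w \<noteq> \<zero>)" for w
    using f by (metis T_carrier minus_minus minus_zero)
  then show ?thesis using f by (simp add: T_carrier)
qed

lemma T_ring: "ring T"
proof (rule ringI)
  show "abelian_group T"
  proof (rule abelian_groupI)
    fix f assume f: "f \<in> carrier T"
    show "\<exists>g\<in>carrier T. g \<oplus>\<^bsub>T\<^esub> f = \<zero>\<^bsub>T\<^esub>"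
      using f by (intro bexI[OF _ neg_T_closed[OF f]]) (simp add: T_simps T_carrier l_neg)
  qed (auto simp: T_simps add_T_closed fun_eq_iff a_ac T_carrierD, simp add: T_carrier)
  show "Group.monoid T"
    by (rule monoidI)
      (auto simp: T_simps fun_eq_iff T_carrierD conv_T_closed mono_closed conv_assoc conv_mono_Nil
        conv_mono_one_right)
qed (auto simp: T_simps fun_eq_iff T_carrierD conv_add_left conv_add_right)

sublocale T: ring T
  by (rule T_ring)

lemma T_minus: "f \<in> carrier T \<Longrightarrow> \<ominus>\<^bsub>T\<^esub> f = (\<lambda>w. \<ominus> f w)"
  by (rule T.minus_equality)
    (auto simp: neg_T_closed T_simps T_carrierD l_neg)

text \<open>Words are removed from the support one at a time. The predicate \<open>Q\<close> records
  which words may occur, so that one rule serves for tensors of even length, of odd length, or over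
  words with a prescribed commutation behaviour.\<close>

lemma T_induct [consumes 2, case_names zero mono add]:
  assumes "f \<in> carrier T" "\<And>w. f w \<noteq> \<zero> \<Longrightarrow> Q w"
    and zero: "P (\<lambda>w. \<zero>)"
    and mono: "\<And>c u. c \<in> carrier K \<Longrightarrow> set u \<subseteq> {..<n} \<Longrightarrow> Q u \<Longrightarrow> P (mono c u)"
    and add: "\<And>f g. f \<in> carrier T \<Longrightarrow> g \<in> carrier T \<Longrightarrow> P f \<Longrightarrow> P g \<Longrightarrow> P (f \<oplus>\<^bsub>T\<^esub> g)"
  shows "P f"
proof -
  have "finite S \<Longrightarrow> f \<in> carrier T \<Longrightarrow> {w. f w \<noteq> \<zero>} \<subseteq> S \<Longrightarrow> Ball S Q \<Longrightarrow> P f" for S f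
  proof (induction S arbitrary: f rule: finite_induct)
    case empty
    then have "f = (\<lambda>w. \<zero>)" by auto
    then show ?case using zero by simp
  next
    case (insert u S)
    show ?case
    proof (cases "f u = \<zero>")
      case True
      then show ?thesis using insert by auto
    next
      case False
      let ?g = "f(u := \<zero>)"
      have u: "set u \<subseteq> {..<n}" "f u \<in> carrier K" "Q u"
        using insert.prems False by (auto simp: T_carrier)
      have "{w. ?g w \<noteq> \<zero>} \<subseteq> {w. f w \<noteq> \<zero>}" by auto
      then have g: "?g \<in> carrier T" using insert.prems(1)
        by (auto simp: T_carrier intro: finite_subset)
      have "P ?g"
        by (rule insert.IH[OF g]) (use insert.prems in \<open>auto split: if_splits\<close>)
      moreover have "f = mono (f u) u \<oplus>\<^bsub>T\<^esub> ?g"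
        using insert.prems(1) by (auto simp: T_simps mono_def fun_eq_iff T_carrierD)
      ultimately show ?thesis
        using add[OF mono_closed[OF u(2,1)] g mono[OF u(2,1,3)]] by metis
    qed
  qed
  from this[of "{w. f w \<noteq> \<zero>}" f] show ?thesis using assms(1,2) by (auto simp: T_carrier)
qed

text \<open>Makes the support of a product with a single letter readable, which the rewriting to
  increasing words relies on.\<close>

lemma conv_mono_single:
  assumes "c \<in> carrier K" "\<And>w. g w \<in> carrier K"
  shows "conv (mono c [a]) g w = (case w of [] \<Rightarrow> \<zero> | b # u \<Rightarrow> if b = a then c \<otimes> g u else \<zero>)"
proof (cases w)
  case Nil then show ?thesis using assms by (simp add: conv_Nil mono_def)
next
  case (Cons b u)
  have *: "(\<lambda>x. mono c [a] (b # x)) = (if b = a then mono c [] else (\<lambda>x. \<zero>))"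
    by (auto simp: mono_def fun_eq_iff)
  have "conv (mono c [a]) g (b # u) =
      mono c [a] [] \<otimes> g (b # u) \<oplus> conv (\<lambda>x. mono c [a] (b # x)) g u"
    by (rule conv_Cons) (use assms in \<open>auto simp: mono_def\<close>)
  also have "\<dots> = (if b = a then c \<otimes> g u else \<zero>)"
    using assms by (auto simp: * conv_zero_left conv_mono_Nil) (auto simp: mono_def)
  finally show ?thesis unfolding Cons by simp
qed

end

section \<open>Recognition of Clifford algebras\<close>

text \<open>Used in both directions: in \<open>R\<close> anticommutation computes the quadratic form
  at a sum of two unit vectors, and in the Clifford algebra the relator at that sum gives
  anticommutation back.\<close>

lemma (in ring) anticommute_iff_square:
  assumes x: "x \<in> carrier R" and y: "y \<in> carrier R"
  shows "x \<otimes> y = \<ominus> (y \<otimes> x) \<longleftrightarrow> (x \<oplus> y) \<otimes> (x \<oplus> y) = x \<otimes> x \<oplus> y \<otimes> y"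
proof -
  have "(x \<oplus> y) \<otimes> (x \<oplus> y) = (x \<otimes> y \<oplus> y \<otimes> x) \<oplus> (x \<otimes> x \<oplus> y \<otimes> y)"
    using x y by (simp add: l_distr r_distr a_ac)
  also have "\<dots> = x \<otimes> x \<oplus> y \<otimes> y \<longleftrightarrow> x \<otimes> y \<oplus> y \<otimes> x = \<zero>"
    using x y by (metis add.l_cancel_one' add.r_cancel_one m_closed a_closed)
  also have "\<dots> \<longleftrightarrow> x \<otimes> y = \<ominus> (y \<otimes> x)"
    using x y by (metis m_closed minus_equality l_neg)
  finally show ?thesis by simp
qed

text \<open>An abstraction of the localization: \<open>k\<close> stands for the central fractions,
  \<open>R0\<close> and \<open>R1\<close> for the graded pieces. Regularity of nonzero scalars
  stands in for division, and generation is phrased through subrings so that it applies directly to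
  the image of the evaluation map.\<close>

locale clifford_generators = ring R for R (structure) +
  fixes k :: "'a set" and n :: nat and e :: "nat \<Rightarrow> 'a" and R0 R1 :: "'a set"
  assumes k: "subring k R"
    and k_central: "c \<in> k \<Longrightarrow> x \<in> carrier R \<Longrightarrow> x \<otimes> c = c \<otimes> x"
    and k_regular: "c \<in> k \<Longrightarrow> x \<in> carrier R \<Longrightarrow> c \<otimes> x = \<zero> \<Longrightarrow> c = \<zero> \<or> x = \<zero>"
    and two_regular: "x \<in> carrier R \<Longrightarrow> x \<oplus> x = \<zero> \<Longrightarrow> x = \<zero>"
    and e_R1: "i < n \<Longrightarrow> e i \<in> R1"
    and e_anti: "i < n \<Longrightarrow> j < n \<Longrightarrow> i \<noteq> j \<Longrightarrow> e i \<otimes> e j = \<ominus> (e j \<otimes> e i)"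
    and e_sq: "i < n \<Longrightarrow> e i \<otimes> e i \<in> k" "i < n \<Longrightarrow> e i \<otimes> e i \<noteq> \<zero>"
    and generated: "subring S R \<Longrightarrow> k \<subseteq> S \<Longrightarrow> e ` {..<n} \<subseteq> S \<Longrightarrow> carrier R \<subseteq> S"
    and R01: "R0 \<subseteq> carrier R" "R1 \<subseteq> carrier R" "R0 \<inter> R1 = {\<zero>}" "k \<subseteq> R0"
    and R0_add: "x \<in> R0 \<Longrightarrow> y \<in> R0 \<Longrightarrow> x \<oplus> y \<in> R0"
    and R1_add: "x \<in> R1 \<Longrightarrow> y \<in> R1 \<Longrightarrow> x \<oplus> y \<in> R1"
    and R00: "x \<in> R0 \<Longrightarrow> y \<in> R0 \<Longrightarrow> x \<otimes> y \<in> R0"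
    and R01m: "x \<in> R0 \<Longrightarrow> y \<in> R1 \<Longrightarrow> x \<otimes> y \<in> R1"
    and R10m: "x \<in> R1 \<Longrightarrow> y \<in> R0 \<Longrightarrow> x \<otimes> y \<in> R1"
    and R11: "x \<in> R1 \<Longrightarrow> y \<in> R1 \<Longrightarrow> x \<otimes> y \<in> R0"
begin

abbreviation "K \<equiv> R\<lparr>carrier := k\<rparr>"

lemma K_ring: "ring K"
  using k by (rule subring_is_ring)

sublocale K: tensor_ring K n
  by (intro tensor_ring.intro K_ring)

abbreviation "T \<equiv> tensor_algebra K n"

lemma k_closed [simp]: "c \<in> k \<Longrightarrow> c \<in> carrier R"
  using subringE(1)[OF k] by auto

lemma k_ops [simp]:
  "\<zero> \<in> k" "\<one> \<in> k" "c \<in> k \<Longrightarrow> \<ominus> c \<in> k"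
  "c \<in> k \<Longrightarrow> d \<in> k \<Longrightarrow> c \<oplus> d \<in> k" "c \<in> k \<Longrightarrow> d \<in> k \<Longrightarrow> c \<otimes> d \<in> k"
  using subringE[OF k] by auto

lemma K_neg: "c \<in> k \<Longrightarrow> \<ominus>\<^bsub>K\<^esub> c = \<ominus> c"
  by (rule K.minus_equality) (auto simp: l_neg)

lemma e_closed [simp]: "i < n \<Longrightarrow> e i \<in> carrier R"
  using e_R1 R01 by auto

section \<open>Evaluation of tensors at the generators\<close>

definition eprod :: "nat list \<Rightarrow> 'a" where
  "eprod w = foldr (\<lambda>i x. e i \<otimes> x) w \<one>"

lemma eprod_simps [simp]: "eprod [] = \<one>" "eprod (i # w) = e i \<otimes> eprod w"
  by (auto simp: eprod_def)

lemma eprod_closed [simp]: "set w \<subseteq> {..<n} \<Longrightarrow> eprod w \<in> carrier R"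
  by (induction w) auto

lemma eprod_append: "set u \<subseteq> {..<n} \<Longrightarrow> set v \<subseteq> {..<n} \<Longrightarrow> eprod (u @ v) = eprod u \<otimes> eprod v"
  by (induction u) (auto simp: m_assoc)

text \<open>The homomorphism from the tensor algebra given by its universal property, written as a
  sum over the finite support.\<close>

definition h :: "(nat list \<Rightarrow> 'a) \<Rightarrow> 'a" where
  "h f = (\<Oplus>w\<in>{w. f w \<noteq> \<zero>}. f w \<otimes> eprod w)"

lemma T_k: "f \<in> carrier T \<Longrightarrow> f w \<in> k"
  using K.T_carrierD[of f w] by simp

lemma T_letters: "f \<in> carrier T \<Longrightarrow> f w \<noteq> \<zero> \<Longrightarrow> set w \<subseteq> {..<n}"
  by (simp add: K.T_carrier)

lemma T_finite: "f \<in> carrier T \<Longrightarrow> finite {w. f w \<noteq> \<zero>}"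
  by (simp add: K.T_carrier)

lemma T_term_closed: "f \<in> carrier T \<Longrightarrow> f w \<noteq> \<zero> \<Longrightarrow> f w \<otimes> eprod w \<in> carrier R"
  using T_k T_letters by simp

text \<open>Two tensors with different supports can be added under \<open>h\<close> only after their
  sums run over a common finite index set.\<close>

lemma h_superset:
  assumes f: "f \<in> carrier T" and S: "finite S" "{w. f w \<noteq> \<zero>} \<subseteq> S" "\<And>w. w \<in> S \<Longrightarrow> set w \<subseteq> {..<n}"
  shows "h f = (\<Oplus>w\<in>S. f w \<otimes> eprod w)"
  unfolding h_def
  by (rule add.finprod_mono_neutral_cong_left) (use assms T_k in \<open>auto\<close>)

lemma h_closed [simp]: "f \<in> carrier T \<Longrightarrow> h f \<in> carrier R"
  unfolding h_def by (rule finsum_closed) (auto simp: T_term_closed)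

lemma T_add: "f \<oplus>\<^bsub>T\<^esub> g = (\<lambda>w. f w \<oplus> g w)"
  by (simp add: K.T_simps)

lemma h_add: 
  assumes f: "f \<in> carrier T" and g: "g \<in> carrier T"
  shows "h (f \<oplus>\<^bsub>T\<^esub> g) = h f \<oplus> h g"
proof -
  let ?S = "{w. f w \<noteq> \<zero>} \<union> {w. g w \<noteq> \<zero>}"
  have S: "finite ?S" "\<And>w. w \<in> ?S \<Longrightarrow> set w \<subseteq> {..<n}"
    using f g by (auto simp: K.T_carrier)
  have "h (f \<oplus>\<^bsub>T\<^esub> g) = (\<Oplus>w\<in>?S. (f w \<oplus> g w) \<otimes> eprod w)"
    by (subst h_superset[OF _ S(1) _ S(2)]) (use f g in \<open>auto simp: T_add intro: K.add_T_closed[simplified]\<close>)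
  also have "\<dots> = (\<Oplus>w\<in>?S. f w \<otimes> eprod w \<oplus> g w \<otimes> eprod w)"
    by (rule finsum_cong') (use S T_k f g in \<open>auto simp: l_distr\<close>)
  also have "\<dots> = (\<Oplus>w\<in>?S. f w \<otimes> eprod w) \<oplus> (\<Oplus>w\<in>?S. g w \<otimes> eprod w)"
    by (rule finsum_addf) (use S T_k f g in auto)
  also have "\<dots> = h f \<oplus> h g"
    using h_superset[OF f S(1) _ S(2)] h_superset[OF g S(1) _ S(2)] by auto
  finally show ?thesis .
qed

lemma h_mono:
  assumes "c \<in> k" "set u \<subseteq> {..<n}"
  shows "h (K.mono c u) = c \<otimes> eprod u"
proof -
  have "h (K.mono c u) = (\<Oplus>w\<in>{u}. K.mono c u w \<otimes> eprod w)"
    by (rule h_superset) (use assms K.mono_closed[of c u] in \<open>auto simp: K.mono_def\<close>)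
  also have "\<dots> = c \<otimes> eprod u"
    using assms by (simp add: K.mono_def)
  finally show ?thesis .
qed

lemma h_zero: "h (\<lambda>w. \<zero>) = \<zero>"
  by (simp add: h_def)

lemma zero_T: "(\<lambda>w. \<zero>) \<in> carrier T"
  using K.T.zero_closed by (simp add: K.T_simps)

lemma mono_T: "c \<in> k \<Longrightarrow> set u \<subseteq> {..<n} \<Longrightarrow> K.mono c u \<in> carrier T"
  using K.mono_closed by simp

lemma mono_mult: "c \<in> k \<Longrightarrow> d \<in> k \<Longrightarrow>
    K.mono c u \<otimes>\<^bsub>T\<^esub> K.mono d v = K.mono (c \<otimes> d) (u @ v)"
  using K.conv_mono by (simp add: K.T_simps)

lemmas T_ind = K.T_induct[simplified, consumes 2, case_names zero mono add]

lemma h_mult: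
  assumes f: "f \<in> carrier T" and g: "g \<in> carrier T"
  shows "h (f \<otimes>\<^bsub>T\<^esub> g) = h f \<otimes> h g"
  using f TrueI
proof (induction rule: T_ind)
  case zero
  have "(\<lambda>w. \<zero>) \<otimes>\<^bsub>T\<^esub> g = (\<lambda>w. \<zero>)" using K.T.l_null[OF g] by (simp add: K.T_simps)
  then show ?case using g by (simp add: h_zero)
next
  case (add f f')
  then show ?case using g by (simp add: K.T.l_distr h_add l_distr)
next
  case (mono c u)
  note cu = mono
  show ?case
    using g TrueI
  proof (induction rule: T_ind)
    case zero
    have "K.mono c u \<otimes>\<^bsub>T\<^esub> (\<lambda>w. \<zero>) = (\<lambda>w. \<zero>)"
      using K.T.r_null[OF mono_T[OF cu(1,2)]] by (simp add: K.T_simps)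
    then show ?case using cu by (simp add: h_zero h_mono)
  next
    case (add f f')
    then show ?case using cu by (simp add: K.T.r_distr h_add r_distr mono_T)
  next
    case (mono d v)
    \<comment> \<open>Multiplicativity comes down to moving the scalar \<open>d\<close> to the left
      past \<open>eprod u\<close>, which is where centrality of \<open>k\<close> enters.\<close>
    have "c \<otimes> d \<otimes> (eprod u \<otimes> eprod v) = c \<otimes> (eprod u \<otimes> d) \<otimes> eprod v"
      using k_central[of d "eprod u"] cu mono by (simp add: m_assoc)
    then show ?case using cu mono by (simp add: mono_mult h_mono eprod_append m_assoc)
  qed
qed

lemma h_one: "h \<one>\<^bsub>T\<^esub> = \<one>"
  using h_mono[of \<one> "[]"] by (simp add: K.T_simps)

sublocale H: ring_hom_ring T R h
  by (rule ring_hom_ringI) (auto simp: K.T_ring ring_axioms h_mult h_add h_one)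

lemma h_surj: "h ` carrier T = carrier R"
proof
  show "carrier R \<subseteq> h ` carrier T"
  proof (rule generated)
    show "subring (h ` carrier T) R"
      by (rule H.img_is_subring[OF K.T.carrier_is_subring])
    show "k \<subseteq> h ` carrier T"
    proof
      fix c assume c: "c \<in> k"
      show "c \<in> h ` carrier T"
        by (rule image_eqI[where x = "K.mono c []"]) (use c in \<open>auto simp: h_mono mono_T\<close>)
    qed
    show "e ` {..<n} \<subseteq> h ` carrier T"
    proof clarify
      fix i assume i: "i < n"
      show "e i \<in> h ` carrier T"
        by (rule image_eqI[where x = "K.mono \<one> [i]"]) (use i in \<open>auto simp: h_mono mono_T\<close>)
    qed
  qed
qed auto

section \<open>Independence of the products over strictly increasing words\<close>

definition word :: "nat list \<Rightarrow> bool" where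
  "word w \<longleftrightarrow> sorted_wrt (<) w \<and> set w \<subseteq> {..<n}"

definition restr :: "(nat list \<Rightarrow> bool) \<Rightarrow> (nat list \<Rightarrow> 'a) \<Rightarrow> nat list \<Rightarrow> 'a" where
  "restr D f = (\<lambda>w. if D w then f w else \<zero>)"

lemma restr_T: "f \<in> carrier T \<Longrightarrow> restr D f \<in> carrier T"
  by (auto simp: K.T_carrier restr_def intro: finite_subset[rotated])

lemma restr_split:
  assumes "f \<in> carrier T" shows "restr D f \<oplus>\<^bsub>T\<^esub> restr (\<lambda>w. \<not> D w) f = f"
  using T_k[OF assms] by (auto simp: T_add restr_def fun_eq_iff)

lemma h_restr_split:
  assumes "f \<in> carrier T" shows "h (restr D f) \<oplus> h (restr (\<lambda>w. \<not> D w) f) = h f"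
  using assms by (simp add: h_add[symmetric] restr_T restr_split)

lemma zero_R01: "\<zero> \<in> R0" "\<zero> \<in> R1"
  using R01(3) by auto

lemma eprod_graded: "set w \<subseteq> {..<n} \<Longrightarrow> eprod w \<in> (if even (length w) then R0 else R1)"
proof (induction w)
  case Nil then show ?case using R01(4) by auto
next
  case (Cons i w) then show ?case using e_R1 R10m R11 by auto
qed

lemma h_even: "f \<in> carrier T \<Longrightarrow> (\<And>w. f w \<noteq> \<zero> \<Longrightarrow> even (length w)) \<Longrightarrow> h f \<in> R0"
proof (induction rule: T_ind)
  case zero then show ?case by (simp add: h_zero zero_R01)
next
  case (mono c u) then show ?case
    using eprod_graded[of u] R01(4) R00 by (auto simp: h_mono)
next
  case (add f g) then show ?case by (simp add: h_add R0_add)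
qed

lemma h_odd: "f \<in> carrier T \<Longrightarrow> (\<And>w. f w \<noteq> \<zero> \<Longrightarrow> odd (length w)) \<Longrightarrow> h f \<in> R1"
proof (induction rule: T_ind)
  case zero then show ?case by (simp add: h_zero zero_R01)
next
  case (mono c u) then show ?case
    using eprod_graded[of u] R01(4) R01m by (auto simp: h_mono)
next
  case (add f g) then show ?case by (simp add: h_add R1_add)
qed

text \<open>Moving \<open>e i\<close> through a product of distinct generators changes the sign once
  for every letter other than \<open>i\<close>; the condition says that the number of these letters
  is even.\<close>

definition commuting :: "nat \<Rightarrow> nat list \<Rightarrow> bool" where
  "commuting i w \<longleftrightarrow> even (length w) = (i \<notin> set w)"

lemma e_eprod:
  assumes "i < n"
  shows "distinct w \<Longrightarrow> set w \<subseteq> {..<n} \<Longrightarrow>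
    e i \<otimes> eprod w = (if commuting i w then eprod w \<otimes> e i else \<ominus> (eprod w \<otimes> e i))"
proof (induction w)
  case Nil then show ?case using assms by (simp add: commuting_def)
next
  case (Cons j w)
  show ?case
  proof (cases "j = i")
    case True
    have "e i \<otimes> (e i \<otimes> eprod w) = (if commuting i w then e i \<otimes> (eprod w \<otimes> e i) else \<ominus> (e i \<otimes> (eprod w \<otimes> e i)))"
      using Cons assms by (simp add: r_minus)
    then show ?thesis
      using True Cons.prems assms by (auto simp: commuting_def m_assoc)
  next
    case False
    have "e i \<otimes> (e j \<otimes> eprod w) = \<ominus> (e j \<otimes> (e i \<otimes> eprod w))"
      using False Cons.prems assms e_anti[of i j] by (simp add: m_assoc[symmetric] l_minus)
    also have "\<dots> = (if commuting i w then \<ominus> (e j \<otimes> (eprod w \<otimes> e i)) else e j \<otimes> (eprod w \<otimes> e i))"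
      using Cons assms by (simp add: r_minus)
    finally show ?thesis
      using False Cons.prems assms by (auto simp: commuting_def m_assoc)
  qed
qed

lemma word_distinct: "word w \<Longrightarrow> distinct w"
  using strict_sorted_iff by (auto simp: word_def)

lemma e_h_commuting:
  assumes i: "i < n"
  shows "f \<in> carrier T \<Longrightarrow> (\<And>w. f w \<noteq> \<zero> \<Longrightarrow> word w \<and> commuting i w) \<Longrightarrow> e i \<otimes> h f = h f \<otimes> e i"
proof (induction rule: T_ind)
  case zero then show ?case using i by (simp add: h_zero)
next
  case (mono c u)
  have "e i \<otimes> (c \<otimes> eprod u) = c \<otimes> (e i \<otimes> eprod u)"
    using mono i k_central[of c "e i"] by (simp add: m_assoc[symmetric])
  then show ?case using mono i e_eprod[OF i word_distinct] by (simp add: h_mono m_assoc)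
next
  case (add f g) then show ?case using i by (simp add: h_add r_distr l_distr)
qed

lemma e_h_anticommuting:
  assumes i: "i < n"
  shows "f \<in> carrier T \<Longrightarrow> (\<And>w. f w \<noteq> \<zero> \<Longrightarrow> word w \<and> \<not> commuting i w) \<Longrightarrow> e i \<otimes> h f = \<ominus> (h f \<otimes> e i)"
proof (induction rule: T_ind)
  case zero then show ?case using i by (simp add: h_zero)
next
  case (mono c u)
  have "e i \<otimes> (c \<otimes> eprod u) = c \<otimes> (e i \<otimes> eprod u)"
    using mono i k_central[of c "e i"] by (simp add: m_assoc[symmetric])
  then show ?case using mono i e_eprod[OF i word_distinct] by (simp add: h_mono m_assoc r_minus)
next
  case (add f g) then show ?case using i by (simp add: h_add r_distr l_distr minus_add)
qed

text \<open>A second multiplication by \<open>e i\<close> produces the nonzero scalar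
  \<open>e i \<otimes> e i\<close>, which can be cancelled.\<close>

lemma e_regular:
  assumes "i < n" "x \<in> carrier R" "e i \<otimes> x = \<zero>" shows "x = \<zero>"
proof -
  have "(e i \<otimes> e i) \<otimes> x = \<zero>" using assms by (simp add: m_assoc)
  then show ?thesis using assms k_regular[OF e_sq(1)] e_sq(2) by blast
qed

lemma eprod_regular:
  "set w \<subseteq> {..<n} \<Longrightarrow> x \<in> carrier R \<Longrightarrow> eprod w \<otimes> x = \<zero> \<Longrightarrow> x = \<zero>"
  by (induction w) (auto simp: m_assoc dest: e_regular[rotated 2])

text \<open>The two parts of \<open>h f\<close> lie in different eigenspaces, either of the grading
  or of commutation with \<open>e i\<close>. A vanishing sum of such parts has vanishing parts, in
  the second case because \<open>2\<close> and \<open>e i\<close> can be cancelled.\<close>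

lemma h_restr_zero:
  assumes f: "f \<in> carrier T" "\<And>w. f w \<noteq> \<zero> \<Longrightarrow> word w" "h f = \<zero>"
    and D: "D = (\<lambda>w. even (length w)) \<or> (\<exists>i<n. D = commuting i)"
  shows "h (restr D f) = \<zero>"
proof -
  let ?X = "h (restr D f)" and ?Y = "h (restr (\<lambda>w. \<not> D w) f)"
  have XY: "?X \<in> carrier R" "?Y \<in> carrier R" "?X \<oplus> ?Y = \<zero>"
    using f by (simp_all add: restr_T h_restr_split)
  from D show ?thesis
  proof (elim disjE exE conjE)
    assume D: "D = (\<lambda>w. even (length w))"
    have X: "?X \<in> R0" using f(1)
      by (intro h_even restr_T) (auto simp: restr_def D split: if_splits)
    have Y: "?Y \<in> R1" using f(1)
      by (intro h_odd restr_T) (auto simp: restr_def D split: if_splits)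
    have "?X = \<ominus> ?Y" using XY by (simp add: minus_equality)
    also have "\<dots> = \<ominus> \<one> \<otimes> ?Y" using XY by (simp add: l_minus)
    also have "\<dots> \<in> R1" using R01m[of "\<ominus> \<one>" ?Y] Y R01(4) k_ops by blast
    finally show ?thesis using X R01(3) by auto
  next
    fix i assume i: "i < n" and D: "D = commuting i"
    have 1: "e i \<otimes> ?X = ?X \<otimes> e i" using f(1,2)
      by (intro e_h_commuting i restr_T) (auto simp: restr_def D split: if_splits)
    have 2: "e i \<otimes> ?Y = \<ominus> (?Y \<otimes> e i)" using f(1,2)
      by (intro e_h_anticommuting i restr_T) (auto simp: restr_def D split: if_splits)
    have Y: "?Y = \<ominus> ?X" using XY by (metis minus_equality a_comm)
    have "e i \<otimes> ?X = \<ominus> (e i \<otimes> ?X)"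
      using 2 XY(1) i by (simp add: Y 1 r_minus l_minus)
    then have "e i \<otimes> ?X \<oplus> e i \<otimes> ?X = \<zero>"
      using XY(1) i by (metis r_neg m_closed e_closed)
    then show ?thesis using XY(1) i by (metis two_regular m_closed e_closed e_regular)
  qed
qed

text \<open>Strictly sorted words are determined by their letters. If the lengths have equal parity,
  a letter occurring in just one of the words commutes with exactly one of the two products.\<close>

lemma separate:
  assumes "word u" "word v" "u \<noteq> v"
  obtains D where "D = (\<lambda>w. even (length w)) \<or> (\<exists>i<n. D = commuting i)" "D u \<noteq> D v"
proof (cases "even (length u) = even (length v)")
  case True
  have "set u \<noteq> set v"
    using assms by (metis strict_sorted_equal word_def)
  then obtain i where i: "(i \<in> set u) \<noteq> (i \<in> set v)" by auto
  then have "i < n" using assms by (auto simp: word_def)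
  moreover have "commuting i u \<noteq> commuting i v" using i True by (auto simp: commuting_def)
  ultimately show ?thesis using that by blast
next
  case False
  then show ?thesis using that[of "\<lambda>w. even (length w)"] by auto
qed

text \<open>Words are told apart by the parity of their length and by which generators they commute with.\<close>

lemma h_inj_words:
  assumes "f \<in> carrier T" "\<And>w. f w \<noteq> \<zero> \<Longrightarrow> word w" "h f = \<zero>"
  shows "f w = \<zero>"
  using assms
proof (induction "card {w. f w \<noteq> \<zero>}" arbitrary: f w rule: less_induct)
  case less
  show ?case
  proof (rule ccontr)
    assume w: "f w \<noteq> \<zero>"
    show False
    proof (cases "\<exists>v. f v \<noteq> \<zero> \<and> v \<noteq> w")
      case True
      then obtain v where v: "f v \<noteq> \<zero>" "v \<noteq> w" by auto
      obtain D where D: "D = (\<lambda>w. even (length w)) \<or> (\<exists>i<n. D = commuting i)" "D v \<noteq> D w"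
        using separate[of v w] v w less.prems(2) by metis
      have X: "h (restr D f) = \<zero>"
        by (rule h_restr_zero) (use less.prems D in auto)
      then have Y: "h (restr (\<lambda>w. \<not> D w) f) = \<zero>"
        using h_restr_split[OF less.prems(1), of D] less.prems by (simp add: restr_T)
      \<comment> \<open>Both restrictions evaluate to zero. \<open>E\<close> is the one that keeps
        \<open>w\<close> and drops \<open>v\<close>, so its support is strictly smaller and the
        induction applies.\<close>
      obtain E where E: "h (restr E f) = \<zero>" "E w" "\<not> E v"
        using X Y D(2) by (cases "D w") auto
      have "card {u. restr E f u \<noteq> \<zero>} < card {u. f u \<noteq> \<zero>}"
        by (rule psubset_card_mono) (use less.prems T_finite v E in \<open>auto simp: restr_def\<close>)
      moreover have "restr E f u \<noteq> \<zero> \<Longrightarrow> word u" for u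
        using less.prems(2) by (auto simp: restr_def split: if_splits)
      ultimately have "restr E f w = \<zero>"
        using less.hyps[OF _ restr_T[OF less.prems(1)] _ E(1)] by blast
      then show False using E(2) w by (simp add: restr_def)
    next
      case False
      then have "f = K.mono (f w) w" by (auto simp: K.mono_def fun_eq_iff)
      moreover have w': "set w \<subseteq> {..<n}" "f w \<in> k" using less.prems(1) w T_letters T_k by auto
      ultimately have "f w \<otimes> eprod w = \<zero>" using less.prems(3) h_mono by metis
      then have "eprod w \<otimes> f w = \<zero>" using w' k_central by simp
      then show False using eprod_regular w w' by simp
    qed
  qed
qed

section \<open>The quadratic form carried by the generators\<close>

primrec lin :: "nat \<Rightarrow> (nat \<Rightarrow> 'a) \<Rightarrow> 'a" where
  "lin 0 v = \<zero>"
| "lin (Suc m) v = lin m v \<oplus> v m \<otimes> e m"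

abbreviation "V \<equiv> coord_space K n"

text \<open>The form is forced, since a vector of a Clifford algebra squares to its value. That
  these squares are scalars is shown in \<open>q_k\<close>.\<close>

definition q :: "(nat \<Rightarrow> 'a) \<Rightarrow> 'a" where
  "q v = lin n v \<otimes> lin n v"

lemma V_k: "v \<in> carrier V \<Longrightarrow> i < n \<Longrightarrow> v i \<in> k"
  by (auto simp: coord_space_def)

lemma lin_closed [simp]: "v \<in> carrier V \<Longrightarrow> m \<le> n \<Longrightarrow> lin m v \<in> carrier R"
  by (induction m) (auto simp: V_k)

lemma tensor_vector_T:
  assumes "v \<in> carrier V" shows "tensor_vector K n v \<in> carrier T"
proof -
  have "{w. \<exists>i<n. w = [i]} = (\<lambda>i. [i]) ` {..<n}" by auto
  then have fin: "finite {w. \<exists>i<n. w = [i]}" by simp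
  show ?thesis
    using assms V_k
    by (auto simp: K.T_carrier tensor_vector_def intro: finite_subset[OF _ fin])
qed

lemma h_tensor_vector:
  assumes v: "v \<in> carrier V"
  shows "h (tensor_vector K n v) = lin n v"
proof -
  let ?t = "\<lambda>m w. if \<exists>i<m. w = [i] then v (hd w) else \<zero>"
  have "m \<le> n \<Longrightarrow> ?t m \<in> carrier T \<and> h (?t m) = lin m v" for m
  proof (induction m)
    case 0 then show ?case using h_zero zero_T by simp
  next
    case (Suc m)
    have m: "v m \<in> k" "set [m] \<subseteq> {..<n}" using Suc v V_k by auto
    have *: "?t (Suc m) = ?t m \<oplus>\<^bsub>T\<^esub> K.mono (v m) [m]"
      using v V_k Suc by (auto simp: fun_eq_iff T_add K.mono_def less_Suc_eq)
    show ?case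
      unfolding * using Suc m mono_T[OF m] by (simp add: h_add h_mono)
  qed
  from this[of n] show ?thesis by (simp add: tensor_vector_def cong: if_cong)
qed

lemma k_lcomm: "c \<in> k \<Longrightarrow> x \<in> carrier R \<Longrightarrow> y \<in> carrier R \<Longrightarrow> x \<otimes> (c \<otimes> y) = c \<otimes> (x \<otimes> y)"
  using k_central[of c x] by (simp add: m_assoc[symmetric])

text \<open>Every summand with index different from \<open>i\<close> anticommutes with
  \<open>e i\<close> and drops out. Partial sums are allowed because \<open>q_k\<close> needs the
  case in which \<open>i\<close> lies just beyond the summed indices.\<close>

lemma lin_e:
  assumes v: "v \<in> carrier V" and i: "i < n"
  shows "m \<le> n \<Longrightarrow> lin m v \<otimes> e i \<oplus> e i \<otimes> lin m v =
     (if i < m then v i \<otimes> (e i \<otimes> e i \<oplus> e i \<otimes> e i) else \<zero>)"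
proof (induction m)
  case 0 then show ?case using i by simp
next
  case (Suc m)
  have c: "v m \<in> k" "lin m v \<in> carrier R" "e m \<in> carrier R" "e i \<in> carrier R"
    using Suc v i V_k by auto
  have "lin (Suc m) v \<otimes> e i \<oplus> e i \<otimes> lin (Suc m) v =
      (lin m v \<otimes> e i \<oplus> e i \<otimes> lin m v) \<oplus> (v m \<otimes> e m \<otimes> e i \<oplus> e i \<otimes> v m \<otimes> e m)"
    using c by (simp add: l_distr r_distr m_assoc a_ac)
  also have "v m \<otimes> e m \<otimes> e i \<oplus> e i \<otimes> v m \<otimes> e m = v m \<otimes> (e m \<otimes> e i \<oplus> e i \<otimes> e m)"
    using c by (simp add: r_distr m_assoc k_lcomm[of "v m" "e i"])
  also have "\<dots> = (if i = m then v i \<otimes> (e i \<otimes> e i \<oplus> e i \<otimes> e i) else \<zero>)"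
    using c i Suc e_anti[of i m] by (auto simp: r_neg)
  finally show ?case using Suc v i V_k by (auto simp: less_Suc_eq)
qed

lemma q_k:
  assumes v: "v \<in> carrier V" shows "q v \<in> k"
proof -
  have "m \<le> n \<Longrightarrow> lin m v \<otimes> lin m v \<in> k" for m
  proof (induction m)
    case (Suc m)
    have c: "v m \<in> k" "lin m v \<in> carrier R" "e m \<in> carrier R" "m < n" "m \<le> n"
      using Suc v V_k by auto
    have 1: "lin m v \<otimes> (v m \<otimes> e m) \<oplus> (v m \<otimes> e m) \<otimes> lin m v =
        v m \<otimes> (lin m v \<otimes> e m \<oplus> e m \<otimes> lin m v)"
      using c by (simp add: r_distr m_assoc k_lcomm[of "v m" "lin m v" "e m"])
    have 2: "(v m \<otimes> e m) \<otimes> (v m \<otimes> e m) = (v m \<otimes> v m) \<otimes> (e m \<otimes> e m)"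
      using c by (simp add: m_assoc k_lcomm[of "v m" "e m" "e m"])
    have "lin (Suc m) v \<otimes> lin (Suc m) v = lin m v \<otimes> lin m v \<oplus>
        (lin m v \<otimes> (v m \<otimes> e m) \<oplus> (v m \<otimes> e m) \<otimes> lin m v) \<oplus> (v m \<otimes> e m) \<otimes> (v m \<otimes> e m)"
      using c by (simp add: l_distr r_distr a_ac)
    \<comment> \<open>The mixed terms cancel: \<open>lin_e\<close> is used at the index
      \<open>m\<close> for the partial sum below \<open>m\<close>, hence in its zero case.\<close>
    also have "\<dots> = lin m v \<otimes> lin m v \<oplus> (v m \<otimes> v m) \<otimes> (e m \<otimes> e m)"
      using c lin_e[OF v c(4,5)] by (simp del: lin.simps add: 1 2)
    finally show ?case using c Suc e_sq(1) by simp
  qed simp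
  then show ?thesis by (simp add: q_def)
qed

lemma V_ops:
  "u \<in> carrier V \<Longrightarrow> v \<in> carrier V \<Longrightarrow> u \<oplus>\<^bsub>V\<^esub> v \<in> carrier V"
  "c \<in> k \<Longrightarrow> v \<in> carrier V \<Longrightarrow> c \<odot>\<^bsub>V\<^esub> v \<in> carrier V"
  by (auto simp: coord_space_def PiE_iff)

lemma lin_add:
  assumes "u \<in> carrier V" "v \<in> carrier V"
  shows "m \<le> n \<Longrightarrow> lin m (u \<oplus>\<^bsub>V\<^esub> v) = lin m u \<oplus> lin m v"
proof (induction m)
  case (Suc m)
  have "(u \<oplus>\<^bsub>V\<^esub> v) m = u m \<oplus> v m" using Suc by (simp add: coord_space_def)
  moreover have "u m \<in> k" "v m \<in> k" "e m \<in> carrier R" "lin m u \<in> carrier R" "lin m v \<in> carrier R"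
    using Suc assms V_k by auto
  ultimately show ?case using Suc by (simp add: l_distr a_ac)
qed simp

lemma lin_smult:
  assumes "c \<in> k" "v \<in> carrier V"
  shows "m \<le> n \<Longrightarrow> lin m (c \<odot>\<^bsub>V\<^esub> v) = c \<otimes> lin m v"
proof (induction m)
  case (Suc m)
  have "(c \<odot>\<^bsub>V\<^esub> v) m = c \<otimes> v m" using Suc by (simp add: coord_space_def)
  moreover have "v m \<in> k" "e m \<in> carrier R" "lin m v \<in> carrier R"
    using Suc assms V_k by auto
  ultimately show ?case using Suc assms(1) by (simp add: r_distr m_assoc)
qed (use assms in simp)

lemma polar_q:
  assumes u: "u \<in> carrier V" and v: "v \<in> carrier V"
  shows "polar_form K V q u v = lin n u \<otimes> lin n v \<oplus> lin n v \<otimes> lin n u"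
proof -
  have "polar_form K V q u v = q (u \<oplus>\<^bsub>V\<^esub> v) \<oplus> \<ominus> q u \<oplus> \<ominus> q v"
    using u v by (simp add: polar_form_def K_neg q_k V_ops a_minus_def)
  also have "q (u \<oplus>\<^bsub>V\<^esub> v) = q u \<oplus> (lin n u \<otimes> lin n v \<oplus> (lin n v \<otimes> lin n u \<oplus> q v))"
    using u v by (simp add: q_def lin_add l_distr r_distr a_ac)
  also have "\<dots> \<oplus> \<ominus> q u \<oplus> \<ominus> q v =
      (lin n u \<otimes> lin n v \<oplus> lin n v \<otimes> lin n u) \<oplus> ((q u \<oplus> \<ominus> q u) \<oplus> (q v \<oplus> \<ominus> q v))"
    using u v q_k[OF u] q_k[OF v] by (simp only: a_ac lin_closed m_closed a_closed a_inv_closed k_closed order_refl)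
  also have "\<dots> = lin n u \<otimes> lin n v \<oplus> lin n v \<otimes> lin n u"
    using u v q_k[OF u] q_k[OF v] by (simp only: r_neg r_zero zero_closed lin_closed m_closed a_closed k_closed order_refl)
  finally show ?thesis .
qed

lemma quadratic_q: "quadratic_form K V q"
  unfolding quadratic_form_def
proof (intro conjI ballI)
  show "q \<in> carrier V \<rightarrow> carrier K" using q_k by auto
next
  fix c v assume c: "c \<in> carrier K" and v: "v \<in> carrier V"
  have "(c \<otimes> lin n v) \<otimes> (c \<otimes> lin n v) = (c \<otimes> c) \<otimes> (lin n v \<otimes> lin n v)"
    using c v by (simp add: m_assoc k_lcomm[of c "lin n v"])
  then show "q (c \<odot>\<^bsub>V\<^esub> v) = c \<otimes>\<^bsub>K\<^esub> c \<otimes>\<^bsub>K\<^esub> q v"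
    using c v by (simp add: q_def lin_smult)
next
  fix u u' v assume "u \<in> carrier V" "u' \<in> carrier V" "v \<in> carrier V"
  then show "polar_form K V q (u \<oplus>\<^bsub>V\<^esub> u') v = polar_form K V q u v \<oplus>\<^bsub>K\<^esub> polar_form K V q u' v"
    by (simp add: polar_q V_ops lin_add l_distr r_distr a_ac)
next
  fix c u v assume "c \<in> carrier K" "u \<in> carrier V" "v \<in> carrier V"
  then show "polar_form K V q (c \<odot>\<^bsub>V\<^esub> u) v = c \<otimes>\<^bsub>K\<^esub> polar_form K V q u v"
    by (simp add: polar_q V_ops lin_smult r_distr m_assoc k_lcomm[of c "lin n v"])
qed

definition unit_vector :: "nat \<Rightarrow> nat \<Rightarrow> 'a" where
  "unit_vector i = (\<lambda>j\<in>{..<n}. if j = i then \<one> else \<zero>)"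

lemma unit_vector_V: "unit_vector i \<in> carrier V"
  by (auto simp: coord_space_def unit_vector_def)

lemma tensor_unit_vector: "i < n \<Longrightarrow> tensor_vector K n (unit_vector i) = K.mono \<one> [i]"
  by (auto simp: tensor_vector_def unit_vector_def K.mono_def fun_eq_iff)

lemma lin_unit_vector:
  assumes "i < n" shows "lin n (unit_vector i) = e i"
  using h_tensor_vector[OF unit_vector_V, of i] assms h_mono[of \<one> "[i]"]
  by (simp add: tensor_unit_vector)

text \<open>Pairing \<open>u\<close> with a unit vector gives \<open>u i\<close> times twice the
  square of \<open>e i\<close>, a nonzero factor that can be cancelled.\<close>

lemma nondegenerate_q: "nondegenerate K V q"
  unfolding nondegenerate_def
proof (intro ballI impI)
  fix u assume u: "u \<in> carrier V" and *: "\<forall>v\<in>carrier V. polar_form K V q u v = \<zero>\<^bsub>K\<^esub>"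
  have "u i = \<zero>" if i: "i < n" for i
  proof -
    have "u i \<otimes> (e i \<otimes> e i \<oplus> e i \<otimes> e i) = lin n u \<otimes> e i \<oplus> e i \<otimes> lin n u"
      unfolding lin_e[OF u i order_refl] using i by (simp only: if_True)
    also have "\<dots> = polar_form K V q u (unit_vector i)"
      by (simp only: polar_q[OF u unit_vector_V] lin_unit_vector[OF i])
    also have "\<dots> = \<zero>"
      using *[THEN bspec, OF unit_vector_V[of i]] by simp
    finally have "u i \<otimes> (e i \<otimes> e i \<oplus> e i \<otimes> e i) = \<zero>" .
    moreover have "e i \<otimes> e i \<in> carrier R" using i by simp
    moreover have "e i \<otimes> e i \<oplus> e i \<otimes> e i \<noteq> \<zero>"
      using two_regular[OF calculation(2)] e_sq(2)[OF i] by blast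
    ultimately show ?thesis using k_regular[OF V_k[OF u i] a_closed] by blast
  qed
  moreover have "u \<in> extensional {..<n}" using u by (simp add: coord_space_def PiE_iff)
  ultimately have "u = (\<lambda>i\<in>{..<n}. \<zero>)" by (intro extensionalityI) auto
  then show "u = \<zero>\<^bsub>V\<^esub>" by (simp add: coord_space_def)
qed

section \<open>The Clifford ideal and its quotient\<close>

abbreviation "J \<equiv> Clifford_ideal K n q"

abbreviation "relators \<equiv> {(tensor_vector K n v \<otimes>\<^bsub>T\<^esub> tensor_vector K n v) \<ominus>\<^bsub>T\<^esub> tensor_scalar K (q v) | v.
  v \<in> carrier V}"

lemma tensor_scalar_mono: "tensor_scalar K c = K.mono c []"
  by (auto simp: tensor_scalar_def K.mono_def)

lemma relators_T: "relators \<subseteq> carrier T"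
proof clarify
  fix v assume v: "v \<in> carrier V"
  show "tensor_vector K n v \<otimes>\<^bsub>T\<^esub> tensor_vector K n v \<ominus>\<^bsub>T\<^esub> tensor_scalar K (q v) \<in> carrier T"
    unfolding tensor_scalar_mono
    by (intro K.T.minus_closed K.T.m_closed mono_T tensor_vector_T v q_k) simp
qed

lemma J_ideal: "ideal J T"
  unfolding Clifford_ideal_def by (rule K.T.genideal_ideal[OF relators_T])

text \<open>A vector tensor evaluates to \<open>lin n v\<close>, whose square is \<open>q v\<close>
  by definition, so the kernel of \<open>h\<close> is an ideal containing all relators.\<close>

lemma h_J: "f \<in> J \<Longrightarrow> h f = \<zero>"
proof -
  have "relators \<subseteq> a_kernel T R h"
  proof clarify
    fix v assume v: "v \<in> carrier V"
    let ?t = "tensor_vector K n v" and ?s = "tensor_scalar K (q v)"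
    have c: "?t \<in> carrier T" "?s \<in> carrier T"
      unfolding tensor_scalar_mono using tensor_vector_T[OF v] mono_T[OF q_k[OF v]] by simp_all
    have t: "h ?t = lin n v" by (rule h_tensor_vector[OF v])
    have s: "h ?s = q v"
      unfolding tensor_scalar_mono h_mono[OF q_k[OF v] empty_subsetI[folded list.set(1)]] eprod_simps
      by (rule r_one[OF k_closed[OF q_k[OF v]]])
    have 0: "h (?t \<otimes>\<^bsub>T\<^esub> ?t \<ominus>\<^bsub>T\<^esub> ?s) = \<zero>"
      unfolding a_minus_def h_add[OF K.T.m_closed[OF c(1) c(1)] K.T.a_inv_closed[OF c(2)]]
        h_mult[OF c(1) c(1)] H.hom_a_inv[OF c(2)] t s q_def[symmetric]
      by (rule r_neg[OF k_closed[OF q_k[OF v]]])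
    have "?t \<otimes>\<^bsub>T\<^esub> ?t \<ominus>\<^bsub>T\<^esub> ?s \<in> carrier T"
      by (intro K.T.minus_closed K.T.m_closed c)
    then show "?t \<otimes>\<^bsub>T\<^esub> ?t \<ominus>\<^bsub>T\<^esub> ?s \<in> a_kernel T R h"
      unfolding a_kernel_def' using 0 by blast
  qed
  then have "J \<subseteq> a_kernel T R h"
    unfolding Clifford_ideal_def by (rule K.T.genideal_minimal[OF H.kernel_is_ideal])
  then show "f \<in> J \<Longrightarrow> h f = \<zero>" unfolding a_kernel_def' by blast
qed

abbreviation "C \<equiv> Clifford_algebra K n q"

abbreviation proj :: "(nat list \<Rightarrow> 'a) \<Rightarrow> (nat list \<Rightarrow> 'a) set" where
  "proj f \<equiv> J +>\<^bsub>T\<^esub> f"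

sublocale P: ring_hom_ring T C proj
  unfolding Clifford_algebra_def by (rule ideal.rcos_ring_hom_ring[OF J_ideal])

lemma proj_eq: "f \<in> carrier T \<Longrightarrow> g \<in> carrier T \<Longrightarrow> proj f = proj g \<longleftrightarrow> f \<ominus>\<^bsub>T\<^esub> g \<in> J"
  by (simp add: K.T.quotient_eq_iff_same_a_r_cos[OF J_ideal])

lemma proj_relator:
  assumes v: "v \<in> carrier V"
  shows "proj (tensor_vector K n v) \<otimes>\<^bsub>C\<^esub> proj (tensor_vector K n v) = proj (K.mono (q v) [])"
proof -
  let ?t = "tensor_vector K n v"
  have "?t \<otimes>\<^bsub>T\<^esub> ?t \<ominus>\<^bsub>T\<^esub> K.mono (q v) [] \<in> J"
    unfolding Clifford_ideal_def tensor_scalar_mono[symmetric]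
    using K.T.genideal_self[OF relators_T] v by blast
  then show ?thesis
    using v by (simp add: proj_eq[symmetric] tensor_vector_T mono_T q_k)
qed

lemma proj_sq:
  assumes "i < n"
  shows "proj (K.mono \<one> [i]) \<otimes>\<^bsub>C\<^esub> proj (K.mono \<one> [i]) = proj (K.mono (e i \<otimes> e i) [])"
  using proj_relator[OF unit_vector_V, of i] assms by (simp add: tensor_unit_vector q_def lin_unit_vector)

text \<open>Polarization of the relators: the one at the sum of two unit vectors, compared with the
  ones at each of them, says that the mixed terms cancel.\<close>

lemma proj_anti:
  assumes i: "i < n" and j: "j < n" and ij: "i \<noteq> j"
  shows "proj (K.mono \<one> [i]) \<otimes>\<^bsub>C\<^esub> proj (K.mono \<one> [j]) =
    \<ominus>\<^bsub>C\<^esub> (proj (K.mono \<one> [j]) \<otimes>\<^bsub>C\<^esub> proj (K.mono \<one> [i]))"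
proof -
  let ?x = "proj (K.mono \<one> [i])" and ?y = "proj (K.mono \<one> [j])"
  let ?v = "unit_vector i \<oplus>\<^bsub>V\<^esub> unit_vector j"
  have c: "K.mono \<one> [i] \<in> carrier T" "K.mono \<one> [j] \<in> carrier T"
    using i j by (auto intro: mono_T)
  then have xy: "?x \<in> carrier C" "?y \<in> carrier C" by simp_all
  have t: "tensor_vector K n ?v = K.mono \<one> [i] \<oplus>\<^bsub>T\<^esub> K.mono \<one> [j]"
    using i j ij by (auto simp: T_add K.mono_def tensor_vector_def unit_vector_def coord_space_def fun_eq_iff)
  have "q ?v = (e i \<oplus> e j) \<otimes> (e i \<oplus> e j)"
    unfolding q_def lin_add[OF unit_vector_V unit_vector_V order_refl]
      lin_unit_vector[OF i] lin_unit_vector[OF j] ..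
  also have "\<dots> = e i \<otimes> e i \<oplus> e j \<otimes> e j"
    using anticommute_iff_square[OF e_closed[OF i] e_closed[OF j]] e_anti[OF i j ij] by blast
  finally have qv: "q ?v = e i \<otimes> e i \<oplus> e j \<otimes> e j" .
  have m: "K.mono (e i \<otimes> e i \<oplus> e j \<otimes> e j) [] = K.mono (e i \<otimes> e i) [] \<oplus>\<^bsub>T\<^esub> K.mono (e j \<otimes> e j) []"
    by (auto simp: T_add K.mono_def fun_eq_iff)
  have mc: "K.mono (e i \<otimes> e i) [] \<in> carrier T" "K.mono (e j \<otimes> e j) [] \<in> carrier T"
    using mono_T[OF e_sq(1)[OF i], of "[]"] mono_T[OF e_sq(1)[OF j], of "[]"] by simp_all
  have "(?x \<oplus>\<^bsub>C\<^esub> ?y) \<otimes>\<^bsub>C\<^esub> (?x \<oplus>\<^bsub>C\<^esub> ?y) = ?x \<otimes>\<^bsub>C\<^esub> ?x \<oplus>\<^bsub>C\<^esub> ?y \<otimes>\<^bsub>C\<^esub> ?y"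
    using proj_relator[OF V_ops(1)[OF unit_vector_V[of i] unit_vector_V[of j]]]
    unfolding t qv m P.hom_add[OF c] P.hom_add[OF mc] proj_sq[OF i] proj_sq[OF j] .
  then show ?thesis
    using P.S.anticommute_iff_square[OF xy] by blast
qed

lemma proj_append:
  assumes "set u \<subseteq> {..<n}" "set v \<subseteq> {..<n}" "c \<in> k" "d \<in> k"
  shows "proj (K.mono c u) \<otimes>\<^bsub>C\<^esub> proj (K.mono d v) = proj (K.mono (c \<otimes> d) (u @ v))"
  using P.hom_mult[OF mono_T[OF assms(3,1)] mono_T[OF assms(4,2)]] mono_mult[OF assms(3,4)] by simp

section \<open>Rewriting tensors to increasing words\<close>

definition reduces_to :: "(nat list \<Rightarrow> bool) \<Rightarrow> (nat list \<Rightarrow> 'a) \<Rightarrow> bool" where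
  "reduces_to Q f \<longleftrightarrow> (\<exists>g\<in>carrier T. (\<forall>w. g w \<noteq> \<zero> \<longrightarrow> Q w) \<and> proj f = proj g)"

lemma reduces_to_zero: "reduces_to Q (\<lambda>w. \<zero>)"
  unfolding reduces_to_def by (intro bexI[OF _ zero_T]) simp

lemma reduces_to_mono:
  assumes "c \<in> k" "set u \<subseteq> {..<n}" "Q u" shows "reduces_to Q (K.mono c u)"
  unfolding reduces_to_def
  by (rule bexI[OF _ mono_T[OF assms(1,2)]]) (use assms(3) in \<open>simp add: K.mono_def\<close>)

lemma reduces_to_add:
  assumes f: "f \<in> carrier T" "reduces_to Q f" and g: "g \<in> carrier T" "reduces_to Q g"
  shows "reduces_to Q (f \<oplus>\<^bsub>T\<^esub> g)"
proof -
  obtain f' where f': "f' \<in> carrier T" "\<And>w. f' w \<noteq> \<zero> \<Longrightarrow> Q w" "proj f = proj f'"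
    using f(2) unfolding reduces_to_def by blast
  obtain g' where g': "g' \<in> carrier T" "\<And>w. g' w \<noteq> \<zero> \<Longrightarrow> Q w" "proj g = proj g'"
    using g(2) unfolding reduces_to_def by blast
  have "Q w" if "(f' \<oplus>\<^bsub>T\<^esub> g') w \<noteq> \<zero>" for w
  proof (rule ccontr)
    assume "\<not> Q w"
    then have "f' w = \<zero>" "g' w = \<zero>" using f'(2) g'(2) by blast+
    then show False using that by (simp add: T_add)
  qed
  moreover have "proj (f \<oplus>\<^bsub>T\<^esub> g) = proj (f' \<oplus>\<^bsub>T\<^esub> g')"
    by (simp only: P.hom_add[OF f(1) g(1)] P.hom_add[OF f'(1) g'(1)] f'(3) g'(3))
  ultimately show ?thesis
    unfolding reduces_to_def using K.T.a_closed[OF f'(1) g'(1)] by blast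
qed

lemma reduces_to_smult:
  assumes c: "c \<in> k" and f: "f \<in> carrier T" "reduces_to Q f"
  shows "reduces_to Q (K.mono c [] \<otimes>\<^bsub>T\<^esub> f)"
proof -
  obtain f' where f': "f' \<in> carrier T" "\<And>w. f' w \<noteq> \<zero> \<Longrightarrow> Q w" "proj f = proj f'"
    using f(2) unfolding reduces_to_def by blast
  have m: "K.mono c [] \<in> carrier T" using mono_T[OF c] by simp
  have "Q w" if "(K.mono c [] \<otimes>\<^bsub>T\<^esub> f') w \<noteq> \<zero>" for w
  proof (rule ccontr)
    assume "\<not> Q w"
    then have "f' w = \<zero>" using f'(2) by blast
    then show False using that c T_k[OF f'(1)] by (simp add: K.T_simps K.conv_mono_Nil)
  qed
  moreover have "proj (K.mono c [] \<otimes>\<^bsub>T\<^esub> f) = proj (K.mono c [] \<otimes>\<^bsub>T\<^esub> f')"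
    by (simp only: P.hom_mult[OF m f(1)] P.hom_mult[OF m f'(1)] f'(3))
  ultimately show ?thesis
    unfolding reduces_to_def using K.T.m_closed[OF m f'(1)] by blast
qed

lemma reduces_to_cong: "proj f = proj g \<Longrightarrow> reduces_to Q g \<Longrightarrow> reduces_to Q f"
  unfolding reduces_to_def by metis

text \<open>One pass of insertion sort. The bound on the letters has to be carried through the
  induction: after a swap the letter \<open>j\<close> is put in front of the reduced words and must
  be smaller than all their letters.\<close>

lemma reduce_letter:
  assumes i: "i < n"
  shows "word S \<Longrightarrow> reduces_to (\<lambda>w. word w \<and> set w \<subseteq> insert i (set S)) (K.mono \<one> (i # S))"
proof (induction S)
  case Nil
  then show ?case using i by (intro reduces_to_mono) (auto simp: word_def)
next
  case (Cons j S)
  have j: "j < n" and S: "word S" "set S \<subseteq> {..<n}" "\<forall>l\<in>set S. j < l"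
    using Cons.prems by (auto simp: word_def)
  let ?x = "proj (K.mono \<one> [i])" and ?y = "proj (K.mono \<one> [j])" and ?s = "proj (K.mono \<one> S)"
  have l: "set [i] \<subseteq> {..<n}" "set [j] \<subseteq> {..<n}" using i j by auto
  have c: "K.mono \<one> [i] \<in> carrier T" "K.mono \<one> [j] \<in> carrier T" "K.mono \<one> S \<in> carrier T"
    using mono_T[OF _ l(1)] mono_T[OF _ l(2)] mono_T[OF _ S(2)] by simp_all
  note cC = c[THEN P.hom_closed]
  have jS: "set (j # S) \<subseteq> {..<n}" "set (i # S) \<subseteq> {..<n}" using i j S by auto
  have eq: "proj (K.mono \<one> (i # j # S)) = ?x \<otimes>\<^bsub>C\<^esub> (?y \<otimes>\<^bsub>C\<^esub> ?s)"
    using proj_append[OF l(1) jS(1), of \<one> \<one>] proj_append[OF l(2) S(2), of \<one> \<one>] by simp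
  consider "i < j" | "i = j" | "j < i" by linarith
  then show ?case
  proof cases
    case 1
    then have "word (i # j # S)" using Cons.prems i by (auto simp: word_def)
    then show ?thesis using i j S by (intro reduces_to_mono) auto
  next
    case 2
    have "proj (K.mono \<one> (i # j # S)) = (?x \<otimes>\<^bsub>C\<^esub> ?x) \<otimes>\<^bsub>C\<^esub> ?s"
      unfolding eq unfolding 2 by (rule P.S.m_assoc[OF cC(2,2,3), symmetric])
    also have "\<dots> = proj (K.mono (e i \<otimes> e i) S)"
      unfolding proj_sq[OF i] using proj_append[of "[]" S "e i \<otimes> e i" \<one>] S(2) e_sq(1)[OF i] by simp
    finally show ?thesis
      by (rule reduces_to_cong) (use S e_sq(1)[OF i] in \<open>auto intro!: reduces_to_mono\<close>)
  next
    case 3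
    obtain g where g: "g \<in> carrier T" "\<And>w. g w \<noteq> \<zero> \<Longrightarrow> word w \<and> set w \<subseteq> insert i (set S)"
      "proj (K.mono \<one> (i # S)) = proj g"
      using Cons.IH[OF S(1)] unfolding reduces_to_def by blast
    \<comment> \<open>The letters \<open>i\<close> and \<open>j\<close> are swapped at the cost of a
      sign, \<open>i\<close> is inserted into the tail by induction, and \<open>j\<close> goes back
      in front with coefficient minus one.\<close>
    let ?g = "K.mono (\<ominus> \<one>) [j] \<otimes>\<^bsub>T\<^esub> g"
    have m: "K.mono (\<ominus> \<one>) [j] \<in> carrier T" using mono_T[OF _ l(2)] by simp
    have "?x \<otimes>\<^bsub>C\<^esub> (?y \<otimes>\<^bsub>C\<^esub> ?s) = (?x \<otimes>\<^bsub>C\<^esub> ?y) \<otimes>\<^bsub>C\<^esub> ?s"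
      by (rule P.S.m_assoc[OF cC(1,2,3), symmetric])
    also have "\<dots> = \<ominus>\<^bsub>C\<^esub> (?y \<otimes>\<^bsub>C\<^esub> ?x) \<otimes>\<^bsub>C\<^esub> ?s"
      using proj_anti[OF i j] 3 by simp
    also have "\<dots> = \<ominus>\<^bsub>C\<^esub> ?y \<otimes>\<^bsub>C\<^esub> (?x \<otimes>\<^bsub>C\<^esub> ?s)"
      unfolding P.S.l_minus[OF cC(2,1), symmetric]
      by (rule P.S.m_assoc[OF P.S.a_inv_closed[OF cC(2)] cC(1,3)])
    also have "?x \<otimes>\<^bsub>C\<^esub> ?s = proj g"
      using proj_append[OF l(1) S(2), of \<one> \<one>] g(3) by simp
    also have "\<ominus>\<^bsub>C\<^esub> ?y = proj (K.mono (\<ominus> \<one>) [j])"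
    proof -
      have "K.mono (\<ominus> \<one>) [j] = \<ominus>\<^bsub>T\<^esub> K.mono \<one> [j]"
        unfolding K.T_minus[OF c(2)] by (auto simp: K.mono_def fun_eq_iff K_neg)
      then show ?thesis using P.hom_a_inv[OF c(2)] by simp
    qed
    also have "proj (K.mono (\<ominus> \<one>) [j]) \<otimes>\<^bsub>C\<^esub> proj g = proj ?g"
      by (rule P.hom_mult[OF m g(1), symmetric])
    finally have *: "proj (K.mono \<one> (i # j # S)) = proj ?g" unfolding eq .
    have "word w \<and> set w \<subseteq> insert i (set (j # S))" if w: "?g w \<noteq> \<zero>" for w
    proof -
      have "?g w = (case w of [] \<Rightarrow> \<zero> | b # u \<Rightarrow> if b = j then \<ominus> \<one> \<otimes> g u else \<zero>)"
        using K.conv_mono_single[of "\<ominus> \<one>" g j w] T_k[OF g(1)] by (simp add: K.T_simps cong: if_cong list.case_cong)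
      then obtain u where u: "w = j # u" "\<ominus> \<one> \<otimes> g u \<noteq> \<zero>"
        using w by (cases w) (auto split: if_splits)
      then have "g u \<noteq> \<zero>" using r_null[of "\<ominus> \<one>"] by (metis a_inv_closed one_closed)
      then show ?thesis using u(1) g(2)[of u] S 3 j by (auto simp: word_def)
    qed
    then show ?thesis
      unfolding reduces_to_def using K.T.m_closed[OF m g(1)] * by blast
  qed
qed

lemma reduce_prepend:
  assumes i: "i < n"
  shows "g \<in> carrier T \<Longrightarrow> (\<And>w. g w \<noteq> \<zero> \<Longrightarrow> word w) \<Longrightarrow>
    reduces_to word (K.mono \<one> [i] \<otimes>\<^bsub>T\<^esub> g)"
proof -
  have m: "K.mono \<one> [i] \<in> carrier T" using mono_T[of \<one> "[i]"] i by simp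
  show "g \<in> carrier T \<Longrightarrow> (\<And>w. g w \<noteq> \<zero> \<Longrightarrow> word w) \<Longrightarrow>
    reduces_to word (K.mono \<one> [i] \<otimes>\<^bsub>T\<^esub> g)"
  proof (induction rule: T_ind)
    case zero
    have "K.mono \<one> [i] \<otimes>\<^bsub>T\<^esub> (\<lambda>w. \<zero>) = (\<lambda>w. \<zero>)"
      using K.T.r_null[OF m] by (simp add: K.T_simps)
    then show ?case by (simp add: reduces_to_zero)
  next
    case (mono c S)
    have "word w \<and> set w \<subseteq> insert i (set S) \<Longrightarrow> word w" for w by simp
    then have r: "reduces_to word (K.mono \<one> (i # S))"
      using reduce_letter[OF i mono(3)] unfolding reduces_to_def by blast
    have iS: "set (i # S) \<subseteq> {..<n}" using i mono by auto
    have "K.mono \<one> [i] \<otimes>\<^bsub>T\<^esub> K.mono c S = K.mono c [] \<otimes>\<^bsub>T\<^esub> K.mono \<one> (i # S)"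
      using mono_mult[of \<one> c "[i]" S] mono_mult[of c \<one> "[]" "i # S"] mono(1) by simp
    then show ?case
      using reduces_to_smult[OF mono(1) mono_T[OF _ iS] r] by simp
  next
    case (add f f')
    show ?case
      unfolding K.T.r_distr[OF add(1,2) m]
      by (rule reduces_to_add[OF K.T.m_closed[OF m add(1)] add(3) K.T.m_closed[OF m add(2)] add(4)])
  qed
qed

lemma reduce_word: "set u \<subseteq> {..<n} \<Longrightarrow> reduces_to word (K.mono \<one> u)"
proof (induction u)
  case Nil then show ?case by (intro reduces_to_mono) (auto simp: word_def)
next
  case (Cons i u)
  then have i: "i < n" "set [i] \<subseteq> {..<n}" and u: "set u \<subseteq> {..<n}" by auto
  have m: "K.mono \<one> [i] \<in> carrier T" "K.mono \<one> u \<in> carrier T"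
    using mono_T[OF _ i(2)] mono_T[OF _ u] by simp_all
  obtain g where g: "g \<in> carrier T" "\<And>w. g w \<noteq> \<zero> \<Longrightarrow> word w" "proj (K.mono \<one> u) = proj g"
    using Cons.IH[OF u] unfolding reduces_to_def by blast
  have "reduces_to word (K.mono \<one> [i] \<otimes>\<^bsub>T\<^esub> g)"
    by (rule reduce_prepend[OF i(1) g(1,2)])
  moreover have "proj (K.mono \<one> (i # u)) = proj (K.mono \<one> [i] \<otimes>\<^bsub>T\<^esub> g)"
    using proj_append[OF i(2) u, of \<one> \<one>] P.hom_mult[OF m(1) g(1)] g(3) by simp
  ultimately show ?case by (rule reduces_to_cong[rotated])
qed

lemma reduce:
  assumes "f \<in> carrier T" shows "reduces_to word f"
  using assms TrueI
proof (induction rule: T_ind)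
  case zero show ?case by (rule reduces_to_zero)
next
  case (mono c u)
  have "K.mono c u = K.mono c [] \<otimes>\<^bsub>T\<^esub> K.mono \<one> u"
    using mono_mult[of c \<one> "[]" u] mono(1) by simp
  then show ?case
    using reduces_to_smult[OF mono(1) mono_T[OF _ mono(2)] reduce_word[OF mono(2)]] by simp
next
  case (add f g) then show ?case by (simp add: reduces_to_add)
qed

text \<open>Says that \<open>J\<close> is the whole kernel of \<open>h\<close>. A difference killed
  by \<open>h\<close> is congruent modulo \<open>J\<close> to a tensor on increasing words; that
  tensor is killed as well and is zero by independence.\<close>

lemma proj_eq_iff:
  assumes f: "f \<in> carrier T" and g: "g \<in> carrier T"
  shows "proj f = proj g \<longleftrightarrow> h f = h g"
proof
  assume "proj f = proj g"
  then have "h (f \<ominus>\<^bsub>T\<^esub> g) = \<zero>"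
    using proj_eq[OF f g] h_J by blast
  then have "h f \<ominus> h g = \<zero>"
    unfolding a_minus_def by (simp only: h_add[OF f K.T.a_inv_closed[OF g]] H.hom_a_inv[OF g])
  then show "h f = h g" using f g by (simp only: r_right_minus_eq h_closed)
next
  assume hfg: "h f = h g"
  have d: "f \<ominus>\<^bsub>T\<^esub> g \<in> carrier T" by (rule K.T.minus_closed[OF f g])
  obtain r where r: "r \<in> carrier T" "\<And>w. r w \<noteq> \<zero> \<Longrightarrow> word w" "proj (f \<ominus>\<^bsub>T\<^esub> g) = proj r"
    using reduce[OF d] unfolding reduces_to_def by blast
  have "h (f \<ominus>\<^bsub>T\<^esub> g) = \<zero>"
    unfolding a_minus_def h_add[OF f K.T.a_inv_closed[OF g]] H.hom_a_inv[OF g] hfg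
    by (rule r_neg[OF h_closed[OF g]])
  moreover have "h ((f \<ominus>\<^bsub>T\<^esub> g) \<ominus>\<^bsub>T\<^esub> r) = \<zero>"
    using r(3) proj_eq[OF d r(1)] h_J by blast
  then have "h (f \<ominus>\<^bsub>T\<^esub> g) \<ominus> h r = \<zero>"
    unfolding a_minus_def[of T "f \<ominus>\<^bsub>T\<^esub> g"] a_minus_def[of R]
    by (simp only: h_add[OF d K.T.a_inv_closed[OF r(1)]] H.hom_a_inv[OF r(1)])
  then have "h (f \<ominus>\<^bsub>T\<^esub> g) = h r" using d r(1) by (simp only: r_right_minus_eq h_closed)
  ultimately have "h r = \<zero>" by simp
  then have "r = \<zero>\<^bsub>T\<^esub>" using h_inj_words[OF r(1,2)] by (simp add: K.T_simps fun_eq_iff)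
  then have "proj (f \<ominus>\<^bsub>T\<^esub> g) = \<zero>\<^bsub>C\<^esub>" using r(3) P.hom_zero by simp
  then have "proj f \<ominus>\<^bsub>C\<^esub> proj g = \<zero>\<^bsub>C\<^esub>"
    unfolding a_minus_def by (simp only: P.hom_add[OF f K.T.a_inv_closed[OF g]] P.hom_a_inv[OF g])
  then show "proj f = proj g"
    using P.S.r_right_minus_eq[OF P.hom_closed[OF f] P.hom_closed[OF g]] by blast
qed

section \<open>The graded isomorphism onto the Clifford algebra\<close>

definition lift :: "'a \<Rightarrow> nat list \<Rightarrow> 'a" where
  "lift x = (SOME f. f \<in> carrier T \<and> h f = x)"

definition iso :: "'a \<Rightarrow> (nat list \<Rightarrow> 'a) set" where
  "iso x = proj (lift x)"

lemma iso_h: 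
  assumes f: "f \<in> carrier T" shows "iso (h f) = proj f"
proof -
  have "lift (h f) \<in> carrier T \<and> h (lift (h f)) = h f"
    unfolding lift_def by (rule someI[of _ f]) (use f in simp)
  then show ?thesis unfolding iso_def using proj_eq_iff[of "lift (h f)" f] f by blast
qed

lemma h_cases:
  assumes "x \<in> carrier R" obtains f where "f \<in> carrier T" "x = h f"
  using h_surj assms by blast

lemma carrier_C: "carrier C = proj ` carrier T"
  unfolding Clifford_algebra_def FactRing_def A_RCOSETS_def' by auto

lemma iso_ring_iso: "iso \<in> ring_iso R C"
proof (rule ring_iso_memI)
  fix x y assume "x \<in> carrier R" "y \<in> carrier R"
  then obtain f g where f: "f \<in> carrier T" "x = h f" and g: "g \<in> carrier T" "y = h g"
    using h_cases by metis
  show "iso x \<in> carrier C"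
    unfolding f(2) iso_h[OF f(1)] by (rule P.hom_closed[OF f(1)])
  show "iso (x \<otimes> y) = iso x \<otimes>\<^bsub>C\<^esub> iso y"
    unfolding f(2) g(2) h_mult[OF f(1) g(1), symmetric] iso_h[OF f(1)] iso_h[OF g(1)]
      iso_h[OF K.T.m_closed[OF f(1) g(1)]] by (rule P.hom_mult[OF f(1) g(1)])
  show "iso (x \<oplus> y) = iso x \<oplus>\<^bsub>C\<^esub> iso y"
    unfolding f(2) g(2) h_add[OF f(1) g(1), symmetric] iso_h[OF f(1)] iso_h[OF g(1)]
      iso_h[OF K.T.a_closed[OF f(1) g(1)]] by (rule P.hom_add[OF f(1) g(1)])
next
  show "iso \<one> = \<one>\<^bsub>C\<^esub>"
    using iso_h[OF K.T.one_closed] unfolding h_one P.hom_one .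
  have "inj_on iso (carrier R)"
  proof (rule inj_onI)
    fix x y assume xy: "x \<in> carrier R" "y \<in> carrier R" "iso x = iso y"
    then obtain f g where f: "f \<in> carrier T" "x = h f" and g: "g \<in> carrier T" "y = h g"
      using h_cases by metis
    then show "x = y" using xy(3) iso_h[OF f(1)] iso_h[OF g(1)] proj_eq_iff[OF f(1) g(1)] by simp
  qed
  moreover have "iso ` carrier R = carrier C"
    unfolding carrier_C h_surj[symmetric] image_image by (rule image_cong) (auto simp: iso_h)
  ultimately show "bij_betw iso (carrier R) (carrier C)" by (simp add: bij_betw_def)
qed

text \<open>The odd part of a preimage of an element of \<open>R0\<close> evaluates to a difference
  of elements of \<open>R0\<close>, hence into the zero intersection of \<open>R0\<close> and
  \<open>R1\<close>; symmetrically for \<open>R1\<close>.\<close>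

lemma R01_h:
  "R0 = h ` {f \<in> carrier T. \<forall>w. f w \<noteq> \<zero> \<longrightarrow> even (length w)}"
  "R1 = h ` {f \<in> carrier T. \<forall>w. f w \<noteq> \<zero> \<longrightarrow> odd (length w)}"
proof -
  let ?ev = "restr (\<lambda>w. even (length w))" and ?od = "restr (\<lambda>w. \<not> even (length w))"
  have ev: "h (?ev f) \<in> R0" and od: "h (?od f) \<in> R1" and sum: "h f = h (?ev f) \<oplus> h (?od f)"
    if f: "f \<in> carrier T" for f
    using f by (auto intro!: h_even h_odd restr_T simp: h_restr_split) (auto simp: restr_def split: if_splits)
  have m1: "\<ominus> \<one> \<in> R0" using R01(4) k_ops(3)[OF k_ops(2)] by blast
  have neg: "\<ominus> x \<in> R0" if "x \<in> R0" for x
  proof -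
    have "x \<in> carrier R" using that R01(1) by blast
    then show ?thesis using R00[OF m1 that] by (simp add: l_minus)
  qed
  have neg1: "\<ominus> x \<in> R1" if "x \<in> R1" for x
  proof -
    have "x \<in> carrier R" using that R01(2) by blast
    then show ?thesis using R01m[OF m1 that] by (simp add: l_minus)
  qed
  show "R0 = h ` {f \<in> carrier T. \<forall>w. f w \<noteq> \<zero> \<longrightarrow> even (length w)}"
  proof (intro equalityI subsetI)
    fix x assume x: "x \<in> R0"
    then have xR: "x \<in> carrier R" using R01(1) by blast
    then obtain f where f: "f \<in> carrier T" "x = h f" using h_cases by metis
    have c: "h (?ev f) \<in> carrier R" "h (?od f) \<in> carrier R" using f by (simp_all add: restr_T)
    have "h (?od f) = x \<oplus> \<ominus> h (?ev f)"
      using sum[OF f(1)] c a_comm[OF c] by (simp add: f(2) a_assoc r_neg)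
    then have "h (?od f) \<in> R0" using R0_add[OF x neg[OF ev[OF f(1)]]] by simp
    then have "h (?od f) = \<zero>" using od[OF f(1)] R01(3) by blast
    then have "x = h (?ev f)" using sum[OF f(1)] c f(2) by simp
    then show "x \<in> h ` {f \<in> carrier T. \<forall>w. f w \<noteq> \<zero> \<longrightarrow> even (length w)}"
      using restr_T[OF f(1)] by (auto simp: restr_def intro!: image_eqI[where x = "?ev f"])
  qed (auto intro: h_even)
  show "R1 = h ` {f \<in> carrier T. \<forall>w. f w \<noteq> \<zero> \<longrightarrow> odd (length w)}"
  proof (intro equalityI subsetI)
    fix x assume x: "x \<in> R1"
    then have xR: "x \<in> carrier R" using R01(2) by blast
    then obtain f where f: "f \<in> carrier T" "x = h f" using h_cases by metis
    have c: "h (?ev f) \<in> carrier R" "h (?od f) \<in> carrier R" using f by (simp_all add: restr_T)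
    have "h (?ev f) = x \<oplus> \<ominus> h (?od f)"
      using sum[OF f(1)] c by (simp add: f(2) a_assoc r_neg)
    then have "h (?ev f) \<in> R1" using R1_add[OF x neg1[OF od[OF f(1)]]] by simp
    then have "h (?ev f) = \<zero>" using ev[OF f(1)] R01(3) by blast
    then have "x = h (?od f)" using sum[OF f(1)] c f(2) by simp
    then show "x \<in> h ` {f \<in> carrier T. \<forall>w. f w \<noteq> \<zero> \<longrightarrow> odd (length w)}"
      using restr_T[OF f(1)] by (auto simp: restr_def intro!: image_eqI[where x = "?od f"])
  qed (auto intro: h_odd)
qed

theorem Clifford_iso:
  "\<exists>q. quadratic_form K V q \<and> nondegenerate K V q \<and>
     (\<exists>\<phi>\<in>ring_iso R (Clifford_algebra K n q).
        \<phi> ` R0 = Clifford_even K n q \<and> \<phi> ` R1 = Clifford_odd K n q \<and>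
        (\<forall>c\<in>carrier K. \<forall>x\<in>carrier R.
           \<phi> (c \<otimes> x) = Clifford_scalar K n q c \<otimes>\<^bsub>Clifford_algebra K n q\<^esub> \<phi> x))"
proof (intro exI conjI bexI ballI)
  show "quadratic_form K V q" by (rule quadratic_q)
  show "nondegenerate K V q" by (rule nondegenerate_q)
  show "iso \<in> ring_iso R C" by (rule iso_ring_iso)
  have "iso ` h ` S = proj ` S" if "S \<subseteq> carrier T" for S
    unfolding image_image by (rule image_cong) (use that iso_h in auto)
  note iso_image = this
  show "iso ` R0 = Clifford_even K n q"
    unfolding R01_h Clifford_even_def by (subst iso_image) auto
  show "iso ` R1 = Clifford_odd K n q"
    unfolding R01_h Clifford_odd_def by (subst iso_image) auto
  fix c x assume c: "c \<in> carrier K" and x: "x \<in> carrier R"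
  then have c': "c \<in> k" by simp
  have m: "K.mono c [] \<in> carrier T" using mono_T[OF c'] by simp
  have "h (K.mono c []) = c" using h_mono[OF c', of "[]"] c' by simp
  then have "iso c = Clifford_scalar K n q c"
    using iso_h[OF m] unfolding Clifford_scalar_def tensor_scalar_mono by simp
  then show "iso (c \<otimes> x) = Clifford_scalar K n q c \<otimes>\<^bsub>C\<^esub> iso x"
    using ring_iso_memE(2)[OF iso_ring_iso k_closed[OF c'] x] by simp
qed

end

section \<open>The central localization\<close>

text \<open>The operations of the localization are unions over all representatives; such a union
  collapses as soon as every pair of representatives yields the same class.\<close>

lemma UN_pair_const:
  assumes "(a, z) \<in> X" "(b, w) \<in> Y"
    and "\<And>a' z' b' w'. (a', z') \<in> X \<Longrightarrow> (b', w') \<in> Y \<Longrightarrow> F a' z' b' w' = S"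
  shows "(\<Union>(a', z')\<in>X. \<Union>(b', w')\<in>Y. F a' z' b' w') = S"
proof (rule SUP_eq_const)
  fix p assume p: "p \<in> X"
  show "(case p of (a', z') \<Rightarrow> \<Union>(b', w')\<in>Y. F a' z' b' w') = S"
  proof (cases p)
    case (Pair a' z')
    have "(\<Union>(b', w')\<in>Y. F a' z' b' w') = S"
      by (rule SUP_eq_const) (use assms(2,3) p Pair in auto)
    then show ?thesis by (simp add: Pair)
  qed
qed (use assms(1) in auto)

locale central_localization =
  fixes Z :: "'a::Rings.ring set"
  assumes Z_add: "z \<in> Z \<Longrightarrow> w \<in> Z \<Longrightarrow> z + w \<in> Z"
    and Z_mult: "z \<in> Z \<Longrightarrow> w \<in> Z \<Longrightarrow> z * w \<in> Z"
    and Z_minus: "z \<in> Z \<Longrightarrow> - z \<in> Z"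
    and Z_zero: "0 \<in> Z"
    and Z_central: "z \<in> Z \<Longrightarrow> a * z = z * a"
    and Z_regular: "z \<in> Z \<Longrightarrow> z \<noteq> 0 \<Longrightarrow> z * a = 0 \<Longrightarrow> a = 0"
    and Z_nontrivial: "Z \<noteq> {0}"
begin

abbreviation "D \<equiv> Z - {0}"

definition frac :: "'a \<Rightarrow> 'a \<Rightarrow> ('a \<times> 'a) set" where
  "frac a z = locrel Z `` {(a, z)}"

abbreviation "R \<equiv> localization Z"

lemma lcomm: "z \<in> Z \<Longrightarrow> a * (z * b) = z * (a * b)"
  by (metis Z_central mult.assoc)

lemma D_mult: "z \<in> D \<Longrightarrow> w \<in> D \<Longrightarrow> z * w \<in> D"
  using Z_mult Z_regular by auto

lemma D_cancel: "z \<in> D \<Longrightarrow> z * a = z * b \<longleftrightarrow> a = b"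
  using Z_regular[of z "a - b"] by (auto simp: right_diff_distrib)

lemma obtain_D: obtains c where "c \<in> D"
  using Z_nontrivial Z_zero by blast

lemma frac_mem: "(b, w) \<in> frac a z \<longleftrightarrow> z \<in> D \<and> w \<in> D \<and> w * a = z * b"
  by (auto simp: frac_def locrel_def)

lemma frac_eq:
  assumes "z \<in> D" "w \<in> D"
  shows "frac a z = frac b w \<longleftrightarrow> w * a = z * b"
proof
  assume "frac a z = frac b w"
  moreover have "(b, w) \<in> frac b w" using assms by (simp add: frac_mem)
  ultimately show "w * a = z * b" by (metis frac_mem)
next
  assume *: "w * a = z * b"
  have "v * a = z * c \<longleftrightarrow> v * b = w * c" if v: "v \<in> D" for v c
  proof -
    have "v * a = z * c \<longleftrightarrow> w * (v * a) = w * (z * c)" using D_cancel assms by blast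
    also have "w * (v * a) = z * (v * b)"
      using * v assms lcomm[of v w a] lcomm[of v z b] by auto
    also have "w * (z * c) = z * (w * c)" using lcomm assms by auto
    finally show ?thesis using D_cancel assms by blast
  qed
  then show "frac a z = frac b w" using assms by (auto simp: set_eq_iff frac_mem)
qed

lemma frac_eqI: "z \<in> D \<Longrightarrow> w \<in> D \<Longrightarrow> w * a = z * b \<Longrightarrow> frac a z = frac b w"
  by (simp add: frac_eq)

lemma carrier_R: "carrier R = {frac a z | a z. z \<in> D}"
  by (simp add: localization_def fractions_def frac_def)

lemma frac_mult:
  assumes z: "z \<in> D" and w: "w \<in> D"
  shows "frac a z \<otimes>\<^bsub>R\<^esub> frac b w = frac (a * b) (z * w)"
proof -
  have *: "frac (a' * b') (z' * w') = frac (a * b) (z * w)"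
    if "(a', z') \<in> frac a z" "(b', w') \<in> frac b w" for a' z' b' w'
  proof -
    have h: "z' \<in> D" "w' \<in> D" "z' * a = z * a'" "w' * b = w * b'" using that by (auto simp: frac_mem)
    have l: "a * (w' * b) = w' * (a * b)" "a' * (w * b') = w * (a' * b')"
      using lcomm h(2) w by blast+
    have "(z' * w') * (a * b) = (z' * a) * (w' * b)"
      by (simp only: mult.assoc l)
    also have "\<dots> = (z * w) * (a' * b')"
      unfolding h(3,4) by (simp only: mult.assoc l)
    finally show ?thesis by (intro frac_eqI D_mult h(1,2) z w) (rule sym)
  qed
  have mem: "(a, z) \<in> frac a z" "(b, w) \<in> frac b w" using z w by (simp_all add: frac_mem)
  show ?thesis
    unfolding localization_def ring.simps monoid.simps frac_def[symmetric]
    by (rule UN_pair_const[OF mem *])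
qed

lemma frac_add:
  assumes z: "z \<in> D" and w: "w \<in> D"
  shows "frac a z \<oplus>\<^bsub>R\<^esub> frac b w = frac (w * a + z * b) (z * w)"
proof -
  have *: "frac (w' * a' + z' * b') (z' * w') = frac (w * a + z * b) (z * w)"
    if "(a', z') \<in> frac a z" "(b', w') \<in> frac b w" for a' z' b' w'
  proof -
    have h: "z' \<in> D" "w' \<in> D" "z' * a = z * a'" "w' * b = w * b'" using that by (auto simp: frac_mem)
    have Zs: "z \<in> Z" "w \<in> Z" "z' \<in> Z" "w' \<in> Z" using h z w by auto
    have 1: "z * w * (w' * a') = w' * w * (z * a')"
      using Zs by (simp add: mult.assoc lcomm)
    have 2: "z' * w' * (w * a) = w' * w * (z' * a)"
      using Zs by (simp add: mult.assoc lcomm)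
    have 3: "z * w * (z' * b') = z' * z * (w * b')"
      using Zs by (simp add: mult.assoc lcomm)
    have 4: "z' * w' * (z * b) = z' * z * (w' * b)"
      using Zs by (simp add: mult.assoc lcomm)
    have "z * w * (w' * a' + z' * b') = z' * w' * (w * a + z * b)"
      unfolding distrib_left 1 2 3 4 h ..
    then show ?thesis by (intro frac_eqI D_mult h(1,2) z w)
  qed
  have mem: "(a, z) \<in> frac a z" "(b, w) \<in> frac b w" using z w by (simp_all add: frac_mem)
  show ?thesis
    unfolding localization_def ring.simps monoid.simps frac_def[symmetric]
    by (rule UN_pair_const[OF mem *])
qed

lemma frac_zero: "z \<in> D \<Longrightarrow> \<zero>\<^bsub>R\<^esub> = frac 0 z"
proof -
  assume z: "z \<in> D"
  show ?thesis
    unfolding localization_def ring.simps monoid.simps frac_def[symmetric]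
    by (rule SUP_eq_const) (use z in \<open>auto simp: frac_eq\<close>)
qed

lemma frac_one: "z \<in> D \<Longrightarrow> \<one>\<^bsub>R\<^esub> = frac z z"
proof -
  assume z: "z \<in> D"
  show ?thesis
    unfolding localization_def ring.simps monoid.simps frac_def[symmetric]
    by (rule SUP_eq_const) (use z in \<open>auto simp: frac_eq Z_central\<close>)
qed

lemma frac_closed: "z \<in> D \<Longrightarrow> frac a z \<in> carrier R"
  by (auto simp: carrier_R)

lemma R_cases:
  assumes "x \<in> carrier R" obtains a z where "z \<in> D" "x = frac a z"
  using assms by (auto simp: carrier_R)

lemma D_Z: "z \<in> D \<Longrightarrow> z \<in> Z" by simp

lemma R_ring: "ring R"
proof (rule ringI)
  show "abelian_group R"
  proof (rule abelian_groupI)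
    fix x y assume "x \<in> carrier R" "y \<in> carrier R"
    then obtain a z b w where x: "z \<in> D" "x = frac a z" and y: "w \<in> D" "y = frac b w"
      by (metis R_cases)
    show "x \<oplus>\<^bsub>R\<^esub> y \<in> carrier R"
      unfolding x(2) y(2) frac_add[OF x(1) y(1)] by (rule frac_closed[OF D_mult[OF x(1) y(1)]])
    show "x \<oplus>\<^bsub>R\<^esub> y = y \<oplus>\<^bsub>R\<^esub> x"
      unfolding x(2) y(2) frac_add[OF x(1) y(1)] frac_add[OF y(1) x(1)]
      using Z_central[OF D_Z[OF x(1)], of w] by (simp add: add.commute)
    fix v assume "v \<in> carrier R"
    then obtain c u where v: "u \<in> D" "v = frac c u" by (metis R_cases)
    note Zs = x(1)[THEN D_Z] y(1)[THEN D_Z] v(1)[THEN D_Z]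
    have 1: "u * (w * a) = w * (u * a)" "u * (z * b) = z * (u * b)"
      using lcomm Zs by auto
    show "x \<oplus>\<^bsub>R\<^esub> y \<oplus>\<^bsub>R\<^esub> v = x \<oplus>\<^bsub>R\<^esub> (y \<oplus>\<^bsub>R\<^esub> v)"
      unfolding x(2) y(2) v(2) frac_add[OF x(1) y(1)] frac_add[OF y(1) v(1)]
        frac_add[OF D_mult[OF x(1) y(1)] v(1)] frac_add[OF x(1) D_mult[OF y(1) v(1)]]
      by (simp add: distrib_left mult.assoc add.assoc 1)
  next
    obtain c where c: "c \<in> D" by (rule obtain_D)
    show "\<zero>\<^bsub>R\<^esub> \<in> carrier R" unfolding frac_zero[OF c] by (rule frac_closed[OF c])
    fix x assume "x \<in> carrier R"
    then obtain a z where x: "z \<in> D" "x = frac a z" by (metis R_cases)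
    show "\<zero>\<^bsub>R\<^esub> \<oplus>\<^bsub>R\<^esub> x = x"
      unfolding x(2) frac_zero[OF x(1)] frac_add[OF x(1) x(1)]
      by (rule frac_eqI[OF D_mult[OF x(1) x(1)] x(1)]) (simp add: mult.assoc)
    show "\<exists>y\<in>carrier R. y \<oplus>\<^bsub>R\<^esub> x = \<zero>\<^bsub>R\<^esub>"
      unfolding x(2) frac_zero[OF D_mult[OF x(1) x(1)]]
      by (rule bexI[of _ "frac (- a) z"]) (simp_all only: frac_add[OF x(1) x(1)] frac_closed[OF x(1)] mult_minus_right add.left_inverse)
  qed
  show "Group.monoid R"
  proof (rule monoidI)
    obtain c where c: "c \<in> D" by (rule obtain_D)
    show "\<one>\<^bsub>R\<^esub> \<in> carrier R" unfolding frac_one[OF c] by (rule frac_closed[OF c])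
    fix x assume "x \<in> carrier R"
    then obtain a z where x: "z \<in> D" "x = frac a z" by (metis R_cases)
    show "\<one>\<^bsub>R\<^esub> \<otimes>\<^bsub>R\<^esub> x = x"
      unfolding x(2) frac_one[OF x(1)] frac_mult[OF x(1) x(1)]
      by (rule frac_eqI[OF D_mult[OF x(1) x(1)] x(1)]) (simp add: mult.assoc)
    show "x \<otimes>\<^bsub>R\<^esub> \<one>\<^bsub>R\<^esub> = x"
      unfolding x(2) frac_one[OF x(1)] frac_mult[OF x(1) x(1)]
      by (rule frac_eqI[OF D_mult[OF x(1) x(1)] x(1)]) (simp add: mult.assoc Z_central[OF D_Z[OF x(1)], of a])
    fix y assume "y \<in> carrier R"
    then obtain b w where y: "w \<in> D" "y = frac b w" by (metis R_cases)
    show "x \<otimes>\<^bsub>R\<^esub> y \<in> carrier R"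
      unfolding x(2) y(2) frac_mult[OF x(1) y(1)] by (rule frac_closed[OF D_mult[OF x(1) y(1)]])
    fix v assume "v \<in> carrier R"
    then obtain c u where v: "u \<in> D" "v = frac c u" by (metis R_cases)
    show "x \<otimes>\<^bsub>R\<^esub> y \<otimes>\<^bsub>R\<^esub> v = x \<otimes>\<^bsub>R\<^esub> (y \<otimes>\<^bsub>R\<^esub> v)"
      unfolding x(2) y(2) v(2) frac_mult[OF x(1) y(1)] frac_mult[OF y(1) v(1)]
        frac_mult[OF D_mult[OF x(1) y(1)] v(1)] frac_mult[OF x(1) D_mult[OF y(1) v(1)]]
      by (simp add: mult.assoc)
  qed
  fix x y v assume "x \<in> carrier R" "y \<in> carrier R" "v \<in> carrier R"
  then obtain a z b w c u where x: "z \<in> D" "x = frac a z" and y: "w \<in> D" "y = frac b w"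
    and v: "u \<in> D" "v = frac c u"
    by (metis R_cases)
  note Zs = x(1)[THEN D_Z] y(1)[THEN D_Z] v(1)[THEN D_Z]
  show "(x \<oplus>\<^bsub>R\<^esub> y) \<otimes>\<^bsub>R\<^esub> v = x \<otimes>\<^bsub>R\<^esub> v \<oplus>\<^bsub>R\<^esub> y \<otimes>\<^bsub>R\<^esub> v"
    unfolding x(2) y(2) v(2) frac_add[OF x(1) y(1)] frac_mult[OF D_mult[OF x(1) y(1)] v(1)]
      frac_mult[OF x(1) v(1)] frac_mult[OF y(1) v(1)] frac_add[OF D_mult[OF x(1) v(1)] D_mult[OF y(1) v(1)]]
  proof (rule frac_eqI)
    have "z * u * (w * u) * ((w * a + z * b) * c) = z * (u * (w * (u * (w * (a * c))))) + z * (u * (w * (u * (z * (b * c)))))"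
      by (simp add: distrib_left distrib_right mult.assoc)
    moreover have "z * w * u * (w * u * (a * c) + z * u * (b * c)) = z * (w * (u * (w * (u * (a * c))))) + z * (w * (u * (z * (u * (b * c)))))"
      by (simp add: distrib_left distrib_right mult.assoc)
    moreover have "w * (u * (w * (u * (a * c)))) = u * (w * (u * (w * (a * c))))"
      "w * (u * (z * (u * (b * c)))) = u * (w * (u * (z * (b * c))))"
      using Zs by (simp_all add: lcomm)
    ultimately show "z * u * (w * u) * ((w * a + z * b) * c) = z * w * u * (w * u * (a * c) + z * u * (b * c))"
      by simp
  qed (intro D_mult x(1) y(1) v(1))+
  show "v \<otimes>\<^bsub>R\<^esub> (x \<oplus>\<^bsub>R\<^esub> y) = v \<otimes>\<^bsub>R\<^esub> x \<oplus>\<^bsub>R\<^esub> v \<otimes>\<^bsub>R\<^esub> y"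
    unfolding x(2) y(2) v(2) frac_add[OF x(1) y(1)] frac_mult[OF v(1) D_mult[OF x(1) y(1)]]
      frac_mult[OF v(1) x(1)] frac_mult[OF v(1) y(1)] frac_add[OF D_mult[OF v(1) x(1)] D_mult[OF v(1) y(1)]]
  proof (rule frac_eqI)
    have "u * z * (u * w) * (c * (w * a + z * b)) = u * (z * (u * (w * (c * (w * a))))) + u * (z * (u * (w * (c * (z * b)))))"
      by (simp add: distrib_left distrib_right mult.assoc)
    moreover have "u * (z * w) * (u * w * (c * a) + u * z * (c * b)) = u * (z * (w * (u * (w * (c * a))))) + u * (z * (w * (u * (z * (c * b)))))"
      by (simp add: distrib_left distrib_right mult.assoc)
    moreover have "u * (w * (c * (w * a))) = w * (u * (w * (c * a)))"
      "u * (w * (c * (z * b))) = w * (u * (z * (c * b)))"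
      using Zs by (simp_all add: lcomm lcomm[where a = c])
    ultimately show "u * z * (u * w) * (c * (w * a + z * b)) = u * (z * w) * (u * w * (c * a) + u * z * (c * b))"
      by simp
  qed (intro D_mult x(1) y(1) v(1))+
qed

lemma fractions_frac: "fractions Z B = {frac a z | a z. a \<in> B \<and> z \<in> D}"
  by (simp add: fractions_def frac_def)

lemma fracI: "a \<in> B \<Longrightarrow> z \<in> D \<Longrightarrow> frac a z \<in> fractions Z B"
  by (auto simp: fractions_frac)

lemma fracE:
  assumes "x \<in> fractions Z B" obtains a z where "a \<in> B" "z \<in> D" "x = frac a z"
  using assms by (auto simp: fractions_frac)

lemma frac_eq_zero: "z \<in> D \<Longrightarrow> frac a z = \<zero>\<^bsub>R\<^esub> \<longleftrightarrow> a = 0"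
  by (subst frac_zero[of z], simp, subst frac_eq, simp, simp) (use Z_regular in auto)

lemma frac_minus:
  assumes z: "z \<in> D" shows "\<ominus>\<^bsub>R\<^esub> frac a z = frac (- a) z"
proof -
  interpret R: ring R by (rule R_ring)
  have "frac (- a) z \<oplus>\<^bsub>R\<^esub> frac a z = \<zero>\<^bsub>R\<^esub>"
    unfolding frac_add[OF z z] frac_zero[OF D_mult[OF z z]] by simp
  then show ?thesis by (rule R.minus_equality) (rule frac_closed[OF z])+
qed

lemma center_subring: "subring (fractions Z Z) R"
proof -
  interpret R: ring R by (rule R_ring)
  show ?thesis
  proof (rule R.subringI)
    show "fractions Z Z \<subseteq> carrier R" by (auto elim!: fracE intro: frac_closed[simplified])
    obtain c where c: "c \<in> D" by (rule obtain_D)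
    show "\<one>\<^bsub>R\<^esub> \<in> fractions Z Z" unfolding frac_one[OF c] by (rule fracI) (use c in auto)
    fix x assume "x \<in> fractions Z Z"
    then obtain a z where x: "a \<in> Z" "z \<in> D" "x = frac a z" by (rule fracE)
    show "\<ominus>\<^bsub>R\<^esub> x \<in> fractions Z Z"
      unfolding x(3) frac_minus[OF x(2)] by (intro fracI Z_minus x)
    fix y assume "y \<in> fractions Z Z"
    then obtain b w where y: "b \<in> Z" "w \<in> D" "y = frac b w" by (rule fracE)
    show "x \<otimes>\<^bsub>R\<^esub> y \<in> fractions Z Z"
      unfolding x(3) y(3) frac_mult[OF x(2) y(2)] by (intro fracI Z_mult D_mult x y)
    show "x \<oplus>\<^bsub>R\<^esub> y \<in> fractions Z Z"
      unfolding x(3) y(3) frac_add[OF x(2) y(2)]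
      by (intro fracI Z_add Z_mult D_mult x y x(2)[THEN D_Z] y(2)[THEN D_Z])
  qed
qed

section \<open>From generators up to central denominators to Clifford algebras\<close>

inductive_set gen :: "'a set \<Rightarrow> 'a set" for E where
  Z: "z \<in> Z \<Longrightarrow> z \<in> gen E"
| E: "x \<in> E \<Longrightarrow> x \<in> gen E"
| add: "x \<in> gen E \<Longrightarrow> y \<in> gen E \<Longrightarrow> x + y \<in> gen E"
| minus: "x \<in> gen E \<Longrightarrow> - x \<in> gen E"
| mult: "x \<in> gen E \<Longrightarrow> y \<in> gen E \<Longrightarrow> x * y \<in> gen E"

text \<open>Reduces the recognition problem to computations inside \<open>A\<close>. Generators are
  asked to reach only a central multiple of each element, since the multiplier becomes invertible in
  the localization.\<close>

lemma Clifford_criterion: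
  assumes two: "\<And>x::'a. x + x = 0 \<Longrightarrow> x = 0"
    and A0: "0 \<in> A0" "\<And>x y. x \<in> A0 \<Longrightarrow> y \<in> A0 \<Longrightarrow> x + y \<in> A0"
    and A1: "0 \<in> A1" "\<And>x y. x \<in> A1 \<Longrightarrow> y \<in> A1 \<Longrightarrow> x + y \<in> A1"
    and A01: "A0 \<inter> A1 = {0}" "Z \<subseteq> A0"
    and A00m: "\<And>x y. x \<in> A0 \<Longrightarrow> y \<in> A0 \<Longrightarrow> x * y \<in> A0"
    and A01m: "\<And>x y. x \<in> A0 \<Longrightarrow> y \<in> A1 \<Longrightarrow> x * y \<in> A1"
    and A10m: "\<And>x y. x \<in> A1 \<Longrightarrow> y \<in> A0 \<Longrightarrow> x * y \<in> A1"
    and A11m: "\<And>x y. x \<in> A1 \<Longrightarrow> y \<in> A1 \<Longrightarrow> x * y \<in> A0"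
    and e: "\<And>i. i < n \<Longrightarrow> e i \<in> A1" "\<And>i. i < n \<Longrightarrow> e i * e i \<in> D"
    and anti: "\<And>i j. i < n \<Longrightarrow> j < n \<Longrightarrow> i \<noteq> j \<Longrightarrow> e i * e j = - (e j * e i)"
    and gen: "\<And>x. \<exists>z\<in>D. z * x \<in> gen (e ` {..<n})"
  defines "K \<equiv> R\<lparr>carrier := fractions Z Z\<rparr>"
  shows "\<exists>q. quadratic_form K (coord_space K n) q \<and> nondegenerate K (coord_space K n) q \<and>
     (\<exists>\<phi>\<in>ring_iso R (Clifford_algebra K n q).
        \<phi> ` fractions Z A0 = Clifford_even K n q \<and> \<phi> ` fractions Z A1 = Clifford_odd K n q \<and>
        (\<forall>c\<in>carrier K. \<forall>x\<in>carrier R.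
           \<phi> (c \<otimes>\<^bsub>R\<^esub> x) = Clifford_scalar K n q c \<otimes>\<^bsub>Clifford_algebra K n q\<^esub> \<phi> x))"
proof -
  interpret R: ring R by (rule R_ring)
  obtain c where c: "c \<in> D" by (rule obtain_D)
  \<comment> \<open>The embedding of \<open>A\<close>. A denominator one need not exist, so an
    arbitrary fixed nonzero central \<open>c\<close> is put into both numerator and
    denominator.\<close>
  define \<iota> where "\<iota> x = frac (c * x) c" for x
  have i_mult: "\<iota> x \<otimes>\<^bsub>R\<^esub> \<iota> y = \<iota> (x * y)" for x y
    unfolding \<iota>_def frac_mult[OF c c]
    by (rule frac_eqI[OF D_mult[OF c c] c]) (simp add: mult.assoc lcomm[OF D_Z[OF c], of x])
  have i_add: "\<iota> x \<oplus>\<^bsub>R\<^esub> \<iota> y = \<iota> (x + y)" for x y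
    unfolding \<iota>_def frac_add[OF c c]
    by (rule frac_eqI[OF D_mult[OF c c] c]) (simp add: mult.assoc distrib_left)
  have i_minus: "\<ominus>\<^bsub>R\<^esub> \<iota> x = \<iota> (- x)" for x
    unfolding \<iota>_def frac_minus[OF c] by simp
  have i_zero: "\<iota> x = \<zero>\<^bsub>R\<^esub> \<longleftrightarrow> x = 0" for x
    unfolding \<iota>_def frac_eq_zero[OF c] using Z_regular c by auto
  have scal: "z * x \<in> A0" if "z \<in> D" "x \<in> A0" for z x using that A01 A00m by auto
  have scal1: "z * x \<in> A1" if "z \<in> D" "x \<in> A1" for z x using that A01 A01m by auto
  have "clifford_generators R (fractions Z Z) n (\<lambda>i. \<iota> (e i)) (fractions Z A0) (fractions Z A1)"
  proof (rule clifford_generators.intro[OF R_ring], rule clifford_generators_axioms.intro)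
    show "subring (fractions Z Z) R" by (rule center_subring)
    show "x \<otimes>\<^bsub>R\<^esub> d = d \<otimes>\<^bsub>R\<^esub> x" if prem: "d \<in> fractions Z Z" "x \<in> carrier R" for d x
    proof -
      obtain b w where d: "b \<in> Z" "w \<in> D" "d = frac b w" using prem(1) by (rule fracE)
      obtain a z where x: "z \<in> D" "x = frac a z" using prem(2) by (rule R_cases)
      show ?thesis
        unfolding d(3) x(2) frac_mult[OF d(2) x(1)] frac_mult[OF x(1) d(2)]
        using Z_central[OF d(1), of a] Z_central[OF D_Z[OF d(2)], of z] by simp
    qed
    show "d = \<zero>\<^bsub>R\<^esub> \<or> x = \<zero>\<^bsub>R\<^esub>"
      if prem: "d \<in> fractions Z Z" "x \<in> carrier R" "d \<otimes>\<^bsub>R\<^esub> x = \<zero>\<^bsub>R\<^esub>" for d x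
    proof -
      obtain b w where d: "b \<in> Z" "w \<in> D" "d = frac b w" using prem(1) by (rule fracE)
      obtain a z where x: "z \<in> D" "x = frac a z" using prem(2) by (rule R_cases)
      have "b * a = 0"
        using that(3) unfolding d(3) x(2) frac_mult[OF d(2) x(1)] frac_eq_zero[OF D_mult[OF d(2) x(1)]] .
      then show ?thesis
        unfolding d(3) x(2) frac_eq_zero[OF d(2)] frac_eq_zero[OF x(1)] using Z_regular d(1) by blast
    qed
    show "x = \<zero>\<^bsub>R\<^esub>" if prem: "x \<in> carrier R" "x \<oplus>\<^bsub>R\<^esub> x = \<zero>\<^bsub>R\<^esub>" for x
    proof -
      obtain a z where x: "z \<in> D" "x = frac a z" using prem(1) by (rule R_cases)
      have "z * a + z * a = 0"
        using that(2) unfolding x(2) frac_add[OF x(1) x(1)] frac_eq_zero[OF D_mult[OF x(1) x(1)]] .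
      then have "z * a = 0" by (rule two)
      then show ?thesis unfolding x(2) frac_eq_zero[OF x(1)] using Z_regular x(1) by blast
    qed
    show "\<iota> (e i) \<in> fractions Z A1" if "i < n" for i
      unfolding \<iota>_def by (intro fracI scal1 e(1) c that)
    show "\<iota> (e i) \<otimes>\<^bsub>R\<^esub> \<iota> (e j) = \<ominus>\<^bsub>R\<^esub> (\<iota> (e j) \<otimes>\<^bsub>R\<^esub> \<iota> (e i))" if "i < n" "j < n" "i \<noteq> j" for i j
      unfolding i_mult i_minus anti[OF that] ..
    show "\<iota> (e i) \<otimes>\<^bsub>R\<^esub> \<iota> (e i) \<in> fractions Z Z" if "i < n" for i
      unfolding i_mult unfolding \<iota>_def by (intro fracI Z_mult c D_Z[OF c] D_Z[OF e(2)] that)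
    show "\<iota> (e i) \<otimes>\<^bsub>R\<^esub> \<iota> (e i) \<noteq> \<zero>\<^bsub>R\<^esub>" if "i < n" for i
      unfolding i_mult i_zero using e(2)[OF that] by simp
    show "carrier R \<subseteq> S"
      if S: "subring S R" and k: "fractions Z Z \<subseteq> S" and eS: "(\<lambda>i. \<iota> (e i)) ` {..<n} \<subseteq> S" for S
    proof
      fix x assume "x \<in> carrier R"
      then obtain a z where x: "z \<in> D" "x = frac a z" by (rule R_cases)
      obtain z' where z': "z' \<in> D" "z' * a \<in> gen (e ` {..<n})" using gen by blast
      have i_gen: "\<iota> y \<in> S" if "y \<in> gen (e ` {..<n})" for y
        using that
      proof induction
        case (Z z)
        have "\<iota> z \<in> fractions Z Z" unfolding \<iota>_def by (intro fracI Z_mult c D_Z[OF c] Z)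
        then show ?case using k by blast
      next
        case (E y) then show ?case using eS by auto
      next
        case (add y y') then show ?case unfolding i_add[symmetric] by (intro subringE(7)[OF S])
      next
        case (minus y) then show ?case unfolding i_minus[symmetric] by (intro subringE(5)[OF S])
      next
        case (mult y y') then show ?case unfolding i_mult[symmetric] by (intro subringE(6)[OF S])
      qed
      have zz: "z' * z \<in> D" by (rule D_mult[OF z'(1) x(1)])
      \<comment> \<open>The fraction of \<open>a\<close> by \<open>z\<close> is the inverse of
        \<open>z' * z\<close> times the image of \<open>z' * a\<close>; the inverse is itself
        written with \<open>c\<close> on both sides.\<close>
      have "x = frac c (c * (z' * z)) \<otimes>\<^bsub>R\<^esub> \<iota> (z' * a)"
        unfolding x(2) \<iota>_def frac_mult[OF D_mult[OF c zz] c]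
        by (rule frac_eqI[OF x(1) D_mult[OF D_mult[OF c zz] c]])
          (use z'(1) x(1) c in \<open>simp add: mult.assoc lcomm\<close>)
      moreover have "frac c (c * (z' * z)) \<in> S"
        using fracI[OF D_Z[OF c] D_mult[OF c zz]] k by blast
      ultimately show "x \<in> S" using subringE(6)[OF S] i_gen[OF z'(2)] by simp
    qed
    show "fractions Z A0 \<subseteq> carrier R" "fractions Z A1 \<subseteq> carrier R"
      by (auto elim!: fracE intro: frac_closed[simplified])
    show "fractions Z A0 \<inter> fractions Z A1 = {\<zero>\<^bsub>R\<^esub>}"
    proof (intro equalityI subsetI)
      fix x assume "x \<in> fractions Z A0 \<inter> fractions Z A1"
      then have x0: "x \<in> fractions Z A0" and x1: "x \<in> fractions Z A1" by auto
      obtain a z where x: "a \<in> A0" "z \<in> D" "x = frac a z" using x0 by (rule fracE)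
      obtain b w where y: "b \<in> A1" "w \<in> D" "x = frac b w" using x1 by (rule fracE)
      have "w * a = z * b" using x(3) y(3) frac_eq[OF x(2) y(2), of a b] by blast
      then have "w * a \<in> A0 \<inter> A1" using scal[OF y(2) x(1)] scal1[OF x(2) y(1)] by simp
      then have "w * a = 0" using A01 by blast
      then have "a = 0" using Z_regular y(2) by blast
      then show "x \<in> {\<zero>\<^bsub>R\<^esub>}" using x(3) frac_eq_zero[OF x(2)] by simp
    next
      fix x assume "x \<in> {\<zero>\<^bsub>R\<^esub>}"
      then show "x \<in> fractions Z A0 \<inter> fractions Z A1"
        using frac_zero[OF c] fracI[OF A0(1) c] fracI[OF A1(1) c] by simp
    qed
    show "fractions Z Z \<subseteq> fractions Z A0" using A01(2) by (auto simp: fractions_frac)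
    fix x y
    show "x \<oplus>\<^bsub>R\<^esub> y \<in> fractions Z A0" if prem: "x \<in> fractions Z A0" "y \<in> fractions Z A0"
    proof -
      obtain a z where x: "a \<in> A0" "z \<in> D" "x = frac a z" using prem(1) by (rule fracE)
      obtain b w where y: "b \<in> A0" "w \<in> D" "y = frac b w" using prem(2) by (rule fracE)
      show ?thesis unfolding x(3) y(3) frac_add[OF x(2) y(2)]
        by (intro fracI A0 scal D_mult x y)
    qed
    show "x \<oplus>\<^bsub>R\<^esub> y \<in> fractions Z A1" if prem: "x \<in> fractions Z A1" "y \<in> fractions Z A1"
    proof -
      obtain a z where x: "a \<in> A1" "z \<in> D" "x = frac a z" using prem(1) by (rule fracE)
      obtain b w where y: "b \<in> A1" "w \<in> D" "y = frac b w" using prem(2) by (rule fracE)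
      show ?thesis unfolding x(3) y(3) frac_add[OF x(2) y(2)]
        by (intro fracI A1 scal1 D_mult x y)
    qed
    have prod: "x \<otimes>\<^bsub>R\<^esub> y \<in> fractions Z B''"
      if prem: "x \<in> fractions Z B" "y \<in> fractions Z B'" "\<And>a b. a \<in> B \<Longrightarrow> b \<in> B' \<Longrightarrow> a * b \<in> B''" for B B' B''
    proof -
      obtain a z where x: "a \<in> B" "z \<in> D" "x = frac a z" using prem(1) by (rule fracE)
      obtain b w where y: "b \<in> B'" "w \<in> D" "y = frac b w" using prem(2) by (rule fracE)
      show ?thesis unfolding x(3) y(3) frac_mult[OF x(2) y(2)]
        by (intro fracI that(3) D_mult x y)
    qed
    show "x \<otimes>\<^bsub>R\<^esub> y \<in> fractions Z A0" if prem: "x \<in> fractions Z A0" "y \<in> fractions Z A0"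
      using that A00m by (rule prod)
    show "x \<otimes>\<^bsub>R\<^esub> y \<in> fractions Z A1" if prem: "x \<in> fractions Z A0" "y \<in> fractions Z A1"
      using that A01m by (rule prod)
    show "x \<otimes>\<^bsub>R\<^esub> y \<in> fractions Z A1" if prem: "x \<in> fractions Z A1" "y \<in> fractions Z A0"
      using that A10m by (rule prod)
    show "x \<otimes>\<^bsub>R\<^esub> y \<in> fractions Z A0" if prem: "x \<in> fractions Z A1" "y \<in> fractions Z A1"
      using that A11m by (rule prod)
  qed
  from clifford_generators.Clifford_iso[OF this] show ?thesis unfolding K_def .
qed

end

section \<open>Prime superalgebras\<close>

locale prime_superalgebra_locale = assoc_superalgebra scale A0 A1
  for scale :: "'k::comm_ring_1 \<Rightarrow> 'a::Rings.ring \<Rightarrow> 'a" and A0 A1 +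
  assumes half: "\<exists>h::'k. 2 * h = 1"
    and prime: "prime_superalgebra scale A0 A1"
    and nontrivial: "A1 \<noteq> {0}"
begin

definition A :: "bool \<Rightarrow> 'a set" where
  "A i = (if i then A1 else A0)"

text \<open>Carries the degrees as arguments, so that the sign is known without extracting
  components. It is the superbracket only when \<open>x\<close> and \<open>y\<close> are homogeneous
  of degrees \<open>i\<close> and \<open>j\<close>.\<close>

definition br :: "bool \<Rightarrow> bool \<Rightarrow> 'a \<Rightarrow> 'a \<Rightarrow> 'a" where
  "br i j x y = (if i \<and> j then x * y + y * x else x * y - y * x)"

abbreviation "submod \<equiv> graded_submodule scale A0 A1"
abbreviation "gideal \<equiv> graded_ideal scale A0 A1"
abbreviation "Z \<equiv> even_center A0"

lemma A_simps [simp]: "A False = A0" "A True = A1"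
  by (auto simp: A_def)

lemma subspace_A: "subspace (A i)"
  using subspace_A0 subspace_A1 by (simp add: A_def)

lemma A_zero [simp]: "0 \<in> A i" and A_add: "x \<in> A i \<Longrightarrow> y \<in> A i \<Longrightarrow> x + y \<in> A i"
  and A_diff: "x \<in> A i \<Longrightarrow> y \<in> A i \<Longrightarrow> x - y \<in> A i"
  and A_minus: "x \<in> A i \<Longrightarrow> - x \<in> A i"
  by (rule subspace_0 subspace_add subspace_diff subspace_neg; (rule subspace_A | assumption))+

lemma A_mult: "x \<in> A i \<Longrightarrow> y \<in> A j \<Longrightarrow> x * y \<in> A (i \<noteq> j)"
  using A0_A0 A0_A1 A1_A0 A1_A1 by (cases i; cases j) auto

lemma A_inter: "x \<in> A i \<Longrightarrow> x \<in> A (\<not> i) \<Longrightarrow> x = 0"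
  using A0_inter_A1 by (cases i) auto

lemma A_sum_zero:
  assumes "x \<in> A i" "y \<in> A (\<not> i)" "x + y = 0" shows "x = 0" "y = 0"
proof -
  have "x = - y" using assms(3) by (simp add: eq_neg_iff_add_eq_0)
  then have "x \<in> A (\<not> i)" using A_minus assms(2) by simp
  then show "x = 0" using A_inter assms(1) by blast
  then show "y = 0" using assms(3) by simp
qed

lemma A_decomp: obtains x0 x1 where "x0 \<in> A0" "x1 \<in> A1" "x = x0 + x1"
  using A0_plus_A1 by blast

lemma A_induct:
  assumes "\<And>i x. x \<in> A i \<Longrightarrow> P x" "\<And>x y. P x \<Longrightarrow> P y \<Longrightarrow> P (x + y)"
  shows "P x"
proof -
  obtain x0 x1 where "x0 \<in> A0" "x1 \<in> A1" "x = x0 + x1" by (rule A_decomp)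
  then show ?thesis using assms(1)[of x0 False] assms(1)[of x1 True] assms(2) by simp
qed

lemma double_eq_zero: "(x::'a) + x = 0 \<Longrightarrow> x = 0"
proof -
  assume *: "x + x = 0"
  obtain h :: 'k where h: "2 * h = 1" using half by blast
  have "scale h (x + x) = scale (h + h) x"
    by (simp only: scale_right_distrib scale_left_distrib)
  also have "\<dots> = x" using h by (simp only: mult_2[symmetric] scale_one)
  finally show ?thesis unfolding * by simp
qed

lemma subspace_half: "subspace S \<Longrightarrow> x + x \<in> S \<Longrightarrow> x \<in> S"
proof -
  assume S: "subspace S" and *: "x + x \<in> S"
  obtain h :: 'k where h: "2 * h = 1" using half by blast
  have "scale h (x + x) = scale (h + h) x"
    by (simp only: scale_right_distrib scale_left_distrib)
  also have "\<dots> = x" using h by (simp only: mult_2[symmetric] scale_one)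
  finally show ?thesis using subspace_scale[OF S *, of h] by simp
qed

section \<open>Graded submodules and ideals\<close>

lemma submod_subspace: "submod S \<Longrightarrow> subspace S"
  by (simp add: graded_submodule_def)

lemma submod_zero: "submod S \<Longrightarrow> 0 \<in> S"
  by (rule subspace_0[OF submod_subspace])

lemma submod_add: "submod S \<Longrightarrow> x \<in> S \<Longrightarrow> y \<in> S \<Longrightarrow> x + y \<in> S"
  by (rule subspace_add[OF submod_subspace])

lemma submod_diff: "submod S \<Longrightarrow> x \<in> S \<Longrightarrow> y \<in> S \<Longrightarrow> x - y \<in> S"
  by (rule subspace_diff[OF submod_subspace])

lemma submod_minus: "submod S \<Longrightarrow> x \<in> S \<Longrightarrow> - x \<in> S"
  by (rule subspace_neg[OF submod_subspace])

lemma submod_scale: "submod S \<Longrightarrow> x \<in> S \<Longrightarrow> scale r x \<in> S"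
  by (rule subspace_scale[OF submod_subspace])

lemma submod_components:
  assumes "submod S" "x \<in> A i" "y \<in> A (\<not> i)" "x + y \<in> S" shows "x \<in> S" "y \<in> S"
proof -
  have "y + x \<in> S" using assms(4) by (simp add: add.commute)
  then have "x \<in> S \<and> y \<in> S"
    using assms by (cases i) (auto simp: graded_submodule_def)
  then show "x \<in> S" "y \<in> S" by auto
qed

lemma submod_decomp:
  assumes "submod S" "x \<in> S"
  obtains x0 x1 where "x0 \<in> A0" "x1 \<in> A1" "x0 \<in> S" "x1 \<in> S" "x = x0 + x1"
proof -
  obtain x0 x1 where x: "x0 \<in> A0" "x1 \<in> A1" "x = x0 + x1" by (rule A_decomp)
  then have "x0 \<in> S" "x1 \<in> S"
    using submod_components[OF assms(1), of x0 False x1] assms(2) by simp_all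
  then show ?thesis using that x by blast
qed

lemma submod_induct:
  assumes "submod S" "x \<in> S"
    and "\<And>i x. x \<in> S \<Longrightarrow> x \<in> A i \<Longrightarrow> P x" "\<And>x y. P x \<Longrightarrow> P y \<Longrightarrow> P (x + y)"
  shows "P x"
proof -
  obtain x0 x1 where "x0 \<in> A0" "x1 \<in> A1" "x0 \<in> S" "x1 \<in> S" "x = x0 + x1"
    using submod_decomp[OF assms(1,2)] .
  then show ?thesis using assms(3)[of x0 False] assms(3)[of x1 True] assms(4) by simp
qed

lemma submodI:
  assumes "0 \<in> S" "\<And>x y. x \<in> S \<Longrightarrow> y \<in> S \<Longrightarrow> x + y \<in> S" "\<And>r x. x \<in> S \<Longrightarrow> scale r x \<in> S"
    and "\<And>x y. x \<in> A0 \<Longrightarrow> y \<in> A1 \<Longrightarrow> x + y \<in> S \<Longrightarrow> x \<in> S"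
  shows "submod S"
proof -
  have "subspace S" using assms(1-3) by (rule subspaceI)
  moreover have "y \<in> S" if "x \<in> A0" "y \<in> A1" "x + y \<in> S" for x y
    using subspace_diff[OF \<open>subspace S\<close> that(3) assms(4)[OF that]] by simp
  ultimately show ?thesis using assms(4) by (auto simp: graded_submodule_def)
qed

lemma gideal_submod: "gideal I \<Longrightarrow> submod I"
  and gideal_left: "gideal I \<Longrightarrow> x \<in> I \<Longrightarrow> a * x \<in> I"
  and gideal_right: "gideal I \<Longrightarrow> x \<in> I \<Longrightarrow> x * a \<in> I"
  by (auto simp: graded_ideal_def)

lemma gidealI: "submod I \<Longrightarrow> (\<And>x a. x \<in> I \<Longrightarrow> a * x \<in> I) \<Longrightarrow> (\<And>x a. x \<in> I \<Longrightarrow> x * a \<in> I) \<Longrightarrow> gideal I"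
  by (auto simp: graded_ideal_def)

lemma gideal_UNIV: "gideal UNIV"
  by (rule gidealI, rule submodI) auto

lemma gideal_homogeneous:
  assumes "gideal I" "I \<noteq> {0}"
  obtains i x where "x \<in> I" "x \<in> A i" "x \<noteq> 0"
proof -
  obtain x where x: "x \<in> I" "x \<noteq> 0"
    using assms submod_zero[OF gideal_submod[OF assms(1)]] by blast
  obtain x0 x1 where "x0 \<in> A0" "x1 \<in> A1" "x0 \<in> I" "x1 \<in> I" "x = x0 + x1"
    using submod_decomp[OF gideal_submod[OF assms(1)] x(1)] .
  then show ?thesis using that[of x0 False] that[of x1 True] x(2) by (cases "x0 = 0") auto
qed

section \<open>Primeness in terms of homogeneous elements\<close>

lemma prime_ideals:
  assumes "gideal I" "gideal J" "\<And>x y. x \<in> I \<Longrightarrow> y \<in> J \<Longrightarrow> x * y = 0"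
  shows "I = {0} \<or> J = {0}"
proof -
  have "{x * y | x y. x \<in> I \<and> y \<in> J} \<subseteq> {0}" using assms(3) by auto
  then have "span {x * y | x y. x \<in> I \<and> y \<in> J} \<subseteq> {0}"
    by (rule span_minimal[OF _ subspace_single_0])
  then have "ideal_product scale I J = {0}"
    using span_zero by (auto simp: ideal_product_def)
  then show ?thesis using prime assms(1,2) by (auto simp: prime_superalgebra_def)
qed

lemma gideal_left_annihilator:
  assumes J: "gideal J" shows "gideal {x. \<forall>y\<in>J. x * y = 0}"
proof (rule gidealI, rule submodI)
  fix x0 x1 assume x: "x0 \<in> A0" "x1 \<in> A1" "x0 + x1 \<in> {x. \<forall>y\<in>J. x * y = 0}"
  have "x0 * y = 0" if "y \<in> J" for y
    using gideal_submod[OF J] that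
  proof (rule submod_induct)
    fix i y assume y: "y \<in> J" "y \<in> A i"
    have "x0 * y + x1 * y = 0" using x(3) y(1) by (simp add: distrib_right)
    moreover have "x0 * y \<in> A i" "x1 * y \<in> A (\<not> i)"
      using A_mult[of x0 False y i] A_mult[of x1 True y i] x y by auto
    ultimately show "x0 * y = 0" using A_sum_zero by blast
  qed (simp add: distrib_left)
  then show "x0 \<in> {x. \<forall>y\<in>J. x * y = 0}" by simp
qed (auto simp: distrib_right scale_mult_left[symmetric] mult.assoc gideal_left[OF J])

text \<open>Both conditions are imposed because \<open>A\<close> may lack a unit. Gradedness comes
  from homogeneity of \<open>a\<close>: the products with the components of \<open>y\<close> fall
  into different degrees.\<close>

lemma gideal_right_annihilator:
  assumes a: "a \<in> A i" shows "gideal {y. a * y = 0 \<and> (\<forall>x. a * x * y = 0)}"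
proof (rule gidealI, rule submodI)
  fix x0 x1 assume x: "x0 \<in> A0" "x1 \<in> A1" "x0 + x1 \<in> {y. a * y = 0 \<and> (\<forall>x. a * x * y = 0)}"
  have *: "c * x0 = 0" if "c \<in> A j" "c * (x0 + x1) = 0" for c j
  proof -
    have "c * x0 \<in> A j" "c * x1 \<in> A (\<not> j)"
      using A_mult[of c j x0 False] A_mult[of c j x1 True] x that by auto
    then show ?thesis using A_sum_zero that(2) by (metis distrib_left)
  qed
  have "a * y * x0 = 0" for y
  proof (rule A_induct[of "\<lambda>y. a * y * x0 = 0"])
    fix j y assume "y \<in> A j"
    then show "a * y * x0 = 0" using *[OF A_mult[OF a]] x(3) by blast
  qed (simp add: distrib_right distrib_left)
  then show "x0 \<in> {y. a * y = 0 \<and> (\<forall>x. a * x * y = 0)}" using *[OF a] x(3) by blast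
next
  fix y c :: 'a assume "y \<in> {y. a * y = 0 \<and> (\<forall>x. a * x * y = 0)}"
  then have "a * y = 0" "a * x * y = 0" for x by auto
  moreover from this(2)[of c] this(2)[of "x * c" for x] this
  have "a * (c * y) = 0" "a * x * (c * y) = 0" "a * (y * c) = 0" "a * x * (y * c) = 0" for x
    by (simp_all only: mult.assoc[symmetric] mult_zero_left)
  ultimately show "c * y \<in> {y. a * y = 0 \<and> (\<forall>x. a * x * y = 0)}"
    "y * c \<in> {y. a * y = 0 \<and> (\<forall>x. a * x * y = 0)}" by simp_all
qed (auto simp: distrib_left scale_mult_right[symmetric])

text \<open>The elements annihilated by every left multiplication form an ideal of square zero,
  which primeness makes trivial.\<close>

lemma right_zero: 
  assumes "b \<in> A j" "\<And>x. x * b = 0" shows "b = 0"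
proof -
  have "gideal {y::'a. \<forall>x. x * y = 0}"
  proof (rule gidealI, rule submodI)
    fix x0 x1 assume x: "x0 \<in> A0" "x1 \<in> A1" "x0 + x1 \<in> {y::'a. \<forall>x. x * y = 0}"
    have "y * x0 = 0" for y
    proof (rule A_induct[of "\<lambda>y. y * x0 = 0"])
      fix i y assume y: "y \<in> A i"
      have "y * x0 + y * x1 = 0" using x(3) by (simp add: distrib_left[symmetric])
      moreover have "y * x0 \<in> A i" "y * x1 \<in> A (\<not> i)"
        using A_mult[of y i x0 False] A_mult[of y i x1 True] x y by auto
      ultimately show "y * x0 = 0" using A_sum_zero by blast
    qed (simp add: distrib_right)
    then show "x0 \<in> {y::'a. \<forall>x. x * y = 0}" by simp
  next
    fix y c :: 'a assume "y \<in> {y::'a. \<forall>x. x * y = 0}"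
    then have y: "x * y = 0" for x by blast
    have "x * (c * y) = 0" "x * (y * c) = 0" for x
      using y[of "x * c"] y[of x] by (simp_all only: mult.assoc[symmetric] mult_zero_left)
    then show "c * y \<in> {y::'a. \<forall>x. x * y = 0}" "y * c \<in> {y::'a. \<forall>x. x * y = 0}" by auto
  qed (auto simp: distrib_left scale_mult_right[symmetric])
  then have "{y::'a. \<forall>x. x * y = 0} = {0}" using prime_ideals[of "{y::'a. \<forall>x. x * y = 0}" "{y::'a. \<forall>x. x * y = 0}"] by blast
  then show ?thesis using assms(2) by blast
qed

text \<open>A nonzero \<open>x * b\<close> lies in the ideal annihilated on the left by
  \<open>a\<close> and by \<open>a A\<close>, while \<open>a\<close> lies in the left annihilator of
  that ideal; primeness for ideals then gives \<open>a = 0\<close>.\<close>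

lemma prime_mult:
  assumes a: "a \<in> A i" and b: "b \<in> A j" and 0: "\<And>x. a * x * b = 0"
  shows "a = 0 \<or> b = 0"
proof (rule disjCI)
  assume "b \<noteq> 0"
  then obtain x where x: "x * b \<noteq> 0" using right_zero[OF b] by blast
  let ?J = "{y. a * y = 0 \<and> (\<forall>x. a * x * y = 0)}"
  have J: "gideal ?J" by (rule gideal_right_annihilator[OF a])
  have "a * (x * b) = 0" "a * y * (x * b) = 0" for y
    using 0[of x] 0[of "y * x"] by (simp_all add: mult.assoc)
  then have "x * b \<in> ?J" by simp
  then have "?J \<noteq> {0}" using x by blast
  moreover have "a \<in> {x. \<forall>y\<in>?J. x * y = 0}" by auto
  ultimately show "a = 0"
    using prime_ideals[OF gideal_left_annihilator[OF J] J] by blast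
qed

text \<open>Elements \<open>x * y\<close> with \<open>x\<close> in \<open>M\<close> are allowed in
  the middle, so \<open>a x A b = 0\<close> first yields \<open>a M = 0\<close>; then
  \<open>a A m = 0\<close> for a nonzero homogeneous \<open>m\<close> in \<open>M\<close> yields
  \<open>a = 0\<close>.\<close>

lemma prime_mult_ideal:
  assumes M: "gideal M" "M \<noteq> {0}" and a: "a \<in> A i" and b: "b \<in> A j"
    and 0: "\<And>k m. m \<in> M \<Longrightarrow> m \<in> A k \<Longrightarrow> a * m * b = 0"
  shows "a = 0 \<or> b = 0"
proof (rule disjCI)
  assume b0: "b \<noteq> 0"
  obtain k m where m: "m \<in> M" "m \<in> A k" "m \<noteq> 0" using gideal_homogeneous[OF M] .
  have 1: "a * x = 0" if "x \<in> M" for x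
  proof -
    show ?thesis
      using gideal_submod[OF M(1)] that
    proof (rule submod_induct[where P = "\<lambda>x. a * x = 0"])
      fix l x assume x: "x \<in> M" "x \<in> A l"
      have "a * x * y * b = 0" for y
      proof -
        have "x * y \<in> M" using gideal_right[OF M(1) x(1)] .
        from gideal_submod[OF M(1)] this have "a * (x * y) * b = 0"
          by (rule submod_induct) (auto simp: 0 distrib_left distrib_right)
        then show ?thesis by (simp add: mult.assoc)
      qed
      then show "a * x = 0" using prime_mult[OF A_mult[OF a x(2)] b] b0 by blast
    qed (simp add: distrib_left)
  qed
  have "a * y * m = 0" for y using 1[OF gideal_left[OF M(1) m(1)]] by (simp add: mult.assoc)
  then show "a = 0" using prime_mult[OF a m(2)] m(3) by blast
qed

text \<open>The largest two-sided ideal contained in \<open>T\<close>, when \<open>T\<close> is a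
  submodule; the four conditions take the place of a single one that would need a unit.\<close>

definition core :: "'a set \<Rightarrow> 'a set" where
  "core T = {x \<in> T. (\<forall>a. a * x \<in> T) \<and> (\<forall>a. x * a \<in> T) \<and> (\<forall>a b. a * x * b \<in> T)}"

lemma core_subset: "core T \<subseteq> T"
  by (auto simp: core_def)

lemma core_gideal:
  assumes T: "submod T" shows "gideal (core T)"
proof (rule gidealI, rule submodI)
  fix x0 x1 assume x: "x0 \<in> A0" "x1 \<in> A1" "x0 + x1 \<in> core T"
  have "x0 \<in> T" using submod_components[OF T, of x0 False x1] x by (simp add: core_def)
  moreover have "a * x0 \<in> T" for a
  proof (rule A_induct[of "\<lambda>a. a * x0 \<in> T"])
    fix i a assume a: "a \<in> A i"
    have "a * x0 + a * x1 \<in> T" using x(3) by (simp add: core_def distrib_left[symmetric])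
    moreover have "a * x0 \<in> A i" "a * x1 \<in> A (\<not> i)"
      using A_mult[of a i x0 False] A_mult[of a i x1 True] x a by auto
    ultimately show "a * x0 \<in> T" using submod_components[OF T] by blast
  qed (simp add: distrib_right submod_add[OF T])
  moreover have "x0 * a \<in> T" for a
  proof (rule A_induct[of "\<lambda>a. x0 * a \<in> T"])
    fix i a assume a: "a \<in> A i"
    have "x0 * a + x1 * a \<in> T" using x(3) by (simp add: core_def distrib_right[symmetric])
    moreover have "x0 * a \<in> A i" "x1 * a \<in> A (\<not> i)"
      using A_mult[of x0 False a i] A_mult[of x1 True a i] x a by auto
    ultimately show "x0 * a \<in> T" using submod_components[OF T] by blast
  qed (simp add: distrib_left submod_add[OF T])
  moreover have "a * x0 * b \<in> T" for a b
  proof (rule A_induct[of "\<lambda>a. a * x0 * b \<in> T"])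
    fix i a assume a: "a \<in> A i"
    show "a * x0 * b \<in> T"
    proof (rule A_induct[of "\<lambda>b. a * x0 * b \<in> T"])
      fix j b assume b: "b \<in> A j"
      have "a * x0 * b + a * x1 * b \<in> T"
        using x(3) by (simp add: core_def distrib_left[symmetric] distrib_right[symmetric])
      moreover have "a * x0 * b \<in> A (i \<noteq> j)" "a * x1 * b \<in> A (\<not> (i \<noteq> j))"
        using A_mult[OF A_mult[of a i x0 False] b] A_mult[OF A_mult[of a i x1 True] b] x a by auto
      ultimately show "a * x0 * b \<in> T" using submod_components[OF T] by blast
    qed (simp add: distrib_left submod_add[OF T])
  qed (simp add: distrib_right submod_add[OF T])
  ultimately show "x0 \<in> core T" by (simp add: core_def)
next
  fix x c assume x: "x \<in> core T"
  have "a * (c * x) = (a * c) * x" "a * (c * x) * b = (a * c) * x * b"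
    "x * c * a = x * (c * a)" "a * (x * c) = a * x * c" "a * (x * c) * b = a * x * (c * b)" for a b
    by (simp_all add: mult.assoc)
  then show "c * x \<in> core T" "x * c \<in> core T"
    using x unfolding core_def by auto
next
  fix x y assume xy: "x \<in> core T" "y \<in> core T"
  then show "x + y \<in> core T"
    by (simp add: core_def distrib_left distrib_right submod_add[OF T])
next
  fix r x assume x: "x \<in> core T"
  have "a * scale r x = scale r (a * x)" "scale r x * a = scale r (x * a)"
    "a * scale r x * b = scale r (a * x * b)" for a b
    by (simp_all only: scale_mult_left[symmetric] scale_mult_right[symmetric])
  then show "scale r x \<in> core T"
    using x by (simp add: core_def submod_scale[OF T])
qed (simp add: core_def submod_zero[OF T])

text \<open>All products \<open>a * c * b\<close> lie in the core. If they were all zero, primeness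
  would give \<open>a * c = 0\<close> for every \<open>a\<close>, against
  \<open>right_zero\<close>.\<close>

lemma core_nonzero:
  assumes c: "c \<in> A i" "c \<noteq> 0" and T: "\<And>a b. a * c * b \<in> T"
  shows "core T \<noteq> {0}"
proof -
  have "\<exists>a b. a * c * b \<noteq> 0"
  proof (rule ccontr)
    assume *: "\<not> ?thesis"
    have "a * c = 0" if "a \<in> A j" for a j
      using prime_mult[OF A_mult[OF that c(1)] c(1)] * c(2) by (metis mult.assoc)
    then have "a * c = 0" for a
      by (rule A_induct[of "\<lambda>a. a * c = 0"]) (auto simp: distrib_right)
    then show False using right_zero[OF c(1)] c(2) by blast
  qed
  then obtain a b where ab: "a * c * b \<noteq> 0" by blast
  have "a * c * b \<in> core T"
  proof -
    have "x * (a * c * b) \<in> T" "a * c * b * x \<in> T" "x * (a * c * b) * y \<in> T" for x y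
      using T[of "x * a" b] T[of a "b * x"] T[of "x * a" "b * y"] by (simp_all add: mult.assoc)
    then show ?thesis using T by (simp add: core_def)
  qed
  then show ?thesis using ab by blast
qed

section \<open>Inner derivations by even elements\<close>

definition ad :: "'a \<Rightarrow> 'a \<Rightarrow> 'a" where
  "ad v x = v * x - x * v"

lemma ad_add: "ad v (x + y) = ad v x + ad v y"
  and ad_diff: "ad v (x - y) = ad v x - ad v y"
  and ad_minus: "ad v (- x) = - ad v x"
  and ad_zero [simp]: "ad v 0 = 0"
  and ad_mult: "ad v (x * y) = ad v x * y + x * ad v y"
  and ad_self_mult: "ad v (v * x) = v * ad v x"
  by (simp_all add: ad_def algebra_simps)

lemma ad_A: "v \<in> A0 \<Longrightarrow> x \<in> A i \<Longrightarrow> ad v x \<in> A i"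
  using A_mult[of v False x i] A_mult[of x i v False] A_diff by (auto simp: ad_def)

lemma centerI: "v \<in> A0 \<Longrightarrow> (\<And>i x. x \<in> A i \<Longrightarrow> ad v x = 0) \<Longrightarrow> v \<in> Z"
proof -
  assume v: "v \<in> A0" and *: "\<And>i x. x \<in> A i \<Longrightarrow> ad v x = 0"
  have "ad v x = 0" for x by (rule A_induct[of "\<lambda>x. ad v x = 0"]) (auto simp: * ad_add)
  then show "v \<in> Z" using v by (simp add: even_center_def ad_def)
qed

text \<open>Replacing \<open>m\<close> by \<open>v * m\<close> isolates the product
  \<open>ad v a * m\<close>, so that information about brackets becomes information about ordinary
  products.\<close>

lemma br_mult_left:
  "br i j (v * m) a = v * br i j m a + (if i \<and> j then - (ad v a * m) else ad v a * m)"
  by (simp add: br_def ad_def algebra_simps)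

lemma ad_ad_mult: "ad v (ad v (x * y)) = ad v (ad v x) * y + (ad v x * ad v y + ad v x * ad v y) + x * ad v (ad v y)"
  by (simp add: ad_mult ad_add algebra_simps)

text \<open>The vanishing spreads from brackets to the products \<open>a * (ad v b * m)\<close>. The
  Leibniz rule, with \<open>2\<close> cancelled, then turns it into a product of three values of
  \<open>ad v\<close>, to which primeness applies.\<close>

lemma ad_square_zero:
  assumes v: "v \<in> A0" and M: "gideal M" "M \<noteq> {0}"
    and sq: "\<And>i j m a. m \<in> M \<Longrightarrow> m \<in> A i \<Longrightarrow> a \<in> A j \<Longrightarrow> ad v (ad v (br i j m a)) = 0"
  shows "v \<in> Z"
proof -
  let ?d = "ad v"
  have 1: "?d (?d (?d a * m)) = 0" if m: "m \<in> M" for a m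
  proof (rule A_induct[of "\<lambda>a. ?d (?d (?d a * m)) = 0"])
    fix j a assume a: "a \<in> A j"
    show "?d (?d (?d a * m)) = 0"
      using gideal_submod[OF M(1)] m
    proof (rule submod_induct)
      fix i m assume m: "m \<in> M" "m \<in> A i"
      have vm: "v * m \<in> M" "v * m \<in> A i"
        using gideal_left[OF M(1) m(1)] A_mult[of v False m i] v m(2) by auto
      show "?d (?d (?d a * m)) = 0"
        using sq[OF vm a] sq[OF m a]
        by (auto simp: br_mult_left ad_add ad_minus ad_self_mult split: if_splits)
    qed (simp add: distrib_left ad_add)
  qed (simp add: distrib_right ad_add)
  have 2: "?d (?d (a * (?d b * m))) = 0" if m: "m \<in> M" for a b m
  proof -
    have "a * (?d b * m) = ?d (a * b) * m - ?d a * (b * m)"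
      by (simp add: ad_mult algebra_simps)
    then show ?thesis
      using 1[OF m, of "a * b"] 1[OF gideal_left[OF M(1) m], of a b] by (simp add: ad_diff)
  qed
  have 3: "?d (?d a) * (?d b * m) + (?d a * ?d (?d b * m) + ?d a * ?d (?d b * m)) = 0"
    if m: "m \<in> M" for a b m
    using 2[OF m, of a b] 1[OF m, of b] by (simp add: ad_ad_mult[of v a])
  have 4: "?d a * ?d b * m * ?d c = 0" if m: "m \<in> M" for a b c m
  proof -
    define u where "u = ?d b * m"
    have 5: "?d (?d a) * (u * c) + (?d a * ?d (u * c) + ?d a * ?d (u * c)) = 0"
      using 3[OF gideal_right[OF M(1) m, of c], of a b] by (simp only: u_def mult.assoc)
    \<comment> \<open>The relation for \<open>u\<close> times \<open>c\<close> is subtracted from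
      the relation for \<open>u * c\<close>; only the term in which the derivation falls on
      \<open>c\<close> survives.\<close>
    have "(?d (?d a) * (u * c) + (?d a * ?d (u * c) + ?d a * ?d (u * c))) -
        (?d (?d a) * u + (?d a * ?d u + ?d a * ?d u)) * c = ?d a * u * ?d c + ?d a * u * ?d c"
      by (simp add: ad_mult[of v u c] distrib_left distrib_right mult.assoc)
    then have "?d a * u * ?d c + ?d a * u * ?d c = 0"
      unfolding 3[OF m, of a b, folded u_def] 5 by simp
    from double_eq_zero[OF this] show ?thesis by (simp only: u_def mult.assoc)
  qed
  show "v \<in> Z"
  proof (rule ccontr)
    assume "v \<notin> Z"
    then obtain k c where c: "c \<in> A k" "?d c \<noteq> 0" using centerI[OF v] by blast
    have 5: "?d a * ?d b = 0" if "a \<in> A i" "b \<in> A j" for a b i j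
      using prime_mult_ideal[OF M A_mult[OF ad_A[OF v that(1)] ad_A[OF v that(2)]] ad_A[OF v c(1)]]
        4 c(2) by blast
    \<comment> \<open>Since products of two values of \<open>ad v\<close> vanish, the Leibniz rule
      for \<open>x * c\<close> leaves only this term of
      \<open>ad v c * ad v (x * c)\<close>.\<close>
    have "?d c * x * ?d c = 0" for x
    proof (rule A_induct[of "\<lambda>x. ?d c * x * ?d c = 0"])
      fix i x assume x: "x \<in> A i"
      have "?d c * ?d (x * c) = 0" by (rule 5[OF c(1) A_mult[OF x c(1)]])
      then show "?d c * x * ?d c = 0"
        using 5[OF c(1) x] by (simp add: ad_mult distrib_left flip: mult.assoc)
    qed (simp add: distrib_right distrib_left)
    then show False using prime_mult[OF ad_A[OF v c(1)] ad_A[OF v c(1)]] c(2) by blast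
  qed
qed

section \<open>The even center\<close>

lemma Z_A0: "z \<in> Z \<Longrightarrow> z \<in> A0"
  by (simp add: even_center_def)

lemma Z_comm: "z \<in> Z \<Longrightarrow> a * z = z * a"
  by (simp add: even_center_def)

lemma ad_Z: "z \<in> Z \<Longrightarrow> ad v z = 0"
  using Z_comm[of z v] by (simp add: ad_def)

lemma Z_I: "z \<in> A0 \<Longrightarrow> (\<And>a. z * a = a * z) \<Longrightarrow> z \<in> Z"
  by (simp add: even_center_def)

lemma Z_zero: "0 \<in> Z"
  using A_zero[of False] by (intro Z_I) auto

lemma Z_add: "z \<in> Z \<Longrightarrow> w \<in> Z \<Longrightarrow> z + w \<in> Z"
proof (rule Z_I)
  fix a assume z: "z \<in> Z" and w: "w \<in> Z"
  show "z + w \<in> A0" using A_add[of z False w] Z_A0 z w by simp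
  show "(z + w) * a = a * (z + w)"
    using Z_comm[OF z, of a] Z_comm[OF w, of a] by (simp only: distrib_left distrib_right)
qed

lemma Z_minus: "z \<in> Z \<Longrightarrow> - z \<in> Z"
proof (rule Z_I)
  fix a assume z: "z \<in> Z"
  show "- z \<in> A0" using A_minus[of z False] Z_A0[OF z] by simp
  show "- z * a = a * - z" using Z_comm[OF z, of a] by simp
qed

lemma Z_mult: "z \<in> Z \<Longrightarrow> w \<in> Z \<Longrightarrow> z * w \<in> Z"
proof -
  assume z: "z \<in> Z" and w: "w \<in> Z"
  have "z * w * a = a * (z * w)" for a
  proof -
    have "a * (z * w) = (a * z) * w" by (simp only: mult.assoc)
    also have "\<dots> = z * (a * w)" unfolding Z_comm[OF z, of a] by (simp only: mult.assoc)
    also have "\<dots> = z * w * a" unfolding Z_comm[OF w, of a] by (simp only: mult.assoc)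
    finally show ?thesis ..
  qed
  then show ?thesis using A_mult[of z False w False] z w by (intro Z_I) (auto simp: Z_A0)
qed

lemma Z_regular:
  assumes z: "z \<in> Z" "z \<noteq> 0" and zx: "z * x = 0" shows "x = 0"
proof -
  have hom: "y = 0" if y: "y \<in> A i" "z * y = 0" for y i
  proof -
    have "z * a * y = 0" for a
      unfolding Z_comm[OF z(1), of a, symmetric] using y(2) by (simp add: mult.assoc)
    then show ?thesis using prime_mult[of z False y i] y z Z_A0 by auto
  qed
  obtain x0 x1 where x: "x0 \<in> A0" "x1 \<in> A1" "x = x0 + x1" by (rule A_decomp)
  have s: "z * x0 + z * x1 = 0" using zx x(3) by (simp add: distrib_left)
  have "z * x0 \<in> A False" "z * x1 \<in> A (\<not> False)"
    using A_mult[of z False x0 False] A_mult[of z False x1 True] x z Z_A0 by auto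
  then have "z * x0 = 0" "z * x1 = 0" using A_sum_zero[OF _ _ s] by blast+
  then show ?thesis using hom[of x0 False] hom[of x1 True] x by simp
qed

lemma Z_cancel:
  assumes z: "z \<in> Z" "z \<noteq> 0" and zx: "z * x = z * y" shows "x = y"
  using Z_regular[OF z, of "x - y"] zx by (simp add: right_diff_distrib)

lemma Z_divide:
  assumes z: "z \<in> Z" "z \<noteq> 0" and x: "x \<in> A0" "z * x \<in> Z" shows "x \<in> Z"
proof (rule Z_I[OF x(1)])
  fix a
  have "z * (x * a) = z * x * a" by (simp only: mult.assoc)
  also have "\<dots> = a * (z * x)" by (rule Z_comm[OF x(2), symmetric])
  also have "\<dots> = z * (a * x)" using Z_comm[OF z(1), of a] by (simp only: mult.assoc[symmetric])
  finally show "x * a = a * x" by (rule Z_cancel[OF z])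
qed

lemma Z_half: "x + x \<in> Z \<Longrightarrow> x \<in> Z"
proof (rule Z_I)
  assume *: "x + x \<in> Z"
  show "x \<in> A0" using subspace_half[OF subspace_A0] Z_A0[OF *] .
  fix a
  have "(x * a - a * x) + (x * a - a * x) = 0"
    using Z_comm[OF *, of a] by (simp add: algebra_simps)
  from double_eq_zero[OF this] show "x * a = a * x" by simp
qed

section \<open>The superbracket on homogeneous elements\<close>

lemma even_component: "x0 \<in> A0 \<Longrightarrow> x1 \<in> A1 \<Longrightarrow> even_component A0 A1 (x0 + x1) = x0"
  unfolding even_component_def
proof (rule the_equality)
  fix y assume x: "x0 \<in> A0" "x1 \<in> A1" and y: "y \<in> A0 \<and> x0 + x1 - y \<in> A1"
  have "y - x0 = x1 - (x0 + x1 - y)" by simp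
  then have "y - x0 \<in> A False" "y - x0 \<in> A (\<not> False)"
    using A_diff[of y False x0] A_diff[of x1 True "x0 + x1 - y"] x y by auto
  from A_inter[OF this] show "y = x0" by simp
qed simp

lemma odd_component: "x0 \<in> A0 \<Longrightarrow> x1 \<in> A1 \<Longrightarrow> odd_component A0 A1 (x0 + x1) = x1"
  by (simp add: odd_component_def even_component)

lemma superbracket_sum:
  assumes "x0 \<in> A0" "x1 \<in> A1" "y0 \<in> A0" "y1 \<in> A1"
  shows "superbracket A0 A1 (x0 + x1) (y0 + y1) =
    br False False x0 y0 + br False True x0 y1 + br True False x1 y0 + br True True x1 y1"
  using assms by (simp add: superbracket_def even_component odd_component br_def)

lemma superbracket_br:
  assumes "x \<in> A i" "y \<in> A j" shows "superbracket A0 A1 x y = br i j x y"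
  using assms superbracket_sum[of x 0 y 0] superbracket_sum[of x 0 0 y] superbracket_sum[of 0 x y 0]
    superbracket_sum[of 0 x 0 y] A_zero[of False] A_zero[of True]
  by (cases i; cases j) (simp_all add: br_def)

lemma br_mem_bracket_span:
  assumes "x \<in> M" "y \<in> N" "x \<in> A i" "y \<in> A j"
  shows "br i j x y \<in> bracket_span scale A0 A1 M N"
  unfolding bracket_span_def superbracket_br[OF assms(3,4), symmetric]
  by (rule span_base) (use assms(1,2) in blast)

lemma bracket_span_subset:
  assumes M: "submod M" and N: "submod N" and V: "submod V"
    and br: "\<And>i j x y. x \<in> M \<Longrightarrow> x \<in> A i \<Longrightarrow> y \<in> N \<Longrightarrow> y \<in> A j \<Longrightarrow> br i j x y \<in> V"
  shows "bracket_span scale A0 A1 M N \<subseteq> V"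
  unfolding bracket_span_def
proof (rule span_minimal[OF _ submod_subspace[OF V]], clarify)
  fix x y assume x: "x \<in> M" and y: "y \<in> N"
  obtain x0 x1 where xs: "x0 \<in> A0" "x1 \<in> A1" "x0 \<in> M" "x1 \<in> M" "x = x0 + x1"
    using submod_decomp[OF M x] .
  obtain y0 y1 where ys: "y0 \<in> A0" "y1 \<in> A1" "y0 \<in> N" "y1 \<in> N" "y = y0 + y1"
    using submod_decomp[OF N y] .
  show "superbracket A0 A1 x y \<in> V"
    unfolding xs(5) ys(5) superbracket_sum[OF xs(1,2) ys(1,2)]
    by (intro submod_add[OF V] br) (use xs ys in simp_all)
qed

lemma br_A: "x \<in> A i \<Longrightarrow> y \<in> A j \<Longrightarrow> br i j x y \<in> A (i \<noteq> j)"
  using A_mult[of x i y j] A_mult[of y j x i] by (cases i; cases j) (auto simp: br_def intro: A_add[of _ False, simplified] A_diff[of _ False, simplified] A_diff[of _ True, simplified])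

lemma br_gideal: "gideal M \<Longrightarrow> x \<in> M \<Longrightarrow> br i j x y \<in> M"
  by (simp add: br_def submod_add[OF gideal_submod] submod_diff[OF gideal_submod] gideal_left gideal_right)

lemma br_swap: "br i j x y = (if i \<and> j then br j i y x else - br j i y x)"
  by (simp add: br_def add.commute)

lemma br_False: "br False j v x = ad v x"
  by (simp add: br_def ad_def)

lemma br_minus_right: "br i j x (- y) = - br i j x y"
  by (simp add: br_def)

lemma br_add_left: "br i j (x + y) z = br i j x z + br i j y z"
  by (simp add: br_def algebra_simps)

lemma br_scale_left: "br i j (scale r x) z = scale r (br i j x z)"
  by (simp add: br_def scale_mult_left[symmetric] scale_mult_right[symmetric] scale_right_distrib scale_right_diff_distrib)

lemma ad_br: "ad v (br i j x y) = br i j (ad v x) y + br i j x (ad v y)"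
  by (simp add: br_def ad_def algebra_simps)

text \<open>The super Jacobi identity, solved for \<open>[[t, n], m]\<close>; it yields stability
  under \<open>[M, A]\<close> of the transporter and of \<open>W M\<close>.\<close>

lemma br_jacobi:
  "br (i \<noteq> l) j (br i l t n) m = br i (l \<noteq> j) t (br l j n m)
     - (if i \<and> l then - br l (i \<noteq> j) n (br i j t m) else br l (i \<noteq> j) n (br i j t m))"
  by (cases i; cases l; cases j) (simp_all add: br_def algebra_simps)

lemma br_mult_cyclic:
  "br (i \<noteq> j) k (x * y) a = br i (j \<noteq> k) x (y * a)
     + (if i \<and> (j \<noteq> k) then - br j (k \<noteq> i) y (a * x) else br j (k \<noteq> i) y (a * x))"
  by (cases i; cases j; cases k) (simp_all add: br_def algebra_simps)

text \<open>Writes a right multiple of \<open>[x, y]\<close> through brackets with \<open>x\<close>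
  alone. This is how a nonzero bracket produces an ideal.\<close>

lemma br_mult_right:
  "br i j x y * a = br i (j \<noteq> k) x (y * a) - (if i \<and> j then - (y * br i k x a) else y * br i k x a)"
  by (cases i; cases j; cases k) (simp_all add: br_def algebra_simps)

lemma br_mult_left_derivation:
  "br (i \<noteq> j) k (m * a) b = m * br j k a b + (if j \<and> k then - (br i k m b * a) else br i k m b * a)"
  by (cases i; cases j; cases k) (simp_all add: br_def algebra_simps)

section \<open>Graded sums and transporters\<close>

definition graded_sum :: "(bool \<Rightarrow> 'a set) \<Rightarrow> 'a set" where
  "graded_sum T = {x0 + x1 | x0 x1. x0 \<in> T False \<and> x1 \<in> T True}"

lemma graded_sum_homogeneous:
  assumes T: "\<And>i. T i \<subseteq> A i" "\<And>i. 0 \<in> T i" and x: "x \<in> A i"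
  shows "x \<in> graded_sum T \<longleftrightarrow> x \<in> T i"
proof
  assume "x \<in> graded_sum T"
  then obtain x0 x1 where s: "x0 \<in> T False" "x1 \<in> T True" "x = x0 + x1" by (auto simp: graded_sum_def)
  have A: "x0 \<in> A False" "x1 \<in> A True"
    by (rule subsetD[OF T(1) s(1)], rule subsetD[OF T(1) s(2)])
  show "x \<in> T i"
  proof (cases i)
    case True
    have "x0 = x - x1" using s by simp
    then have "x0 \<in> A True" using A_diff[of x True x1] x A True by simp
    then have "x0 = 0" using A_inter[of x0 False] A by simp
    then show ?thesis using s True by simp
  next
    case False
    have "x1 = x - x0" using s by simp
    then have "x1 \<in> A False" using A_diff[of x False x0] x A False by simp
    then have "x1 = 0" using A_inter[of x1 False] A by simp
    then show ?thesis using s False by simp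
  qed
next
  assume x: "x \<in> T i"
  show "x \<in> graded_sum T"
    using x T(2)[of True] T(2)[of False] unfolding graded_sum_def by (cases i) force+
qed

lemma graded_sum_submod:
  assumes T: "\<And>i. T i \<subseteq> A i" "\<And>i. subspace (T i)"
  shows "submod (graded_sum T)"
proof (rule submodI)
  have 0: "0 \<in> T i" for i using subspace_0[OF T(2)] .
  show "0 \<in> graded_sum T" using graded_sum_homogeneous[OF T(1) 0 A_zero] 0 by blast
  show "x + y \<in> graded_sum T" if xy: "x \<in> graded_sum T" "y \<in> graded_sum T" for x y
  proof -
    obtain x0 x1 where x: "x0 \<in> T False" "x1 \<in> T True" "x = x0 + x1" using xy(1) by (auto simp: graded_sum_def)
    obtain y0 y1 where y: "y0 \<in> T False" "y1 \<in> T True" "y = y0 + y1" using xy(2) by (auto simp: graded_sum_def)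
    have "x + y = (x0 + y0) + (x1 + y1)" using x y by (simp add: algebra_simps)
    then show ?thesis using x y subspace_add[OF T(2)] unfolding graded_sum_def by blast
  qed
  show "scale r x \<in> graded_sum T" if x: "x \<in> graded_sum T" for r x
  proof -
    obtain x0 x1 where x: "x0 \<in> T False" "x1 \<in> T True" "x = x0 + x1" using x by (auto simp: graded_sum_def)
    have "scale r x = scale r x0 + scale r x1" using x by (simp add: scale_right_distrib)
    then show ?thesis using x subspace_scale[OF T(2)] unfolding graded_sum_def by blast
  qed
  show "x \<in> graded_sum T" if xy: "x \<in> A0" "y \<in> A1" "x + y \<in> graded_sum T" for x y
  proof -
    obtain x0 x1 where x: "x0 \<in> T False" "x1 \<in> T True" "x + y = x0 + x1" using xy(3) by (auto simp: graded_sum_def)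
    have "(x - x0) + (y - x1) = 0" using x(3) by (simp add: algebra_simps)
    moreover have "x - x0 \<in> A False" "y - x1 \<in> A (\<not> False)"
      using A_diff[OF _ subsetD[OF T(1) x(1)], of x] A_diff[OF _ subsetD[OF T(1) x(2)], of y] xy by simp_all
    ultimately have "x - x0 = 0" using A_sum_zero(1) by blast
    then have "x \<in> T False" using x(1) by simp
    then show ?thesis using graded_sum_homogeneous[OF T(1) 0, of x False] xy(1) by simp
  qed
qed

text \<open>The set of \<open>x\<close> with \<open>[x, M]\<close> inside \<open>V\<close>. The
  condition is imposed on the homogeneous components so that the result is graded by
  construction.\<close>

definition transporter :: "'a set \<Rightarrow> 'a set \<Rightarrow> 'a set" where
  "transporter M V = graded_sum (\<lambda>i. {x \<in> A i. \<forall>j. \<forall>m\<in>M \<inter> A j. br i j x m \<in> V})"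

lemma transporter_homogeneous:
  assumes V: "submod V" and x: "x \<in> A i"
  shows "x \<in> transporter M V \<longleftrightarrow> (\<forall>j m. m \<in> M \<longrightarrow> m \<in> A j \<longrightarrow> br i j x m \<in> V)"
proof -
  let ?T = "\<lambda>i. {x \<in> A i. \<forall>j. \<forall>m\<in>M \<inter> A j. br i j x m \<in> V}"
  have "x \<in> graded_sum ?T \<longleftrightarrow> x \<in> ?T i"
    by (rule graded_sum_homogeneous[OF _ _ x]) (auto simp: br_def submod_zero[OF V])
  then show ?thesis using x unfolding transporter_def by blast
qed

lemma transporterD:
  "submod V \<Longrightarrow> x \<in> transporter M V \<Longrightarrow> x \<in> A i \<Longrightarrow> m \<in> M \<Longrightarrow> m \<in> A j \<Longrightarrow> br i j x m \<in> V"
  using transporter_homogeneous by blast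

lemma transporterI:
  "submod V \<Longrightarrow> x \<in> A i \<Longrightarrow> (\<And>j m. m \<in> M \<Longrightarrow> m \<in> A j \<Longrightarrow> br i j x m \<in> V) \<Longrightarrow> x \<in> transporter M V"
  using transporter_homogeneous by blast

lemma transporter_submod:
  assumes V: "submod V" shows "submod (transporter M V)"
  unfolding transporter_def
proof (rule graded_sum_submod)
  fix i
  show "subspace {x \<in> A i. \<forall>j. \<forall>m\<in>M \<inter> A j. br i j x m \<in> V}"
    by (rule subspaceI)
      (auto simp: br_add_left br_scale_left A_add subspace_scale[OF subspace_A] submod_add[OF V] submod_scale[OF V],
       simp add: br_def submod_zero[OF V])
qed auto

lemma transporter_mult:
  assumes V: "submod V" and M: "gideal M"
    and x: "x \<in> transporter M V" "x \<in> A i" and y: "y \<in> transporter M V" "y \<in> A j"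
  shows "x * y \<in> transporter M V"
proof (rule transporterI[OF V A_mult[OF x(2) y(2)]])
  fix k m assume m: "m \<in> M" "m \<in> A k"
  have "br i (j \<noteq> k) x (y * m) \<in> V"
    by (rule transporterD[OF V x gideal_left[OF M m(1)] A_mult[OF y(2) m(2)]])
  moreover have "br j (k \<noteq> i) y (m * x) \<in> V"
    by (rule transporterD[OF V y gideal_right[OF M m(1)] A_mult[OF m(2) x(2)]])
  ultimately show "br (i \<noteq> j) k (x * y) m \<in> V"
    unfolding br_mult_cyclic[of i j k x y m] by (auto intro: submod_add[OF V] submod_diff[OF V])
qed

lemma submod_mult_closed:
  assumes T: "submod T"
    and mult: "\<And>i j x y. x \<in> T \<Longrightarrow> x \<in> A i \<Longrightarrow> y \<in> T \<Longrightarrow> y \<in> A j \<Longrightarrow> x * y \<in> T"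
    and x: "x \<in> T" and y: "y \<in> T"
  shows "x * y \<in> T"
  using T x
proof (rule submod_induct)
  fix i x assume x: "x \<in> T" "x \<in> A i"
  show "x * y \<in> T"
    using T y by (rule submod_induct) (use mult x in \<open>auto simp: distrib_left submod_add[OF T]\<close>)
qed (simp add: distrib_right submod_add[OF T])

lemma two_sided_induct:
  assumes T: "submod T" and hom: "\<And>i j a b. a \<in> A i \<Longrightarrow> b \<in> A j \<Longrightarrow> a * c * b \<in> T"
  shows "a * c * b \<in> T"
proof (rule A_induct[of "\<lambda>a. a * c * b \<in> T"])
  fix i a assume a: "a \<in> A i"
  show "a * c * b \<in> T"
    by (rule A_induct[of "\<lambda>b. a * c * b \<in> T"]) (auto simp: hom[OF a] distrib_left submod_add[OF T])
qed (simp add: distrib_right submod_add[OF T])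

lemma ideal_mult_nonzero:
  assumes M: "gideal M" "M \<noteq> {0}" and c: "c \<in> A i" "c \<noteq> 0"
  obtains k m where "m \<in> M" "m \<in> A k" "c * m \<noteq> 0"
proof -
  obtain l m' where m': "m' \<in> M" "m' \<in> A l" "m' \<noteq> 0" using gideal_homogeneous[OF M] .
  have "\<exists>k m. m \<in> M \<and> m \<in> A k \<and> c * m \<noteq> 0"
  proof (rule ccontr)
    assume "\<not> ?thesis"
    then have "c * m * m' = 0" if "m \<in> M" "m \<in> A k" for k m using that by auto
    then show False using prime_mult_ideal[OF M c(1) m'(2)] c m' by blast
  qed
  then show ?thesis using that by blast
qed

text \<open>If all brackets of \<open>M\<close> with \<open>A\<close> vanish, then
  \<open>M [A, A] = 0\<close> and primeness makes \<open>A\<close> supercommutative. An odd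
  \<open>x\<close> then has \<open>x * x = 0\<close> and \<open>x A x = 0\<close>, hence is zero,
  against nontriviality.\<close>

lemma noncommutative:
  assumes M: "gideal M" "M \<noteq> {0}"
  obtains i j m a where "m \<in> M" "m \<in> A i" "a \<in> A j" "br i j m a \<noteq> 0"
proof -
  have "\<exists>i j m a. m \<in> M \<and> m \<in> A i \<and> a \<in> A j \<and> br i j m a \<noteq> 0"
  proof (rule ccontr)
    assume "\<not> ?thesis"
    then have 0: "br i j m a = 0" if "m \<in> M" "m \<in> A i" "a \<in> A j" for i j m a using that by blast
    obtain l m' where m': "m' \<in> M" "m' \<in> A l" "m' \<noteq> 0" using gideal_homogeneous[OF M] .
    have comm: "br j k a b = 0" if a: "a \<in> A j" and b: "b \<in> A k" for a b j k
    proof -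
      have *: "m * br j k a b = 0" if m: "m \<in> M" "m \<in> A i" for i m
        using br_mult_left_derivation[of i j k m a b] 0[OF gideal_right[OF M(1) m(1)] A_mult[OF m(2) a] b]
          0[OF m b] by (auto split: if_splits)
      have "m' * m * br j k a b = 0" if "m \<in> M" "m \<in> A i" for i m
        using *[OF that] by (simp add: mult.assoc)
      then show ?thesis using prime_mult_ideal[OF M m'(2) br_A[OF a b]] m' by blast
    qed
    have "x = 0" if x: "x \<in> A1" for x
    proof -
      have xx: "x * x = 0"
        using comm[of x True x True] x double_eq_zero[of "x * x"] by (simp add: br_def)
      have "x * a * x = 0" for a
      proof (rule A_induct[of "\<lambda>a. x * a * x = 0"])
        fix i a assume a: "a \<in> A i"
        have "x * a = a * x \<or> x * a = - (a * x)"
          using comm[of x True a i] x a by (auto simp: br_def eq_neg_iff_add_eq_0 split: if_splits)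
        moreover have "a * x * x = 0" using xx by (simp add: mult.assoc)
        ultimately show "x * a * x = 0" by (elim disjE) simp_all
      qed (simp add: distrib_left distrib_right)
      then show ?thesis using prime_mult[of x True x True] x by simp
    qed
    then show False using nontrivial A_zero[of True] by auto
  qed
  then show ?thesis using that by blast
qed

section \<open>Lie ideals and submodules invariant under them\<close>

text \<open>The odd elements whose superbracket with every odd element of \<open>[M, A]\<close> is
  central. Since \<open>m\<close> and \<open>a\<close> have opposite degrees, their superbracket is
  the plain commutator.\<close>

definition W :: "'a set \<Rightarrow> 'a set" where
  "W M = {w \<in> A1. \<forall>i m a. m \<in> M \<longrightarrow> m \<in> A i \<longrightarrow> a \<in> A (\<not> i) \<longrightarrow> w * (m * a - a * m) + (m * a - a * m) * w \<in> Z}"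

lemma W_I:
  assumes "w \<in> A1" "\<And>i m a. m \<in> M \<Longrightarrow> m \<in> A i \<Longrightarrow> a \<in> A (\<not> i) \<Longrightarrow> br True True w (br i (\<not> i) m a) \<in> Z"
  shows "w \<in> W M"
  using assms unfolding W_def br_def by auto

lemma Lie_ideal_dichotomy:
  assumes L: "submod L" and LA: "\<And>i j x a. x \<in> L \<Longrightarrow> x \<in> A i \<Longrightarrow> a \<in> A j \<Longrightarrow> br i j x a \<in> L"
  shows "(\<exists>M. gideal M \<and> M \<noteq> {0} \<and> (\<forall>i j m a. m \<in> M \<longrightarrow> m \<in> A i \<longrightarrow> a \<in> A j \<longrightarrow> br i j m a \<in> L))
    \<or> L \<subseteq> Z \<or> W UNIV \<noteq> {0}"
proof -
  define T where "T = transporter UNIV L"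
  have T: "submod T" unfolding T_def by (rule transporter_submod[OF L])
  have TD: "br i j x a \<in> L" if "x \<in> T" "x \<in> A i" "a \<in> A j" for x a i j
    by (rule transporterD[OF L that(1)[unfolded T_def] that(2) UNIV_I that(3)])
  have LT: "x \<in> T" if "x \<in> L" "x \<in> A i" for x i
    unfolding T_def by (rule transporterI[OF L that(2)]) (rule LA[OF that])
  have Tm: "x * y \<in> T" if "x \<in> T" "x \<in> A i" "y \<in> T" "y \<in> A j" for x y i j
    using that unfolding T_def by (rule transporter_mult[OF L gideal_UNIV])
  show ?thesis
  proof (cases "\<exists>i j x y. x \<in> T \<and> x \<in> A i \<and> y \<in> T \<and> y \<in> A j \<and> br i j x y \<noteq> 0")
    case True
    then obtain i j x y where x: "x \<in> T" "x \<in> A i" and y: "y \<in> T" "y \<in> A j" and c0: "br i j x y \<noteq> 0"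
      by blast
    let ?c = "br i j x y"
    have c: "?c \<in> A (i \<noteq> j)" by (rule br_A[OF x(2) y(2)])
    \<comment> \<open>By \<open>br_mult_right\<close> the product is a combination of
      \<open>[x, y a]\<close> and \<open>y [x, a]\<close>. Both brackets lie in \<open>L\<close>,
      hence in the subalgebra \<open>T\<close>.\<close>
    have ca: "?c * a \<in> T" if a: "a \<in> A k" for a k
    proof -
      have "br i (j \<noteq> k) x (y * a) \<in> T"
        by (rule LT[OF TD[OF x A_mult[OF y(2) a]] br_A[OF x(2) A_mult[OF y(2) a]]])
      moreover have "y * br i k x a \<in> T"
        by (rule Tm[OF y LT[OF TD[OF x a] br_A[OF x(2) a]] br_A[OF x(2) a]])
      ultimately show ?thesis
        unfolding br_mult_right[of i j x y a k] by (auto intro: submod_diff[OF T] submod_add[OF T])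
    qed
    have bca: "b * ?c * a \<in> T" if b: "b \<in> A l" and a: "a \<in> A k" for a b k l
    proof -
      have cA: "?c * a \<in> A ((i \<noteq> j) \<noteq> k)" by (rule A_mult[OF c a])
      have "br ((i \<noteq> j) \<noteq> k) l (?c * a) b \<in> T"
        by (rule LT[OF TD[OF ca[OF a] cA b] br_A[OF cA b]])
      moreover have "?c * (a * b) \<in> T" by (rule ca[OF A_mult[OF a b]])
      moreover have "b * ?c * a = ?c * (a * b) - br ((i \<noteq> j) \<noteq> k) l (?c * a) b \<or>
          b * ?c * a = br ((i \<noteq> j) \<noteq> k) l (?c * a) b - ?c * (a * b)"
        by (auto simp: br_def mult.assoc)
      ultimately show ?thesis using submod_diff[OF T] by metis
    qed
    have core: "core T \<noteq> {0}"
      by (rule core_nonzero[OF c c0]) (rule two_sided_induct[OF T bca])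
    have "br i j m a \<in> L" if "m \<in> core T" "m \<in> A i" "a \<in> A j" for i j m a
      using TD core_subset that by blast
    then show ?thesis using core core_gideal[OF T] by blast
  next
    case False
    then have 0: "br i j x y = 0" if "x \<in> T" "x \<in> A i" "y \<in> T" "y \<in> A j" for x y i j
      using that by blast
    \<comment> \<open>One application of \<open>ad u\<close> lands in \<open>L\<close>, hence in
      \<open>T\<close>; a second one is then a bracket of two elements of \<open>T\<close> and
      vanishes.\<close>
    have L0: "u \<in> Z" if u: "u \<in> L" "u \<in> A0" for u
    proof (rule ad_square_zero[OF _ gideal_UNIV])
      have uF: "u \<in> A False" using u by simp
      fix i j m a assume "m \<in> A i" "a \<in> A j"
      then have b: "br i j m a \<in> A (i \<noteq> j)" (is "?b \<in> _") by (rule br_A)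
      have "ad u ?b \<in> T" "ad u ?b \<in> A (i \<noteq> j)"
        using LT[OF LA[OF u(1) uF b] br_A[OF uF b]] br_A[OF uF b] by (simp_all add: br_False)
      then show "ad u (ad u ?b) = 0"
        using 0[OF LT[OF u(1) uF] uF, of "ad u ?b"] by (simp add: br_False)
    next
      show "UNIV \<noteq> {0::'a}" using nontrivial A_zero[of True] by auto
    qed (use u in simp)
    show ?thesis
    proof (cases "W UNIV = {0}")
      case True
      have "x \<in> Z" if "x \<in> L" for x
        using L that
      proof (rule submod_induct)
        fix i x assume x: "x \<in> L" "x \<in> A i"
        show "x \<in> Z"
        proof (cases i)
          case False then show ?thesis using L0 x by simp
        next
          case i: True
          \<comment> \<open>The bracket of an odd \<open>x\<close> in \<open>L\<close> with an odd
            element is in the even part of \<open>L\<close>, which is already known to be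
            central.\<close>
          have "x \<in> W UNIV"
          proof (rule W_I)
            fix j m a assume ma: "m \<in> A j" "a \<in> A (\<not> j)"
            have b: "br j (\<not> j) m a \<in> A True" using br_A[OF ma] by simp
            show "br True True x (br j (\<not> j) m a) \<in> Z"
              using L0[OF LA[OF x b]] br_A[OF x(2) b] i by simp
          qed (use x i in simp)
          then show ?thesis using True Z_zero by simp
        qed
      qed (rule Z_add)
      then show ?thesis by blast
    qed blast
  qed
qed

lemma subalgebra_contains_ideal:
  assumes M: "gideal M" "M \<noteq> {0}" and T: "submod T"
    and Tm: "\<And>i j x y. x \<in> T \<Longrightarrow> x \<in> A i \<Longrightarrow> y \<in> T \<Longrightarrow> y \<in> A j \<Longrightarrow> x * y \<in> T"
    and TN: "\<And>i j k t m a. t \<in> T \<Longrightarrow> t \<in> A i \<Longrightarrow> m \<in> M \<Longrightarrow> m \<in> A j \<Longrightarrow> a \<in> A k \<Longrightarrow>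
       br i (j \<noteq> k) t (br j k m a) \<in> T"
    and t: "t \<in> T" "t \<in> A0" "t \<notin> Z"
  shows "\<exists>c l. c \<in> A l \<and> c \<noteq> 0 \<and> (\<forall>a b. a * c * b \<in> T)"
proof -
  have Tmult: "x * y \<in> T" if "x \<in> T" "y \<in> T" for x y
    by (rule submod_mult_closed[OF T _ that]) (rule Tm)
  have tF: "t \<in> A False" using t by simp
  let ?d = "ad t"
  have dN: "?d (br j k m a) \<in> T" if "m \<in> M" "m \<in> A j" "a \<in> A k" for j k m a
    using TN[OF t(1) tF that] by (simp add: br_False)
  \<comment> \<open>Apply \<open>ad t\<close> to the bracket of \<open>t * m\<close> with
    \<open>a\<close>. The part \<open>t * ad t [m, a]\<close> stays in the subalgebra
    \<open>T\<close>, which leaves the derivative of \<open>ad t a * m\<close>.\<close>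
  have 1: "?d (?d a * m) \<in> T" if m: "m \<in> M" for a m
  proof (rule A_induct[of "\<lambda>a. ?d (?d a * m) \<in> T"])
    fix k a assume a: "a \<in> A k"
    show "?d (?d a * m) \<in> T"
      using gideal_submod[OF M(1)] m
    proof (rule submod_induct)
      fix j m assume m: "m \<in> M" "m \<in> A j"
      have tm: "t * m \<in> M" "t * m \<in> A j" using gideal_left[OF M(1) m(1)] A_mult[OF tF m(2)] by simp_all
      have "?d (br j k (t * m) a) - t * ?d (br j k m a) \<in> T"
        by (rule submod_diff[OF T dN[OF tm a] Tmult[OF t(1) dN[OF m a]]])
      then have "?d (if j \<and> k then - (?d a * m) else ?d a * m) \<in> T"
        by (simp add: br_mult_left ad_add ad_self_mult)
      then show "?d (?d a * m) \<in> T"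
        using submod_minus[OF T, of "- ?d (?d a * m)"] by (auto simp: ad_minus split: if_splits)
    qed (simp add: distrib_left ad_add submod_add[OF T])
  qed (simp add: distrib_right ad_add submod_add[OF T])
  have 2: "?d (a * (?d b * m)) \<in> T" if m: "m \<in> M" for a b m
  proof -
    have "a * (?d b * m) = ?d (a * b) * m - ?d a * (b * m)"
      by (simp add: ad_mult algebra_simps)
    then show ?thesis
      using submod_diff[OF T 1[OF m, of "a * b"] 1[OF gideal_left[OF M(1) m], of a b]] by (simp add: ad_diff)
  qed
  define S where "S = {x. ?d x \<in> T}"
  have S: "submod S"
  proof (rule submodI)
    fix x y assume x: "x \<in> A0" "y \<in> A1" "x + y \<in> S"
    have "?d x \<in> A False" "?d y \<in> A (\<not> False)"
      using ad_A[OF t(2), of x False] ad_A[OF t(2), of y True] x by simp_all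
    then show "x \<in> S"
      using submod_components(1)[OF T, of "?d x" False "?d y"] x(3) by (simp add: S_def ad_add)
  next
    fix r x assume "x \<in> S"
    moreover have "?d (scale r x) = scale r (?d x)"
      by (simp add: ad_def scale_mult_left[symmetric] scale_mult_right[symmetric] scale_right_diff_distrib)
    ultimately show "scale r x \<in> S" by (simp add: S_def submod_scale[OF T])
  qed (simp_all add: S_def submod_zero[OF T] ad_add submod_add[OF T])
  \<comment> \<open>A whole ideal that \<open>ad t\<close> maps into \<open>T\<close>. It is nonzero
    because, by the preceding step, \<open>S\<close> contains all products
    \<open>x * (ad t b * m) * y\<close>.\<close>
  define I where "I = core S"
  have I: "gideal I" unfolding I_def by (rule core_gideal[OF S])
  have dI: "?d x \<in> T" if "x \<in> I" for x using that core_subset[of S] by (auto simp: I_def S_def)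
  obtain k b where b: "b \<in> A k" "?d b \<noteq> 0" using centerI[OF t(2)] t(3) by blast
  obtain j m where m: "m \<in> M" "m \<in> A j" "?d b * m \<noteq> 0"
    using ideal_mult_nonzero[OF M ad_A[OF t(2) b(1)] b(2)] .
  have I0: "I \<noteq> {0}" unfolding I_def
  proof (rule core_nonzero[OF A_mult[OF ad_A[OF t(2) b(1)] m(2)] m(3)])
    fix x y show "x * (?d b * m) * y \<in> S"
      using 2[OF gideal_right[OF M(1) m(1), of y], of x b] by (simp add: S_def mult.assoc)
  qed
  \<comment> \<open>Otherwise \<open>ad t\<close> would square to zero on all brackets of
    \<open>I\<close>, and \<open>ad_square_zero\<close> would make \<open>t\<close> central.\<close>
  have "\<exists>i x. x \<in> I \<and> x \<in> A i \<and> ?d (?d x) \<noteq> 0"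
  proof (rule ccontr)
    assume "\<not> ?thesis"
    then have "?d (?d (br i j m a)) = 0" if "m \<in> I" "m \<in> A i" "a \<in> A j" for i j m a
      using br_gideal[OF I that(1)] br_A[OF that(2,3)] by blast
    then have "t \<in> Z" using ad_square_zero[OF t(2) I I0] by blast
    then show False using t(3) by simp
  qed
  then obtain i x where x: "x \<in> I" "x \<in> A i" "?d (?d x) \<noteq> 0" by blast
  define q where "q = ?d (?d x)"
  have q: "q \<in> A i" "q \<noteq> 0" using x ad_A[OF t(2)] by (auto simp: q_def)
  \<comment> \<open>The left multipliers of \<open>I\<close> into \<open>T\<close>. This is a right
    ideal, and homogeneous members stay in it under left multiplication by \<open>[M, A]\<close>.
    These two properties suffice to absorb an arbitrary \<open>a\<close> on the left of
    \<open>q * m * q\<close>.\<close>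
  define Q where "Q = {q. \<forall>y\<in>I. q * y \<in> T}"
  have qQ: "q \<in> Q"
  proof -
    have "q * y \<in> T" if y: "y \<in> I" for y
    proof -
      have "?d (?d x * y) \<in> T" by (rule dI[OF gideal_left[OF I y]])
      moreover have "?d x * ?d y \<in> T" by (rule Tmult[OF dI[OF x(1)] dI[OF y]])
      ultimately have "?d (?d x * y) - ?d x * ?d y \<in> T" by (rule submod_diff[OF T])
      then show ?thesis by (simp add: ad_mult q_def)
    qed
    then show ?thesis by (simp add: Q_def)
  qed
  have Qr: "p * z \<in> Q" if "p \<in> Q" for p z
    using that gideal_left[OF I] by (auto simp: Q_def mult.assoc)
  have QN: "br j k m a * p \<in> Q" if m: "m \<in> M" "m \<in> A j" and a: "a \<in> A k" and p: "p \<in> Q" "p \<in> A l" for j k l m a p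
  proof -
    let ?n = "br j k m a"
    have "?n * p * y \<in> T" if y: "y \<in> I" for y
      using gideal_submod[OF I] y
    proof (rule submod_induct[where P = "\<lambda>y. ?n * p * y \<in> T"])
      fix r y assume y: "y \<in> I" "y \<in> A r"
      have "br (l \<noteq> r) (j \<noteq> k) (p * y) ?n \<in> T"
        using TN[OF _ A_mult[OF p(2) y(2)] m a] p(1) y(1) by (auto simp: Q_def)
      moreover have "p * (y * ?n) \<in> T" using p(1) gideal_right[OF I y(1)] by (auto simp: Q_def)
      moreover have "?n * p * y = p * (y * ?n) - br (l \<noteq> r) (j \<noteq> k) (p * y) ?n \<or>
        ?n * p * y = br (l \<noteq> r) (j \<noteq> k) (p * y) ?n - p * (y * ?n)"
        unfolding br_def[of "l \<noteq> r"] by (auto simp: mult.assoc)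
      ultimately show "?n * p * y \<in> T" using submod_diff[OF T] by metis
    qed (simp add: distrib_left submod_add[OF T])
    then show ?thesis by (simp add: Q_def)
  qed
  have Qadd: "p + p' \<in> Q" "p - p' \<in> Q" if "p \<in> Q" "p' \<in> Q" for p p'
    using that by (auto simp: Q_def distrib_right left_diff_distrib submod_add[OF T] submod_diff[OF T])
  \<comment> \<open>Up to sign, \<open>a q m q\<close> is the difference of
    \<open>[q m, a] q\<close> and \<open>q m a q\<close>; the first is in \<open>Q\<close> by
    \<open>QN\<close>, the second because \<open>Q\<close> is a right ideal.\<close>
  have qmq: "a * q * m * q \<in> Q" if m: "m \<in> M" "m \<in> A j" for a m j
  proof (rule A_induct[of "\<lambda>a. a * q * m * q \<in> Q"])
    fix k a assume a: "a \<in> A k"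
    have "br (i \<noteq> j) k (q * m) a * q \<in> Q"
      by (rule QN[OF gideal_left[OF M(1) m(1)] A_mult[OF q(1) m(2)] a qQ q(1)])
    moreover have "q * (m * a * q) \<in> Q" by (rule Qr[OF qQ])
    moreover have "a * q * m * q = q * (m * a * q) - br (i \<noteq> j) k (q * m) a * q \<or>
        a * q * m * q = br (i \<noteq> j) k (q * m) a * q - q * (m * a * q)"
      by (auto simp: br_def mult.assoc left_diff_distrib distrib_right)
    ultimately show "a * q * m * q \<in> Q" using Qadd by metis
  qed (simp add: distrib_right Qadd)
  obtain j m where m: "m \<in> M" "m \<in> A j" "q * m * q \<noteq> 0"
    using prime_mult_ideal[OF M q(1) q(1)] q(2) by blast
  have qmqA: "q * m * q \<in> A ((i \<noteq> j) \<noteq> i)" by (rule A_mult[OF A_mult[OF q(1) m(2)] q(1)])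
  obtain r y where y: "y \<in> I" "y \<in> A r" "q * m * q * y \<noteq> 0"
    using ideal_mult_nonzero[OF I I0 qmqA m(3)] .
  have "a * (q * m * q * y) * b \<in> T" for a b
    using qmq[OF m(1,2), of a] gideal_right[OF I y(1), of b] by (auto simp: Q_def mult.assoc)
  then show ?thesis using A_mult[OF qmqA y(2)] y(3) by blast
qed

text \<open>Stability under \<open>[M, A]\<close> is the form in which a Lie ideal \<open>L\<close>
  containing \<open>[M, A]\<close> acts on \<open>V\<close>. The alternative
  \<open>W M \<noteq> {0}\<close> isolates the cases in which odd elements can fail to be
  central.\<close>

lemma invariant_submodule_dichotomy:
  assumes M: "gideal M" "M \<noteq> {0}" and V: "submod V"
    and VN: "\<And>i j k v m a. v \<in> V \<Longrightarrow> v \<in> A i \<Longrightarrow> m \<in> M \<Longrightarrow> m \<in> A j \<Longrightarrow> a \<in> A k \<Longrightarrow>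
       br i (j \<noteq> k) v (br j k m a) \<in> V"
  shows "(\<exists>I. gideal I \<and> I \<noteq> {0} \<and> (\<forall>i j m a. m \<in> I \<longrightarrow> m \<in> A i \<longrightarrow> a \<in> A j \<longrightarrow> br i j m a \<in> V))
    \<or> V \<subseteq> Z \<or> W M \<noteq> {0}"
proof -
  define T where "T = transporter M V"
  have T: "submod T" unfolding T_def by (rule transporter_submod[OF V])
  have TD: "br i j x m \<in> V" if "x \<in> T" "x \<in> A i" "m \<in> M" "m \<in> A j" for x m i j
    by (rule transporterD[OF V that(1)[unfolded T_def] that(2-4)])
  have TI: "x \<in> T" if "x \<in> A i" "\<And>j m. m \<in> M \<Longrightarrow> m \<in> A j \<Longrightarrow> br i j x m \<in> V" for x i
    unfolding T_def by (rule transporterI[OF V that])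
  have Tm: "x * y \<in> T" if "x \<in> T" "x \<in> A i" "y \<in> T" "y \<in> A j" for x y i j
    using that unfolding T_def by (rule transporter_mult[OF V M(1)])
  \<comment> \<open>By the super Jacobi identity \<open>[[t, n], x]\<close> is a combination of
    \<open>[t, [n, x]]\<close>, in \<open>V\<close> since \<open>[n, x]\<close> is in
    \<open>M\<close>, and \<open>[n, [t, x]]\<close>, in \<open>V\<close> since \<open>V\<close> is
    stable under \<open>n\<close>.\<close>
  have TN: "br i (j \<noteq> k) t (br j k m a) \<in> T"
    if t: "t \<in> T" "t \<in> A i" and m: "m \<in> M" "m \<in> A j" and a: "a \<in> A k" for i j k t m a
  proof (rule TI[OF br_A[OF t(2) br_A[OF m(2) a]]])
    let ?n = "br j k m a"
    have n: "?n \<in> M" "?n \<in> A (j \<noteq> k)" using br_gideal[OF M(1) m(1)] br_A[OF m(2) a] by simp_all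
    fix l x assume x: "x \<in> M" "x \<in> A l"
    have "br i ((j \<noteq> k) \<noteq> l) t (br (j \<noteq> k) l ?n x) \<in> V"
      by (rule TD[OF t br_gideal[OF M(1) n(1)] br_A[OF n(2) x(2)]])
    moreover have "br (i \<noteq> l) (j \<noteq> k) (br i l t x) ?n \<in> V"
      by (rule VN[OF TD[OF t x] br_A[OF t(2) x(2)] m a])
    then have "br (j \<noteq> k) (i \<noteq> l) ?n (br i l t x) \<in> V"
      unfolding br_swap[of "j \<noteq> k" "i \<noteq> l"] using submod_minus[OF V] by auto
    ultimately show "br (i \<noteq> (j \<noteq> k)) l (br i (j \<noteq> k) t ?n) x \<in> V"
      unfolding br_jacobi[of i "j \<noteq> k" l t ?n x] 
      using submod_add[OF V] submod_diff[OF V] by auto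
  qed
  show ?thesis
  proof (cases "T \<inter> A0 \<subseteq> Z")
    case False
    then obtain t where t: "t \<in> T" "t \<in> A0" "t \<notin> Z" by blast
    have ex: "\<exists>c l. c \<in> A l \<and> c \<noteq> 0 \<and> (\<forall>a b. a * c * b \<in> T)"
      by (rule subalgebra_contains_ideal[OF M T _ _ t]) (erule (3) Tm, erule (4) TN)
    then obtain c l where c: "c \<in> A l" "c \<noteq> 0" "\<And>a b. a * c * b \<in> T"
      using ex by blast
    define I where "I = core T"
    have I: "gideal I" "I \<noteq> {0}" "I \<subseteq> T"
      unfolding I_def using core_gideal[OF T] core_nonzero[OF c] core_subset by auto
    obtain i x where x: "x \<in> I" "x \<in> A i" "x \<noteq> 0" using gideal_homogeneous[OF I(1,2)] .
    obtain j m where m: "m \<in> M" "m \<in> A j" "x * m \<noteq> 0" using ideal_mult_nonzero[OF M x(2,3)] .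
    \<comment> \<open>Elements of \<open>T\<close> bracket only \<open>M\<close> into
      \<open>V\<close>, while the conclusion asks for all of \<open>A\<close>. Products of the ideal
      \<open>I\<close> inside \<open>T\<close> with elements of \<open>M\<close> repair this through
      the cyclic identity.\<close>
    define U where "U = transporter UNIV V"
    have U: "submod U" unfolding U_def by (rule transporter_submod[OF V])
    have IM: "x * m \<in> U" if x: "x \<in> I" "x \<in> A i" and m: "m \<in> M" "m \<in> A j" for x m i j
      unfolding U_def
    proof (rule transporterI[OF V A_mult[OF x(2) m(2)]])
      fix k a assume a: "a \<in> A k"
      have "br i (j \<noteq> k) x (m * a) \<in> V"
        by (rule TD[OF subsetD[OF I(3) x(1)] x(2) gideal_right[OF M(1) m(1)] A_mult[OF m(2) a]])
      moreover have "br (k \<noteq> i) j (a * x) m \<in> V"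
        by (rule TD[OF subsetD[OF I(3) gideal_left[OF I(1) x(1)]] A_mult[OF a x(2)] m])
      then have "br j (k \<noteq> i) m (a * x) \<in> V"
        unfolding br_swap[of j "k \<noteq> i"] using submod_minus[OF V] by auto
      ultimately show "br (i \<noteq> j) k (x * m) a \<in> V"
        unfolding br_mult_cyclic[of i j k x m a] using submod_add[OF V] submod_diff[OF V] by auto
    qed
    have "a * (x * m) * b \<in> U" for a b
    proof (rule two_sided_induct[OF U])
      fix k l a b assume a: "a \<in> A k" and b: "b \<in> A l"
      show "a * (x * m) * b \<in> U"
        using IM[OF gideal_left[OF I(1) x(1)] A_mult[OF a x(2)] gideal_right[OF M(1) m(1)] A_mult[OF m(2) b]]
        by (simp only: mult.assoc)
    qed
    then have "core U \<noteq> {0}" by (rule core_nonzero[OF A_mult[OF x(2) m(2)] m(3)])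
    moreover have "br i j m a \<in> V" if "m \<in> core U" "m \<in> A i" "a \<in> A j" for i j m a
    proof -
      have "m \<in> transporter UNIV V" using that(1) core_subset[of U] by (auto simp: U_def)
      from transporterD[OF V this that(2) UNIV_I that(3)] show ?thesis .
    qed
    ultimately show ?thesis using core_gideal[OF U] by blast
  next
    case TZ: True
    show ?thesis
    proof (cases "W M = {0}")
      case W: True
      have T1: "t = 0" if t: "t \<in> T" "t \<in> A True" for t
      proof -
        have "t \<in> W M"
        proof (rule W_I)
          fix i m a assume m: "m \<in> M" "m \<in> A i" and a: "a \<in> A (\<not> i)"
          have "br True True t (br i (\<not> i) m a) \<in> T \<inter> A0"
            using TN[OF t m a] br_A[OF t(2) br_A[OF m(2) a]] by auto
          then show "br True True t (br i (\<not> i) m a) \<in> Z" using TZ by blast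
        qed (use t in simp)
        then show ?thesis using W by simp
      qed
      have V0: "v \<in> Z" if v: "v \<in> V" "v \<in> A0" for v
      proof (rule ccontr)
        assume vZ: "v \<notin> Z"
        have vF: "v \<in> A False" using v by simp
        let ?d = "ad v"
        have dN: "?d (br j k m a) \<in> V" "?d (br j k m a) \<in> A (j \<noteq> k)"
          if "m \<in> M" "m \<in> A j" "a \<in> A k" for j k m a
          using VN[OF v(1) vF that] ad_A[OF v(2) br_A[OF that(2,3)]] by (simp_all add: br_False)
        \<comment> \<open>The derivation rule gives
          \<open>[ad v u, m] = ad v [u, m] - [u, ad v m]\<close>. Up to sign, \<open>[u, m]\<close>
          and \<open>ad v m\<close> are brackets of \<open>M\<close> with \<open>A\<close>, and
          \<open>V\<close> is stable under these.\<close>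
        have dV: "?d u \<in> T" if u: "u \<in> V" "u \<in> A i" for u i
        proof (rule TI[OF ad_A[OF v(2) u(2)]])
          fix j m assume m: "m \<in> M" "m \<in> A j"
          have "?d (br j i m u) \<in> V" by (rule dN(1)[OF m u(2)])
          then have 1: "?d (br i j u m) \<in> V"
            unfolding br_swap[of i j] using submod_minus[OF V] by (auto simp: ad_minus)
          have "br i j u (br j False m v) \<in> V"
            using VN[OF u m vF] by simp
          then have "br i j u (?d m) \<in> V"
            unfolding br_swap[of j False m v] using submod_minus[OF V] by (simp add: br_False br_minus_right) fastforce
          then have "?d (br i j u m) - br i j u (?d m) \<in> V" by (rule submod_diff[OF V 1])
          then show "br i j (?d u) m \<in> V" by (simp add: ad_br)
        qed
        have ddN: "?d (?d (br j k m a)) \<in> T" "?d (?d (br j k m a)) \<in> A (j \<noteq> k)"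
          if "m \<in> M" "m \<in> A j" "a \<in> A k" for j k m a
          using dV[OF dN[OF that]] ad_A[OF v(2) dN(2)[OF that]] by simp_all
        \<comment> \<open>Double derivatives of brackets lie in \<open>T\<close>, whose odd part is
          zero while its even part is merely central. The argument of \<open>ad_square_zero\<close>
          therefore has to be repeated in odd total degree only.\<close>
        have odd: "?d (?d (br j k m a)) = 0" if "m \<in> M" "m \<in> A j" "a \<in> A k" "j \<noteq> k" for j k m a
          using T1 ddN[OF that(1-3)] that(4) by simp
        have 1: "?d (?d (?d a * m)) = 0" if m: "m \<in> M" "m \<in> A j" and a: "a \<in> A k" and jk: "j \<noteq> k" for j k m a
        proof -
          have vm: "v * m \<in> M" "v * m \<in> A j" using gideal_left[OF M(1) m(1)] A_mult[OF vF m(2)] by simp_all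
          show ?thesis
            using odd[OF vm a jk] odd[OF m a jk] jk
            by (auto simp: br_mult_left ad_add ad_minus ad_self_mult split: if_splits)
        qed
        have 2: "?d (?d (a * (?d b * m))) = 0"
          if m: "m \<in> M" "m \<in> A j" and a: "a \<in> A k" and b: "b \<in> A l" and jkl: "j \<noteq> (k \<noteq> l)" for j k l m a b
        proof -
          have "a * (?d b * m) = ?d (a * b) * m - ?d a * (b * m)"
            by (simp add: ad_mult algebra_simps)
          moreover have "?d (?d (?d (a * b) * m)) = 0" by (rule 1[OF m A_mult[OF a b] jkl])
          moreover have "?d (?d (?d a * (b * m))) = 0"
            by (rule 1[OF gideal_left[OF M(1) m(1)] A_mult[OF b m(2)] a]) (use jkl in auto)
          ultimately show ?thesis by (simp add: ad_diff)
        qed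
        \<comment> \<open>Even components are left free, since only odd ones are controlled. The
          core of \<open>S\<close> is an ideal on whose odd part \<open>ad v\<close> squares to
          zero.\<close>
        define S where "S = graded_sum (\<lambda>i. {x \<in> A i. i \<longrightarrow> ?d (?d x) = 0})"
        have sub: "subspace {x \<in> A i. i \<longrightarrow> ?d (?d x) = 0}" for i
        proof (rule subspaceI)
          fix r x assume "x \<in> {x \<in> A i. i \<longrightarrow> ?d (?d x) = 0}"
          moreover have "?d (scale r x) = scale r (?d x)" for x
            by (simp add: ad_def scale_mult_left[symmetric] scale_mult_right[symmetric] scale_right_diff_distrib)
          ultimately show "scale r x \<in> {x \<in> A i. i \<longrightarrow> ?d (?d x) = 0}"
            using subspace_scale[OF subspace_A] by auto
        qed (auto simp: A_add ad_add)
        have S: "submod S" unfolding S_def by (rule graded_sum_submod[OF _ sub]) auto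
        have S_iff: "x \<in> S \<longleftrightarrow> (i \<longrightarrow> ?d (?d x) = 0)" if "x \<in> A i" for x i
        proof -
          have "x \<in> S \<longleftrightarrow> x \<in> {x \<in> A i. i \<longrightarrow> ?d (?d x) = 0}"
            unfolding S_def by (rule graded_sum_homogeneous[OF _ _ that]) auto
          then show ?thesis using that by blast
        qed
        define I where "I = core S"
        have I: "gideal I" unfolding I_def by (rule core_gideal[OF S])
        have ddI: "?d (?d x) = 0" if "x \<in> I" "x \<in> A True" for x
          using that core_subset[of S] S_iff[OF that(2)] by (auto simp: I_def)
        obtain k b where b: "b \<in> A k" "?d b \<noteq> 0" using centerI[OF v(2)] vZ by blast
        obtain j m where m: "m \<in> M" "m \<in> A j" "?d b * m \<noteq> 0"
          using ideal_mult_nonzero[OF M ad_A[OF v(2) b(1)] b(2)] .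
        have cA: "?d b * m \<in> A (k \<noteq> j)" by (rule A_mult[OF ad_A[OF v(2) b(1)] m(2)])
        have I0: "I \<noteq> {0}" unfolding I_def
        proof (rule core_nonzero[OF cA m(3)], rule two_sided_induct[OF S])
          fix p r x y assume x: "x \<in> A p" and y: "y \<in> A r"
          have *: "x * (?d b * m) * y = x * (?d b * (m * y))" by (simp only: mult.assoc)
          have my: "m * y \<in> M" "m * y \<in> A (j \<noteq> r)"
            using gideal_right[OF M(1) m(1)] A_mult[OF m(2) y] by simp_all
          have mem: "x * (?d b * (m * y)) \<in> A (p \<noteq> (k \<noteq> (j \<noteq> r)))"
            by (rule A_mult[OF x A_mult[OF ad_A[OF v(2) b(1)] my(2)]])
          show "x * (?d b * m) * y \<in> S"
            unfolding * S_iff[OF mem] using 2[OF my x b(1)] by auto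
        qed
        \<comment> \<open>As \<open>v\<close> is not central, some double derivative of a bracket is
          nonzero. It must be even, so it is a nonzero, hence cancellable, element \<open>z\<close>
          of the center with \<open>z = ad v y\<close>.\<close>
        obtain i j m a where n: "m \<in> M" "m \<in> A i" "a \<in> A j" and z0: "?d (?d (br i j m a)) \<noteq> 0"
          using ad_square_zero[OF v(2) M] vZ by blast
        then have ij: "i = j" using odd by blast
        define y where "y = ?d (br i j m a)"
        have y: "y \<in> A False" using dN(2)[OF n] ij by (simp add: y_def)
        define z where "z = ?d y"
        have z: "z \<in> Z" "z \<noteq> 0" using ddN[OF n] ij z0 TZ by (auto simp: z_def y_def)
        \<comment> \<open>In the second derivative of \<open>x * y\<close> the outer terms vanish,
          because \<open>ad v\<close> squares to zero on \<open>x\<close> and kills the central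
          \<open>z\<close>; twice \<open>ad v x * z\<close> remains.\<close>
        have dI: "?d x = 0" if x: "x \<in> I" "x \<in> A True" for x
        proof -
          have "?d (?d (x * y)) = 0"
            by (rule ddI[OF gideal_right[OF I x(1)]]) (use A_mult[OF x(2) y] in simp)
          then have "?d x * z + ?d x * z = 0"
            using ddI[OF x] ad_Z[OF z(1), of v] by (simp add: ad_ad_mult z_def)
          from double_eq_zero[OF this] have "z * ?d x = 0" using Z_comm[OF z(1), of "?d x"] by simp
          then show ?thesis by (rule Z_regular[OF z])
        qed
        have I1: "x = 0" if x: "x \<in> I" "x \<in> A True" for x
        proof -
          have "?d (y * x) = 0"
            by (rule dI[OF gideal_left[OF I x(1)]]) (use A_mult[OF y x(2)] in simp)
          then have "z * x = 0" using dI[OF x] by (simp add: ad_mult z_def)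
          then show ?thesis by (rule Z_regular[OF z])
        qed
        \<comment> \<open>An ideal without odd part annihilates \<open>A1\<close> on the right, so
          \<open>u A b = 0\<close> for every odd \<open>b\<close>, and primeness contradicts
          nontriviality.\<close>
        obtain l u where u: "u \<in> I" "u \<in> A l" "u \<noteq> 0" using gideal_homogeneous[OF I I0] .
        then have lF: "u \<in> A False" using I1 by (cases l) auto
        have uodd: "u * x = 0" if "x \<in> A True" for x
          using I1[OF gideal_right[OF I u(1)]] A_mult[OF lF that] by simp
        have "b = 0" if b: "b \<in> A1" for b
        proof -
          have "u * x * b = 0" for x
          proof (rule A_induct[of "\<lambda>x. u * x * b = 0"])
            fix i x assume x: "x \<in> A i"
            show "u * x * b = 0"
            proof (cases i)
              case True then show ?thesis using uodd x by simp
            next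
              case False
              then have "x * b \<in> A True" using A_mult[of x i b True] x b by simp
              then show ?thesis using uodd by (simp add: mult.assoc)
            qed
          qed (simp add: distrib_left distrib_right)
          then show ?thesis using prime_mult[OF u(2), of b True] b u(3) by auto
        qed
        then show False using nontrivial A_zero[of True] by auto
      qed
      have "x \<in> Z" if "x \<in> V" for x
        using V that
      proof (rule submod_induct)
        fix i x assume x: "x \<in> V" "x \<in> A i"
        show "x \<in> Z"
        proof (cases i)
          case False then show ?thesis using V0 x by simp
        next
          case i: True
          have "x \<in> W M"
          proof (rule W_I)
            fix j m a assume ma: "m \<in> M" "m \<in> A j" "a \<in> A (\<not> j)"
            have b: "br j (\<not> j) m a \<in> A True" using br_A[OF ma(2,3)] by simp
            show "br True True x (br j (\<not> j) m a) \<in> Z"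
              using V0[OF VN[OF x ma]] br_A[OF x(2) b] i by simp
          qed (use x i in simp)
          then show ?thesis using W Z_zero by simp
        qed
      qed (rule Z_add)
      then show ?thesis by blast
    qed blast
  qed
qed

section \<open>The exceptional superalgebras\<close>

lemma mult_eq_assoc: "(u::'a) * v = r \<Longrightarrow> u * (v * y) = r * y"
  by (simp flip: mult.assoc)

lemma Z_lcomm: "z \<in> Z \<Longrightarrow> a * (z * b) = z * (a * b)"
  using Z_comm[of z a] by (simp flip: mult.assoc)

lemma Z_mult_nonzero: "z \<in> Z \<Longrightarrow> z \<noteq> 0 \<Longrightarrow> x \<noteq> 0 \<Longrightarrow> z * x \<noteq> 0"
  using Z_regular by blast

lemma W_D:
  "w \<in> W M \<Longrightarrow> m \<in> M \<Longrightarrow> m \<in> A i \<Longrightarrow> a \<in> A (\<not> i) \<Longrightarrow> w * (m * a - a * m) + (m * a - a * m) * w \<in> Z"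
  unfolding W_def by blast

lemma W_A1: "w \<in> W M \<Longrightarrow> w \<in> A True"
  by (simp add: W_def)

lemma W_add: "w \<in> W M \<Longrightarrow> w' \<in> W M \<Longrightarrow> w + w' \<in> W M"
proof (rule W_I)
  assume w: "w \<in> W M" and w': "w' \<in> W M"
  show "w + w' \<in> A1" using A_add[OF W_A1[OF w] W_A1[OF w']] by simp
  fix i m a assume m: "m \<in> M" "m \<in> A i" "a \<in> A (\<not> i)"
  show "br True True (w + w') (br i (\<not> i) m a) \<in> Z"
    using Z_add[OF W_D[OF w m] W_D[OF w' m]] by (simp add: br_def algebra_simps)
qed

text \<open>On even elements of \<open>M\<close> the derivation \<open>ad (w * w)\<close> is minus
  the double bracket with \<open>w\<close>, so its values there are central. It is shown to vanish
  on the even part of \<open>M\<close>, then on the odd part, and finally on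
  \<open>A\<close>.\<close>

lemma W_square:
  assumes M: "gideal M" "M \<noteq> {0}" and w: "w \<in> W M"
  shows "w * w \<in> Z"
proof (cases "w = 0")
  case True then show ?thesis using Z_zero by simp
next
  case w0: False
  define s where "s = w * w"
  let ?d = "ad s"
  have wA: "w \<in> A True" by (rule W_A1[OF w])
  have sA: "s \<in> A False" using A_mult[OF wA wA] by (simp add: s_def)
  have dZ: "?d m \<in> Z" if m: "m \<in> M" "m \<in> A False" for m
  proof -
    have "w * (m * w - w * m) + (m * w - w * m) * w \<in> Z" using W_D[OF w m] wA by simp
    from Z_minus[OF this] show ?thesis
      by (simp add: ad_def s_def algebra_simps)
  qed
  \<comment> \<open>The second derivative of \<open>m * m\<close> is twice the square of the central
    element \<open>ad s m\<close>; a central element with square zero is zero.\<close>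
  have d0: "?d m = 0" if m: "m \<in> M" "m \<in> A False" for m
  proof -
    have "?d (m * m) \<in> Z"
      by (rule dZ[OF gideal_left[OF M(1) m(1)]]) (use A_mult[OF m(2) m(2)] in simp)
    then have "?d (?d (m * m)) = 0" by (rule ad_Z)
    then have "?d m * ?d m + ?d m * ?d m = 0"
      using ad_Z[OF dZ[OF m], of s] by (simp add: ad_ad_mult)
    then have "?d m * ?d m = 0" by (rule double_eq_zero)
    then show ?thesis using Z_regular[OF dZ[OF m]] by blast
  qed
  have wd: "w * ?d m = 0" if m: "m \<in> M" "m \<in> A True" for m
  proof -
    have "?d (w * m) = 0"
      by (rule d0[OF gideal_left[OF M(1) m(1)]]) (use A_mult[OF wA m(2)] in simp)
    moreover have "?d w = 0" by (simp add: ad_def s_def mult.assoc)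
    ultimately show ?thesis by (simp add: ad_mult)
  qed
  \<comment> \<open>So far only \<open>w * ad s m = 0\<close> is known. Treating even and odd
    \<open>x\<close> separately inserts \<open>x\<close> between the factors, which is the form that
    primeness needs.\<close>
  have d1: "?d m = 0" if m: "m \<in> M" "m \<in> A True" for m
  proof -
    have "w * x * ?d m = 0" if x: "x \<in> M" "x \<in> A k" for k x
    proof (cases k)
      case False
      have "w * ?d (x * m) = 0"
        by (rule wd[OF gideal_left[OF M(1) m(1)]]) (use A_mult[OF x(2) m(2)] False in simp)
      then show ?thesis using d0[OF x(1)] x(2) False by (simp add: ad_mult mult.assoc)
    next
      case True
      have "?d (x * m) = 0"
        by (rule d0[OF gideal_left[OF M(1) m(1)]]) (use A_mult[OF x(2) m(2)] True in simp)
      then have "w * ?d x * m + w * x * ?d m = 0" by (simp add: ad_mult mult.assoc distrib_left[symmetric])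
      then show ?thesis using wd[OF x(1)] x(2) True by simp
    qed
    then show ?thesis
      using prime_mult_ideal[OF M wA ad_A[OF _ m(2), of s]] sA w0 by auto
  qed
  have dM: "?d m = 0" if "m \<in> M" "m \<in> A k" for m k
    using that d0 d1 by (cases k) auto
  have "s \<in> Z"
  proof (rule centerI)
    show "s \<in> A0" using sA by simp
    fix i x assume x: "x \<in> A i"
    show "?d x = 0"
    proof (rule ccontr)
      assume dx: "?d x \<noteq> 0"
      have "s \<in> A0" using sA by simp
      obtain k m where m: "m \<in> M" "m \<in> A k" "?d x * m \<noteq> 0"
        using ideal_mult_nonzero[OF M ad_A[OF \<open>s \<in> A0\<close> x] dx] .
      have "?d (x * m) = 0" by (rule dM[OF gideal_left[OF M(1) m(1)] A_mult[OF x m(2)]])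
      then show False using m(3) dM[OF m(1,2)] by (simp add: ad_mult)
    qed
  qed
  then show ?thesis by (simp add: s_def)
qed

text \<open>In the super Jacobi identity one term has the form \<open>[w, [n, n']]\<close> and is
  central because \<open>[n, n']\<close> is an odd bracket with \<open>M\<close>; the other is a
  bracket with the central \<open>[w, n']\<close> and vanishes.\<close>

lemma W_bracket:
  assumes M: "gideal M" and w: "w \<in> W M" and m: "m \<in> M" "m \<in> A i" and a: "a \<in> A i"
  shows "br True False w (br i i m a) \<in> W M"
proof (rule W_I)
  let ?n = "br i i m a"
  have n: "?n \<in> M" "?n \<in> A False" using br_gideal[OF M m(1)] br_A[OF m(2) a] by simp_all
  show "br True False w ?n \<in> A1" using br_A[OF W_A1[OF w] n(2)] by simp
  fix j m' a' assume m': "m' \<in> M" "m' \<in> A j" and a': "a' \<in> A (\<not> j)"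
  let ?n' = "br j (\<not> j) m' a'"
  have n': "?n' \<in> A True" using br_A[OF m'(2) a'] by simp
  have "br True True w (br False True ?n ?n') \<in> Z"
    using W_D[OF w n] n' by (simp add: br_def)
  moreover have "br False False ?n (br True True w ?n') = 0"
    using ad_Z[OF W_D[OF w m' a']] by (simp add: br_def ad_def cong: if_cong)
  ultimately show "br True True (br True False w ?n) ?n' \<in> Z"
    using br_jacobi[of True False True w ?n ?n'] by simp
qed

text \<open>
  If all squares vanish on \<open>W M\<close>, then some odd \<open>y\<close> in \<open>[M, A]\<close> has \<open>\<zeta> = w y + y w\<close> central and nonzero,
  and \<open>y w y\<close> again lies in \<open>W M\<close>; but \<open>(w + y w y)\<^sup>2 = \<zeta>\<^sup>2\<close>.
\<close>

lemma W_nonisotropic: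
  assumes M: "gideal M" "M \<noteq> {0}" and W0: "W M \<noteq> {0}"
  shows "\<exists>w\<in>W M. w * w \<noteq> 0"
proof (rule ccontr)
  assume "\<not> ?thesis"
  then have iso: "v * v = 0" if "v \<in> W M" for v using that by blast
  have "0 \<in> W M" using A_zero[of True] Z_zero by (simp add: W_def)
  then obtain w where w: "w \<in> W M" and w0: "w \<noteq> 0" using W0 by blast
  have wA: "w \<in> A True" by (rule W_A1[OF w])
  have ww: "w * w = 0" by (rule iso[OF w])
  note ww' = ww mult_eq_assoc[OF ww]
  have "\<exists>i m a. m \<in> M \<and> m \<in> A i \<and> a \<in> A (\<not> i) \<and> w * (m * a - a * m) * w \<noteq> 0"
  proof (rule ccontr)
    assume "\<not> ?thesis"
    then have n0: "w * (m * a - a * m) * w = 0" if "m \<in> M" "m \<in> A i" "a \<in> A (\<not> i)" for m a i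
      using that by blast
    \<comment> \<open>Substituting \<open>a * w\<close> for \<open>a\<close> in the assumed relation
      kills one of its two terms, because \<open>w * w = 0\<close>; a relation between plain
      products remains.\<close>
    have P: "w * a * w * m * w = 0" if m: "m \<in> M" "m \<in> A i" and a: "a \<in> A i" for m a i
    proof -
      have "w * (m * (a * w) - a * w * m) * w = 0"
        by (rule n0[OF m]) (use A_mult[OF a wA] in simp)
      then show ?thesis by (simp add: algebra_simps ww')
    qed
    have even: "w * m * w = 0" if m: "m \<in> M" "m \<in> A False" for m
    proof -
      have "(w * m * w) * x * (w * m * w) = 0" if x: "x \<in> M" "x \<in> A k" for x k
      proof (cases k)
        case False
        have "w * m * w * x * w = 0" by (rule P[OF x(1) _ m(2)]) (use x False in simp)
        then have "w * m * w * x * w * m * w = 0" by simp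
        then show ?thesis by (simp only: mult.assoc)
      next
        case True
        have "w * (m * w * x) * w * m * w = 0"
          by (rule P[OF m]) (use A_mult[OF A_mult[OF m(2) wA] x(2)] True in simp)
        then show ?thesis by (simp only: mult.assoc)
      qed
      then show ?thesis
        using prime_mult_ideal[OF M A_mult[OF A_mult[OF wA m(2)] wA] A_mult[OF A_mult[OF wA m(2)] wA]] by blast
    qed
    have odd: "w * m * w = 0" if m: "m \<in> M" "m \<in> A True" for m
    proof -
      have "(w * m * w) * x * (w * m * w) = 0" if x: "x \<in> M" "x \<in> A k" for x k
      proof (cases k)
        case True
        have "w * m * w * x * w = 0" by (rule P[OF x(1) _ m(2)]) (use x True in simp)
        then have "w * m * w * x * w * m * w = 0" by simp
        then show ?thesis by (simp only: mult.assoc)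
      next
        case False
        have "w * (m * w * x) * w = 0"
          by (rule even[OF gideal_left[OF M(1) x(1)]]) (use A_mult[OF A_mult[OF m(2) wA] x(2)] False in simp)
        then have "w * (m * w * x) * w * m * w = 0" by simp
        then show ?thesis by (simp only: mult.assoc)
      qed
      then show ?thesis
        using prime_mult_ideal[OF M A_mult[OF A_mult[OF wA m(2)] wA] A_mult[OF A_mult[OF wA m(2)] wA]] by blast
    qed
    have "w * m * w = 0" if "m \<in> M" "m \<in> A k" for m k
      using that even odd by (cases k) auto
    then show False using prime_mult_ideal[OF M wA wA] w0 by blast
  qed
  then obtain i m a where n: "m \<in> M" "m \<in> A i" "a \<in> A (\<not> i)" and wnw: "w * (m * a - a * m) * w \<noteq> 0"
    by blast
  define y where "y = m * a - a * m"
  have yM: "y \<in> M" unfolding y_def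
    by (intro submod_diff[OF gideal_submod[OF M(1)]] gideal_right[OF M(1)] gideal_left[OF M(1)] n)
  have yA: "y \<in> A True"
    using A_diff[of "m * a" True "a * m"] A_mult[OF n(2,3)] A_mult[OF n(3,2)] by (simp add: y_def)
  define \<zeta> where "\<zeta> = w * y + y * w"
  have zZ: "\<zeta> \<in> Z" using W_D[OF w n] by (simp add: \<zeta>_def y_def)
  have wyw: "w * (y * w) = \<zeta> * w" by (simp add: \<zeta>_def distrib_right mult.assoc ww')
  have z0: "\<zeta> \<noteq> 0" using wnw wyw by (auto simp: y_def[symmetric] mult.assoc)
  have wyw': "w * (y * (w * x)) = \<zeta> * (w * x)" for x
    using wyw by (metis mult.assoc)
  note zl = Z_lcomm[OF zZ]
  \<comment> \<open>For \<open>n = [y, b * w]\<close> the bracket \<open>[w, n]\<close> is again in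
    \<open>W M\<close> and squares to zero. Multiplied by \<open>w\<close> this reads
    \<open>w n w n w = 0\<close>, and \<open>w n w\<close> is \<open>\<zeta>\<close> times
    \<open>w b w\<close>.\<close>
  have wbwbw: "w * b * w * b * w = 0" if b: "b \<in> A False" for b
  proof -
    have bw: "b * w \<in> A True" using A_mult[OF b wA] by simp
    let ?n = "br True True y (b * w)"
    have "br True False w ?n \<in> W M" by (rule W_bracket[OF M(1) w yM yA bw])
    then have "(w * ?n - ?n * w) * (w * ?n - ?n * w) = 0" using iso by (simp add: br_def)
    then have "w * ((w * ?n - ?n * w) * (w * ?n - ?n * w)) = 0" by simp
    then have 1: "w * (?n * (w * (?n * w))) = 0"
      by (simp add: right_diff_distrib left_diff_distrib mult.assoc ww')
    have wnw: "w * (?n * w) = \<zeta> * (w * (b * w))"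
      by (simp add: br_def distrib_left distrib_right mult.assoc ww' wyw wyw' zl[of b] zl[of w])
    have wnx: "w * (?n * (w * x)) = \<zeta> * (w * (b * (w * x)))" for x
      using wnw by (metis mult.assoc)
    have "w * (?n * (w * (?n * w))) = \<zeta> * (w * (b * (\<zeta> * (w * (b * w)))))"
      by (subst wnx, subst wnw, rule refl)
    then have "\<zeta> * (\<zeta> * (w * (b * (w * (b * w))))) = 0"
      using 1 by (simp only: zl[of w] zl[of b])
    then have "w * (b * (w * (b * w))) = 0" using Z_regular[OF zZ z0] by blast
    then show ?thesis by (simp only: mult.assoc)
  qed
  have polar: "w * b * w * c * w = - (w * c * w * b * w)" if b: "b \<in> A False" and c: "c \<in> A False" for b c
    using wbwbw[OF A_add[OF b c]] wbwbw[OF b] wbwbw[OF c]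
    by (simp add: distrib_left distrib_right eq_neg_iff_add_eq_0 add_ac)
  \<comment> \<open>Linearizing the previous relation in \<open>b\<close> moves the two factors
    \<open>w b w\<close> next to each other, so any product with \<open>r\<close> between them
    vanishes.\<close>
  have wbw: "w * b * w = 0" if b: "b \<in> A False" for b
  proof -
    have "(w * b * w) * r * (w * b * w) = 0" for r
    proof (rule A_induct[of "\<lambda>r. (w * b * w) * r * (w * b * w) = 0"])
      fix i r assume r: "r \<in> A i"
      show "(w * b * w) * r * (w * b * w) = 0"
      proof (cases i)
        case True
        have c: "r * w * b \<in> A False" using A_mult[OF A_mult[OF r wA] b] True by simp
        have "(w * b * w) * r * (w * b * w) = w * b * w * (r * w * b) * w" by (simp only: mult.assoc)
        also have "\<dots> = - (w * (r * w * b) * w * b * w)" by (rule polar[OF b c])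
        also have "\<dots> = - (w * r * (w * b * w * b * w))" by (simp only: mult.assoc)
        finally show ?thesis using wbwbw[OF b] by simp
      next
        case False
        have "(w * b * w) * r * (w * b * w) = (w * b * w * r * w) * b * w" by (simp only: mult.assoc)
        also have "\<dots> = - (w * r * w * b * w) * b * w" using polar[OF b, of r] r False by simp
        also have "\<dots> = - (w * r * (w * b * w * b * w))" by (simp add: mult.assoc)
        finally show ?thesis using wbwbw[OF b] by simp
      qed
    qed (simp add: distrib_left distrib_right)
    then show ?thesis
      using prime_mult[OF A_mult[OF A_mult[OF wA b] wA] A_mult[OF A_mult[OF wA b] wA]] by blast
  qed
  have wbw': "w * (b * (w * x)) = 0" if "b \<in> A False" for b x
    using wbw[OF that] by (metis mult.assoc mult_zero_left)
  \<comment> \<open>Let \<open>n\<close> be the commutator of \<open>y\<close> and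
    \<open>x * w\<close>. The central element \<open>w n + n w\<close>, multiplied by
    \<open>w\<close>, equals \<open>w n w\<close>, which is minus \<open>\<zeta>\<close> times
    \<open>w x w\<close>.\<close>
  have wxw: "\<exists>z\<in>Z. \<zeta> * (w * (x * w)) = z * w" if x: "x \<in> A True" for x
  proof -
    let ?n = "y * (x * w) - x * w * y"
    have xw: "x * w \<in> A (\<not> True)" using A_mult[OF x wA] by simp
    define z where "z = w * ?n + ?n * w"
    have z: "z \<in> Z" unfolding z_def by (rule W_D[OF w yM yA xw])
    have "z * w = w * ?n * w" by (simp add: z_def distrib_right mult.assoc ww)
    also have "\<dots> = - (\<zeta> * (w * (x * w)))"
      by (simp add: right_diff_distrib left_diff_distrib mult.assoc ww wyw zl[of x] zl[of w])
    finally have "\<zeta> * (w * (x * w)) = (- z) * w" by simp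
    then show ?thesis using Z_minus[OF z] by blast
  qed
  define p where "p = y * (w * y)"
  have pA: "p \<in> A True" using A_mult[OF yA A_mult[OF wA yA]] by (simp add: p_def)
  have yy: "y * y \<in> A False" using A_mult[OF yA yA] by simp
  have pp: "p * p = 0"
    using wbw'[OF yy, of y] by (simp add: p_def mult.assoc)
  have wp: "w * p + p * w = \<zeta> * \<zeta>"
    by (simp add: p_def mult.assoc wyw wyw' zl[of y] distrib_left[symmetric]) (simp add: \<zeta>_def)
  have pW: "p \<in> W M"
  proof (rule W_I)
    show "p \<in> A1" using pA by simp
    fix i m a assume m: "m \<in> M" "m \<in> A i" and a: "a \<in> A (\<not> i)"
    define x where "x = br i (\<not> i) m a"
    have x: "x \<in> A True" using br_A[OF m(2) a] by (simp add: x_def)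
    have yx: "y * x \<in> A False" "x * y \<in> A False" using A_mult[OF yA x] A_mult[OF x yA] by simp_all
    obtain z1 where z1: "z1 \<in> Z" "\<zeta> * (w * (y * x * y * w)) = z1 * w"
      using wxw[of "y * x * y"] A_mult[OF A_mult[OF yA x] yA] by auto
    obtain z2 where z2: "z2 \<in> Z" "\<zeta> * (w * (x * w)) = z2 * w" using wxw[OF x] by blast
    \<comment> \<open>Both factors \<open>\<zeta>\<close> are expanded. The terms with the even
      elements \<open>y * x\<close> or \<open>x * y\<close> between two \<open>w\<close> vanish, so
      up to a central factor \<open>x\<close> is a central combination of \<open>w\<close> and
      \<open>p\<close>, and the anticommutators of these with \<open>p\<close> are central.\<close>
    have "\<zeta> * x * \<zeta> = w * (y * x * (w * y)) + w * (y * x * y * w) + y * (w * (x * w)) * y + y * (w * (x * y * w))"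
      by (simp add: \<zeta>_def distrib_left distrib_right mult.assoc add_ac)
    also have "w * (y * x * (w * y)) = 0" by (rule wbw'[OF yx(1)])
    also have "w * (x * y * w) = 0" using wbw[OF yx(2)] by (simp add: mult.assoc)
    finally have "\<zeta> * (\<zeta> * x * \<zeta>) = \<zeta> * (w * (y * x * y * w)) + y * (\<zeta> * (w * (x * w))) * y"
      by (simp add: distrib_left zl[of y] mult.assoc)
    also have "\<dots> = z1 * w + z2 * p"
      unfolding z1(2) z2(2) by (simp add: p_def mult.assoc Z_lcomm[OF z2(1), of y])
    finally have X: "\<zeta> * (\<zeta> * x * \<zeta>) = z1 * w + z2 * p" .
    have "p * (\<zeta> * (\<zeta> * x * \<zeta>)) = \<zeta> * \<zeta> * \<zeta> * (p * x)"
      by (simp only: mult.assoc Z_comm[OF zZ, of x] zl[of p])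
    moreover have "\<zeta> * (\<zeta> * x * \<zeta>) * p = \<zeta> * \<zeta> * \<zeta> * (x * p)"
      by (simp only: mult.assoc zl[of x])
    ultimately have "\<zeta> * \<zeta> * \<zeta> * (p * x + x * p) = p * (\<zeta> * (\<zeta> * x * \<zeta>)) + \<zeta> * (\<zeta> * x * \<zeta>) * p"
      by (simp only: distrib_left)
    also have "\<dots> = z1 * (w * p + p * w)"
      unfolding X
      by (simp add: distrib_left distrib_right mult.assoc pp Z_lcomm[OF z1(1), of p] Z_lcomm[OF z2(1), of p] add_ac)
    also have "\<dots> = z1 * (\<zeta> * \<zeta>)" by (simp only: wp)
    finally have mem: "\<zeta> * \<zeta> * \<zeta> * (p * x + x * p) \<in> Z"
      using Z_mult[OF z1(1) Z_mult[OF zZ zZ]] by simp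
    have zzz: "\<zeta> * \<zeta> * \<zeta> \<in> Z" by (intro Z_mult zZ)
    have zzz0: "\<zeta> * \<zeta> * \<zeta> \<noteq> 0"
      by (rule Z_mult_nonzero[OF Z_mult[OF zZ zZ] Z_mult_nonzero[OF zZ z0 z0] z0])
    have "p * x + x * p \<in> A0"
      using A_add[of "p * x" False "x * p"] A_mult[OF pA x] A_mult[OF x pA] by simp
    then have "p * x + x * p \<in> Z" using mem by (rule Z_divide[OF zzz zzz0])
    moreover have "br True True p x = p * x + x * p" by (simp add: br_def)
    ultimately show "br True True p (br i (\<not> i) m a) \<in> Z" unfolding x_def[symmetric] by (simp only:)
  qed
  have "(w + p) * (w + p) = 0" by (rule iso[OF W_add[OF w pW]])
  then have "\<zeta> * \<zeta> = 0" using wp by (simp add: distrib_left distrib_right ww pp add_ac)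
  then show False using Z_mult_nonzero[OF zZ z0 z0] by simp
qed

section \<open>Clifford generators from an exceptional odd element with nonzero square\<close>

lemma center_localization: "Z \<noteq> {0} \<Longrightarrow> central_localization Z"
  by (rule central_localization.intro)
    (erule (1) Z_add, erule (1) Z_mult, erule Z_minus, rule Z_zero, erule Z_comm, erule (2) Z_regular)

lemma double_cancel: "(u::'a) + u = v + v \<Longrightarrow> u = v"
  using double_eq_zero[of "u - v"] by (simp add: algebra_simps)

lemma central_order_criterion:
  assumes Z0: "Z \<noteq> {0}"
    and e: "\<And>i. i < n \<Longrightarrow> e i \<in> A1" "\<And>i. i < n \<Longrightarrow> e i * e i \<in> Z" "\<And>i. i < n \<Longrightarrow> e i * e i \<noteq> 0"
    and anti: "\<And>i j. i < n \<Longrightarrow> j < n \<Longrightarrow> i \<noteq> j \<Longrightarrow> e i * e j = - (e j * e i)"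
    and gen: "\<And>x. \<exists>z\<in>Z - {0}. z * x \<in> central_localization.gen Z (e ` {..<n})"
  shows "central_order_in_Clifford A0 A1 n"
proof -
  interpret Z: central_localization Z
    by (rule center_localization[OF Z0])
  show ?thesis
    unfolding central_order_in_Clifford_def center_field_def Let_def
  proof (rule conjI[OF Z0], rule Z.Clifford_criterion[where e = e])
    show "0 \<in> A0" "0 \<in> A1" using A_zero[of False] A_zero[of True] by simp_all
    show "x + y \<in> A0" if "x \<in> A0" "y \<in> A0" for x y using A_add[of x False y] that by simp
    show "x + y \<in> A1" if "x \<in> A1" "y \<in> A1" for x y using A_add[of x True y] that by simp
    show "e i * e i \<in> Z - {0}" if "i < n" for i using e that by blast
    show "A0 \<inter> A1 = {0}" by (rule A0_inter_A1)
    show "Z \<subseteq> A0" using Z_A0 by blast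
    show "\<exists>z\<in>Z - {0}. z * x \<in> Z.gen (e ` {..<n})" for x by (rule gen)
    show "e i \<in> A1" if "i < n" for i using that by (rule e(1))
    show "e i * e j = - (e j * e i)" if "i < n" "j < n" "i \<noteq> j" for i j using that by (rule anti)
    show "x = 0" if "x + x = 0" for x :: 'a using that by (rule double_eq_zero)
    show "x * y \<in> A0" if "x \<in> A0" "y \<in> A0" for x y using that by (rule A0_A0)
    show "x * y \<in> A1" if "x \<in> A0" "y \<in> A1" for x y using that by (rule A0_A1)
    show "x * y \<in> A1" if "x \<in> A1" "y \<in> A0" for x y using that by (rule A1_A0)
    show "x * y \<in> A0" if "x \<in> A1" "y \<in> A1" for x y using that by (rule A1_A1)
  qed
qed

lemma nonisotropic_central_order:
  assumes M: "gideal M" "M \<noteq> {0}" and w: "w \<in> W M" and ww0: "w * w \<noteq> 0"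
  shows "\<exists>n\<in>{1, 2, 3}. central_order_in_Clifford A0 A1 n"
proof -
  define s where "s = w * w"
  have wA: "w \<in> A True" by (rule W_A1[OF w])
  have sZ: "s \<in> Z" using W_square[OF M w] by (simp add: s_def)
  have s0: "s \<noteq> 0" using ww0 by (simp add: s_def)
  have Z0: "Z \<noteq> {0}" using sZ s0 by blast
  interpret Z: central_localization Z
    by (rule center_localization[OF Z0])
  note sl = Z_lcomm[OF sZ]
  have ww: "w * (w * x) = s * x" for x by (simp add: s_def mult.assoc)
  define C where "C = {x \<in> A0. x * w = w * x}"
  define C' where "C' = {x \<in> A0. x * w = - (w * x)}"
  have CA: "x \<in> A False" if "x \<in> C" for x using that by (simp add: C_def)
  have CA': "x \<in> A False" if "x \<in> C'" for x using that by (simp add: C'_def)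
  have Cw: "x * w = w * x" "x * (w * y) = w * (x * y)" if "x \<in> C" for x y
    using that mult_eq_assoc[of x w "w * x" y] by (simp_all add: C_def mult.assoc)
  have Cw': "x * w = - (w * x)" "x * (w * y) = - (w * (x * y))" if "x \<in> C'" for x y
    using that mult_eq_assoc[of x w "- (w * x)" y] by (simp_all add: C'_def mult.assoc)
  have CI: "x \<in> C" if "x \<in> A False" "x * w = w * x" for x using that by (simp add: C_def)
  have CI': "x \<in> C'" if "x \<in> A False" "x * w = - (w * x)" for x using that by (simp add: C'_def)
  have prod: "x * y \<in> C" if "x \<in> C" "y \<in> C" for x y
    by (rule CI) (use A_mult[OF CA CA] that in \<open>auto simp: mult.assoc Cw\<close>)
  have prod1': "x * y \<in> C'" if "x \<in> C'" "y \<in> C" for x y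
    by (rule CI') (use A_mult[OF CA' CA] that in \<open>auto simp: mult.assoc Cw Cw'\<close>)
  have prod2: "x * y \<in> C" if "x \<in> C'" "y \<in> C'" for x y
    by (rule CI) (use A_mult[OF CA' CA'] that in \<open>auto simp: mult.assoc Cw'\<close>)
  have C_diff: "x - y \<in> C" "x + y \<in> C" if "x \<in> C" "y \<in> C" for x y
    using A_diff[OF CA CA, of x y] A_add[OF CA CA, of x y] that by (auto simp: C_def algebra_simps)
  have ZC: "z \<in> C" if "z \<in> Z" for z
    using Z_A0[OF that] Z_comm[OF that, of w] by (simp add: C_def)
  \<comment> \<open>The inverse of \<open>w\<close> is \<open>w\<close> divided by \<open>s\<close>,
    so these are the projections of \<open>x\<close> to the two eigenspaces of conjugation by
    \<open>w\<close>, multiplied by \<open>2 s\<close>.\<close>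
  have s_decomp: "s * x + w * x * w \<in> C" "s * x - w * x * w \<in> C'"
    "(s * x + w * x * w) + (s * x - w * x * w) = s * (x + x)" if x: "x \<in> A False" for x
  proof -
    have "s * x \<in> A False" "w * x * w \<in> A False"
      using A_mult[of s False x False] A_mult[OF A_mult[OF wA x] wA] Z_A0[OF sZ] x by simp_all
    then have c: "s * x + w * x * w \<in> A False" "s * x - w * x * w \<in> A False"
      using A_add A_diff by blast+
    have wxs: "w * (x * (w * w)) = s * (w * x)"
      using Z_comm[OF sZ, of "w * x"] by (simp add: s_def mult.assoc)
    have wsx: "w * (s * x) = s * (w * x)" by (rule sl)
    show "s * x + w * x * w \<in> C"
      by (rule CI[OF c(1)]) (simp add: distrib_left distrib_right mult.assoc wxs wsx ww add.commute)
    show "s * x - w * x * w \<in> C'"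
      by (rule CI'[OF c(2)]) (simp add: right_diff_distrib left_diff_distrib mult.assoc wxs wsx ww)
    show "(s * x + w * x * w) + (s * x - w * x * w) = s * (x + x)" by (simp add: distrib_left)
  qed
  \<comment> \<open>For \<open>x\<close> commuting with \<open>w\<close> the anticommutator of
    \<open>w\<close> and \<open>w * x\<close> is \<open>2 s x\<close>, and both factors can be
    divided out of the center.\<close>
  have CC_Z: "x \<in> Z" if x: "x \<in> C" and wx: "w * (w * x) + w * x * w \<in> Z" for x
  proof -
    have "w * (w * x) + w * x * w = s * x + s * x" using Cw[OF x] by (simp add: mult.assoc ww)
    then have "s * x + s * x \<in> Z" using wx by (simp only:)
    then have sx: "s * x \<in> Z" by (rule Z_half)
    have "x \<in> A0" using CA[OF x] by simp
    then show ?thesis using sx by (rule Z_divide[OF sZ s0])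
  qed
  \<comment> \<open>The defining condition of \<open>W M\<close> for \<open>a\<close> and
    \<open>w * c\<close> concerns \<open>w\<close> times the commutator of \<open>a\<close> and
    \<open>c\<close>; by \<open>CC_Z\<close> that commutator is central.\<close>
  have F1: "a * b = b * a" if a: "a \<in> M" "a \<in> C" and b: "b \<in> C" for a b
  proof -
    have key: "a * c - c * a \<in> Z" if c: "c \<in> C" for c
    proof (rule CC_Z)
      show "a * c - c * a \<in> C" by (rule C_diff(1)[OF prod[OF a(2) c] prod[OF c a(2)]])
      have "w * (a * (w * c) - w * c * a) + (a * (w * c) - w * c * a) * w \<in> Z"
        by (rule W_D[OF w a(1) CA[OF a(2)]]) (use A_mult[OF wA CA[OF c]] in simp)
      moreover have "a * (w * c) - w * c * a = w * (a * c - c * a)"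
        using Cw[OF a(2)] by (simp add: right_diff_distrib mult.assoc)
      ultimately show "w * (w * (a * c - c * a)) + w * (a * c - c * a) * w \<in> Z" by simp
    qed
    \<comment> \<open>The commutator of \<open>a\<close> with \<open>a * b\<close> is
      \<open>z * a\<close> and is central as well. Hence either \<open>z = 0\<close> or
      \<open>a\<close> is central, and in both cases \<open>a\<close> and \<open>b\<close>
      commute.\<close>
    let ?z = "a * b - b * a"
    have "a * (a * b) - a * b * a = ?z * a"
      using Z_comm[OF key[OF b], of a] by (simp add: algebra_simps)
    then have za: "?z * a \<in> Z" using key[OF prod[OF a(2) b]] by simp
    show ?thesis
    proof (cases "?z = 0")
      case False
      then have "a \<in> Z" using Z_divide[OF key[OF b] _ _ za] CA[OF a(2)] by simp
      then show ?thesis using Z_comm by metis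
    qed simp
  qed
  \<comment> \<open>The same device as in \<open>F1\<close>; as \<open>a\<close> now anticommutes
    with \<open>w\<close>, pulling \<open>w\<close> out turns the commutator into an
    anticommutator.\<close>
  have F2: "a * b + b * a \<in> Z" if a: "a \<in> M" "a \<in> C'" and b: "b \<in> C'" for a b
  proof (rule CC_Z)
    show c: "a * b + b * a \<in> C" by (rule C_diff(2)[OF prod2[OF a(2) b] prod2[OF b a(2)]])
    have "w * (a * (w * b) - w * b * a) + (a * (w * b) - w * b * a) * w \<in> Z"
      by (rule W_D[OF w a(1) CA'[OF a(2)]]) (use A_mult[OF wA CA'[OF b]] in simp)
    moreover have "a * (w * b) - w * b * a = - (w * (a * b + b * a))"
      using Cw'[OF a(2)] by (simp add: distrib_left mult.assoc)
    ultimately have "- (w * (w * (a * b + b * a)) + w * (a * b + b * a) * w) \<in> Z" by simp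
    from Z_minus[OF this] show "w * (w * (a * b + b * a)) + w * (a * b + b * a) * w \<in> Z"
      by (simp only: minus_minus)
  qed
  have A1_w: "w * x \<in> A False" "w * (w * x) = s * x" if "x \<in> A True" for x
    using A_mult[OF wA that] ww by simp_all
  show ?thesis
  proof (cases "\<exists>a\<in>M \<inter> C'. a * a \<noteq> 0")
    case False
    then have sq0: "a * a = 0" if "a \<in> M" "a \<in> C'" for a using that by blast
    \<comment> \<open>If all squares vanish, elements of \<open>M\<close> in \<open>C'\<close>
      anticommute with each other. This forces \<open>a x a = 0\<close> for all homogeneous
      \<open>x\<close> in \<open>M\<close>, so \<open>a = 0\<close> by primeness.\<close>
    have C'0: "a = 0" if a: "a \<in> M" "a \<in> C'" for a
    proof -
      have anti: "a * b = - (b * a)" if b: "b \<in> M" "b \<in> C'" for b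
      proof -
        have "a + b \<in> C'" using a b A_add[OF CA' CA', of a b] by (auto simp: C'_def distrib_left distrib_right)
        then have "(a + b) * (a + b) = 0" using submod_add[OF gideal_submod[OF M(1)] a(1) b(1)] sq0 by blast
        then show ?thesis
          using sq0[OF a] sq0[OF b] by (simp add: distrib_left distrib_right eq_neg_iff_add_eq_0 add.commute)
      qed
      have aa: "a * a = 0" "a * (a * y) = 0" for y using sq0[OF a] mult_eq_assoc[of a a 0 y] by simp_all
      have even: "a * x * a = 0" if x: "x \<in> M" "x \<in> A False" for x
      proof -
        let ?c = "s * x + w * x * w" and ?b = "s * x - w * x * w"
        have m: "?b \<in> M"
          by (intro submod_diff[OF gideal_submod[OF M(1)]] gideal_left[OF M(1)] gideal_right[OF M(1)] x)
        have "a * ?b = - (?b * a)" by (rule anti[OF m s_decomp(2)[OF x(2)]])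
        then have b: "a * ?b * a = 0" using aa(1) by (simp add: mult.assoc)
        \<comment> \<open>For the part \<open>?c\<close> in \<open>C\<close> the relation is applied
          to \<open>a * ?c\<close>, which lies in \<open>C'\<close> again; the left side is zero
          since \<open>a * a = 0\<close>.\<close>
        have "a * (a * ?c) = - (a * ?c * a)"
          by (rule anti[OF gideal_right[OF M(1) a(1)] prod1'[OF a(2) s_decomp(1)[OF x(2)]]])
        then have c: "a * ?c * a = 0" unfolding aa(2) by simp
        have "a * (?c + ?b) * a = a * ?c * a + a * ?b * a" by (simp only: distrib_left distrib_right)
        then have "a * (?c + ?b) * a = 0" unfolding b c by simp
        then have "s * (a * x * a) + s * (a * x * a) = 0"
          unfolding s_decomp(3)[OF x(2)] by (simp add: distrib_left distrib_right mult.assoc sl[of a])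
        then have "s * (a * x * a) = 0" by (rule double_eq_zero)
        then show ?thesis by (rule Z_regular[OF sZ s0])
      qed
      have "a * x * a = 0" if x: "x \<in> M" "x \<in> A k" for x k
      proof (cases k)
        case False then show ?thesis using even x by simp
      next
        case True
        have "a * (w * x) * a = 0"
          by (rule even[OF gideal_left[OF M(1) x(1)]]) (use A1_w x True in simp)
        then have "w * (w * (a * x * a)) = 0" using Cw'[OF a(2)] by (simp add: mult.assoc)
        then show ?thesis unfolding ww by (rule Z_regular[OF sZ s0])
      qed
      then show ?thesis using prime_mult_ideal[OF M CA'[OF a(2)] CA'[OF a(2)]] by blast
    qed
    have MC0: "x \<in> C" if x: "x \<in> M" "x \<in> A False" for x
    proof (rule CI[OF x(2)])
      have "s * x - w * x * w \<in> M"
        by (intro submod_diff[OF gideal_submod[OF M(1)]] gideal_left[OF M(1)] gideal_right[OF M(1)] x)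
      then have "s * x = w * x * w" using C'0[OF _ s_decomp(2)[OF x(2)]] by simp
      then have "w * (s * x) = s * (x * w)" by (simp add: mult.assoc ww)
      then have "s * (x * w) = s * (w * x)" by (simp add: sl[of w])
      then show "x * w = w * x" by (rule Z_cancel[OF sZ s0])
    qed
    have Mw: "x * w = w * x" if x: "x \<in> M" "x \<in> A k" for x k
    proof (cases k)
      case False then show ?thesis using Cw(1)[OF MC0] x by simp
    next
      case True
      have wxC: "w * x \<in> C" using MC0[OF gideal_left[OF M(1) x(1)]] A1_w x True by simp
      have "w * (x * w) = w * (w * x)" using Cw(1)[OF wxC] by (simp only: mult.assoc)
      then have "w * (w * (x * w)) = w * (w * (w * x))" by simp
      then show ?thesis unfolding ww sl[of w] by (rule Z_cancel[OF sZ s0])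
    qed
    have w_central: "x * w = w * x" if x: "x \<in> A k" for x k
    proof (rule ccontr)
      assume "x * w \<noteq> w * x"
      then have 0: "x * w - w * x \<noteq> 0" by simp
      have A: "x * w - w * x \<in> A (\<not> k)"
        using A_diff[of "x * w" "\<not> k"] A_mult[OF x wA] A_mult[OF wA x] by simp
      obtain l m where m: "m \<in> M" "m \<in> A l" "(x * w - w * x) * m \<noteq> 0" using ideal_mult_nonzero[OF M A 0] .
      have "x * m * w = w * (x * m)" by (rule Mw[OF gideal_left[OF M(1) m(1)] A_mult[OF x m(2)]])
      then show False using m(3) Mw[OF m(1,2)] by (simp add: left_diff_distrib mult.assoc)
    qed
    have M0Z: "x \<in> Z" if x: "x \<in> M" "x \<in> A False" for x
    proof (rule centerI)
      show "x \<in> A0" using x by simp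
      have ev: "x * y = y * x" if y: "y \<in> A False" for y
        by (rule F1[OF x(1) MC0[OF x] CI[OF y w_central[OF y]]])
      fix k y assume y: "y \<in> A k"
      show "ad x y = 0"
      proof (cases k)
        case False then show ?thesis using ev y by (simp add: ad_def)
      next
        case True
        have "x * (w * y) = w * y * x" by (rule ev) (use A1_w y True in simp)
        then have "w * (x * y) = w * (y * x)" using Cw(2)[OF MC0[OF x]] by (simp add: mult.assoc)
        then have "w * (w * (x * y)) = w * (w * (y * x))" by simp
        then have "x * y = y * x" unfolding ww by (rule Z_cancel[OF sZ s0])
        then show ?thesis by (simp add: ad_def)
      qed
    qed
    \<comment> \<open>A nonzero central element of \<open>M\<close> transports centrality from the
      even part of \<open>M\<close> to all of \<open>A0\<close>. If only an odd element of
      \<open>M\<close> is at hand, multiplication by \<open>w\<close> makes it even.\<close>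
    obtain z where z: "z \<in> M" "z \<in> Z" "z \<noteq> 0"
    proof -
      obtain k x where x: "x \<in> M" "x \<in> A k" "x \<noteq> 0" using gideal_homogeneous[OF M] .
      show ?thesis
      proof (cases k)
        case False then show ?thesis using that[OF x(1) M0Z[OF x(1)]] x by simp
      next
        case True
        have wx: "w * x \<in> M" "w * x \<in> A False" using gideal_left[OF M(1) x(1)] A1_w x True by simp_all
        have "w * x \<noteq> 0" using A1_w(2)[of x] x True Z_mult_nonzero[OF sZ s0 x(3)] by auto
        then show ?thesis using that[OF wx(1) M0Z[OF wx]] by simp
      qed
    qed
    have A0Z: "x \<in> Z" if x: "x \<in> A False" for x
    proof (rule Z_divide[OF z(2,3)])
      show "x \<in> A0" using x by simp
      show "z * x \<in> Z"
        by (rule M0Z[OF gideal_right[OF M(1) z(1)]]) (use A_mult[of z False x False] Z_A0[OF z(2)] x in simp)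
    qed
    have "central_order_in_Clifford A0 A1 1"
    proof (rule central_order_criterion[OF Z0, where e = "\<lambda>_. w"])
      fix x
      obtain x0 x1 where x: "x0 \<in> A0" "x1 \<in> A1" "x = x0 + x1" by (rule A_decomp)
      have "s * x = s * x0 + w * (w * x1)" using x by (simp add: distrib_left ww)
      moreover have "s * x0 \<in> Z" "w * x1 \<in> Z" using Z_mult[OF sZ A0Z] A0Z[OF A1_w(1)] x by simp_all
      moreover have "w \<in> (\<lambda>_. w) ` {..<1::nat}" by auto
      ultimately have "s * x \<in> Z.gen ((\<lambda>_. w) ` {..<1::nat})"
        using Z.gen.intros(3)[OF Z.gen.intros(1) Z.gen.intros(5)[OF Z.gen.intros(2) Z.gen.intros(1)]] by metis
      then show "\<exists>z\<in>Z - {0}. z * x \<in> Z.gen ((\<lambda>_. w) ` {..<1::nat})" using sZ s0 by blast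
    qed (use wA sZ s0 in \<open>auto simp: s_def\<close>)
    then show ?thesis by blast
  next
    case True
    then obtain a where aM: "a \<in> M" and a: "a \<in> C'" and aa0: "a * a \<noteq> 0" by blast
    define \<alpha> where "\<alpha> = a * a"
    have \<alpha>Z: "\<alpha> \<in> Z" using Z_half[OF F2[OF aM a a]] by (simp only: \<alpha>_def)
    have \<alpha>0: "\<alpha> \<noteq> 0" using aa0 by (simp add: \<alpha>_def)
    have \<alpha>M: "\<alpha> \<in> M" unfolding \<alpha>_def by (rule gideal_left[OF M(1) aM])
    note \<alpha>l = Z_lcomm[OF \<alpha>Z]
    have aA: "a \<in> A False" by (rule CA'[OF a])
    have aa: "a * (a * x) = \<alpha> * x" for x by (simp add: \<alpha>_def mult.assoc)
    note aw = Cw'[OF a]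
    \<comment> \<open>\<open>F1\<close> needs one factor in \<open>M\<close>. The central square
      \<open>\<alpha>\<close> lies in \<open>M\<close>, so \<open>\<alpha> * b\<close> qualifies and
      \<open>\<alpha>\<close> cancels afterwards.\<close>
    have comm: "b * c = c * b" if b: "b \<in> C" and c: "c \<in> C" for b c
    proof -
      have "\<alpha> * b * c = c * (\<alpha> * b)"
        by (rule F1[OF gideal_right[OF M(1) \<alpha>M] prod[OF ZC[OF \<alpha>Z] b] c])
      then have "\<alpha> * (b * c) = \<alpha> * (c * b)" by (simp only: mult.assoc \<alpha>l[of c])
      then show ?thesis by (rule Z_cancel[OF \<alpha>Z \<alpha>0])
    qed
    define E where "E = {f \<in> C. f * a = - (a * f)}"
    have EC: "f \<in> C" and Ea: "f * a = - (a * f)" and Ea': "f * (a * x) = - (a * (f * x))" if "f \<in> E" for f x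
      using that mult_eq_assoc[of f a "- (a * f)" x] by (simp_all add: E_def mult.assoc)
    \<comment> \<open>The same eigenprojections, now for conjugation by \<open>a\<close> acting on
      \<open>C\<close>. The commuting one is the anticommutator of \<open>a\<close> with
      \<open>a * c\<close>, hence central by \<open>F2\<close>.\<close>
    have C_decomp: "\<alpha> * c + a * c * a \<in> Z" "\<alpha> * c - a * c * a \<in> E"
      "(\<alpha> * c + a * c * a) + (\<alpha> * c - a * c * a) = \<alpha> * (c + c)" if c: "c \<in> C" for c
    proof -
      have "a * (a * c) + a * c * a \<in> Z" by (rule F2[OF aM a prod1'[OF a c]])
      then show "\<alpha> * c + a * c * a \<in> Z" by (simp add: aa)
      have mem: "\<alpha> * c - a * c * a \<in> C"
        by (rule C_diff(1)[OF prod[OF ZC[OF \<alpha>Z] c] prod2[OF prod1'[OF a c] a]])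
      have aca: "a * (c * (a * a)) = \<alpha> * (a * c)"
        using Z_comm[OF \<alpha>Z, of "a * c"] by (simp add: \<alpha>_def mult.assoc)
      show "\<alpha> * c - a * c * a \<in> E"
        using mem by (simp add: E_def right_diff_distrib left_diff_distrib mult.assoc aca aa \<alpha>l[of a])
      show "(\<alpha> * c + a * c * a) + (\<alpha> * c - a * c * a) = \<alpha> * (c + c)" by (simp add: distrib_left)
    qed
    \<comment> \<open>A central multiplier that works for \<open>C\<close> is enough:
      \<open>\<alpha> b = a (a b)\<close> with \<open>a b\<close> in \<open>C\<close> reaches
      \<open>C'\<close>, and \<open>s x = w (w x)\<close> reaches the odd part.\<close>
    have span: "\<exists>z\<in>Z - {0}. z * x \<in> Z.gen B"
      if wB: "w \<in> B" and sa: "s * a \<in> Z.gen B" and z0: "z0 \<in> Z" "z0 \<noteq> 0"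
        and C: "\<And>c. c \<in> C \<Longrightarrow> z0 * c \<in> Z.gen B" for B z0 x
    proof -
      have C': "s * \<alpha> * z0 * b \<in> Z.gen B" if b: "b \<in> C'" for b
      proof -
        have "s * a * (z0 * (a * b)) \<in> Z.gen B"
          by (rule Z.gen.intros(5)[OF sa C[OF prod2[OF a b]]])
        moreover have "s * a * (z0 * (a * b)) = s * \<alpha> * z0 * b"
          by (simp only: mult.assoc Z_lcomm[OF z0(1), of a] aa Z_lcomm[OF z0(1), of \<alpha>])
        ultimately show ?thesis by simp
      qed
      let ?z = "s * \<alpha> * z0"
      have zZ: "?z \<in> Z" by (intro Z_mult sZ \<alpha>Z z0)
      have znz: "?z \<noteq> 0"
        using Z_mult_nonzero[OF Z_mult[OF sZ \<alpha>Z] Z_mult_nonzero[OF sZ s0 \<alpha>0] z0(2)] .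
      have even: "?z * (s * (x + x)) \<in> Z.gen B" if x: "x \<in> A False" for x
      proof -
        let ?c = "s * x + w * x * w" and ?b = "s * x - w * x * w"
        have "s * \<alpha> * (z0 * ?c) \<in> Z.gen B"
          by (intro Z.gen.intros(5) Z.gen.intros(1) sZ \<alpha>Z C s_decomp(1)[OF x])
        then have "?z * ?c \<in> Z.gen B" by (simp only: mult.assoc)
        moreover have "?z * ?b \<in> Z.gen B" by (rule C'[OF s_decomp(2)[OF x]])
        ultimately have "?z * ?c + ?z * ?b \<in> Z.gen B" by (rule Z.gen.intros(3))
        then show ?thesis by (simp only: distrib_left[symmetric] s_decomp(3)[OF x])
      qed
      obtain x0 x1 where x: "x0 \<in> A0" "x1 \<in> A1" "x = x0 + x1" by (rule A_decomp)
      have 0: "s * (?z * (s * (x0 + x0))) \<in> Z.gen B"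
        by (rule Z.gen.intros(5)[OF Z.gen.intros(1)[OF sZ] even]) (use x in simp)
      have "w * (?z * (s * (w * x1 + w * x1))) \<in> Z.gen B"
        by (rule Z.gen.intros(5)[OF Z.gen.intros(2)[OF wB] even]) (use A1_w x in simp)
      also have "w * (?z * (s * (w * x1 + w * x1))) = s * (?z * (s * (x1 + x1)))"
      proof -
        have "w * (?z * (s * (w * (x1 + x1)))) = ?z * (s * (s * (x1 + x1)))"
          by (simp only: Z_lcomm[OF zZ, of w] sl[of w] ww)
        also have "\<dots> = s * (?z * (s * (x1 + x1)))" by (rule sl)
        finally show ?thesis by (simp only: distrib_left)
      qed
      finally have "s * (?z * (s * (x0 + x0))) + s * (?z * (s * (x1 + x1))) \<in> Z.gen B"
        by (rule Z.gen.intros(3)[OF 0])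
      also have "s * (?z * (s * (x0 + x0))) + s * (?z * (s * (x1 + x1))) = (s * ?z * s + s * ?z * s) * x"
        by (simp add: x(3) distrib_left distrib_right mult.assoc add_ac)
      finally have "(s * ?z * s + s * ?z * s) * x \<in> Z.gen B" .
      moreover have "s * ?z * s + s * ?z * s \<in> Z" by (intro Z_add Z_mult sZ zZ)
      moreover have "s * ?z * s \<noteq> 0"
        using Z_mult_nonzero[OF Z_mult[OF sZ zZ] Z_mult_nonzero[OF sZ s0 znz] s0] .
      then have "s * ?z * s + s * ?z * s \<noteq> 0" using double_eq_zero by blast
      ultimately show ?thesis by blast
    qed
    have saw: "w * (w * a) = s * a" by (rule ww)
    have \<alpha>2: "\<alpha> + \<alpha> \<in> Z" "\<alpha> + \<alpha> \<noteq> 0" using Z_add[OF \<alpha>Z \<alpha>Z] double_eq_zero[of \<alpha>] \<alpha>0 by blast+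
    have waA: "w * a \<in> A True" using A_mult[OF wA aA] by simp
    have wawa: "w * a * (w * a) = - (s * \<alpha>)"
      by (simp add: mult.assoc aw ww \<alpha>_def)
    have waw: "w * (w * a) = - (w * a * w)" by (simp add: mult.assoc aw)
    have s\<alpha>: "s * \<alpha> \<in> Z" "s * \<alpha> \<noteq> 0" using Z_mult[OF sZ \<alpha>Z] Z_mult_nonzero[OF sZ s0 \<alpha>0] by auto
    show ?thesis
    proof (cases "E \<subseteq> {0}")
      case True
      let ?e = "\<lambda>i::nat. if i = 0 then w else w * a"
      have img: "?e ` {..<2} = {w, w * a}"
      proof -
        have "{..<2::nat} = {0, 1}" by auto
        then show ?thesis by auto
      qed
      have "central_order_in_Clifford A0 A1 2"
      proof (rule central_order_criterion[OF Z0, where e = ?e])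
        fix x
        \<comment> \<open>With \<open>E\<close> trivial the anticommuting projection of
          \<open>c\<close> is zero, so twice \<open>\<alpha> * c\<close> equals the commuting
          projection and is central.\<close>
        have "(\<alpha> + \<alpha>) * c \<in> Z.gen {w, w * a}" if "c \<in> C" for c
        proof -
          have "\<alpha> * c - a * c * a = 0" using C_decomp(2)[OF that] True by blast
          then have "\<alpha> * (c + c) \<in> Z" using C_decomp(1,3)[OF that] by simp
          then show ?thesis by (simp add: distrib_left distrib_right Z.gen.intros(1))
        qed
        moreover have "s * a \<in> Z.gen {w, w * a}"
          unfolding saw[symmetric] by (intro Z.gen.intros(5) Z.gen.intros(2)) auto
        ultimately show "\<exists>z\<in>Z - {0}. z * x \<in> Z.gen (?e ` {..<2})"
          unfolding img by (intro span[OF _ _ \<alpha>2]) auto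
      qed (use wA waA sZ s0 wawa waw Z_minus[OF s\<alpha>(1)] s\<alpha>(2) in \<open>auto simp: s_def[symmetric]\<close>)
      then show ?thesis by blast
    next
      case False
      then obtain f0 where f0: "f0 \<in> E" "f0 \<noteq> 0" by blast
      \<comment> \<open>The product commutes with \<open>a\<close>, since both factors anticommute
        with it, and with the commutative \<open>C\<close>. Multiplication by \<open>a\<close>
        carries \<open>C'\<close> into \<open>C\<close> and multiplication by \<open>w\<close>
        carries the odd part to the even one, so it commutes with everything.\<close>
      have EE: "f * g \<in> Z" if f: "f \<in> E" and g: "g \<in> E" for f g
      proof (rule centerI)
        have fgC: "f * g \<in> C" by (rule prod[OF EC[OF f] EC[OF g]])
        show "f * g \<in> A0" using CA[OF fgC] by simp
        have fga: "f * g * (a * x) = a * (f * g * x)" for x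
          by (simp add: mult.assoc Ea'[OF f] Ea'[OF g])
        have fgC': "f * g * b = b * (f * g)" if b: "b \<in> C'" for b
        proof -
          have "a * b * (f * g) = f * g * (a * b)" by (rule comm[OF prod2[OF a b] fgC])
          then have "a * (f * g * b) = a * (b * (f * g))" unfolding fga by (simp only: mult.assoc)
          then have "a * (a * (f * g * b)) = a * (a * (b * (f * g)))" by simp
          then show ?thesis unfolding aa by (rule Z_cancel[OF \<alpha>Z \<alpha>0])
        qed
        have ev: "f * g * x = x * (f * g)" if x: "x \<in> A False" for x
        proof -
          have "f * g * (s * (x + x)) = s * (x + x) * (f * g)"
            unfolding s_decomp(3)[OF x, symmetric]
            using comm[OF fgC s_decomp(1)[OF x]] fgC'[OF s_decomp(2)[OF x]]
            by (simp only: distrib_left distrib_right)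
          then have "s * (f * g * (x + x)) = s * ((x + x) * (f * g))" by (simp only: mult.assoc sl[of f] sl[of g])
          then have "f * g * (x + x) = (x + x) * (f * g)" by (rule Z_cancel[OF sZ s0])
          then have "f * g * x + f * g * x = x * (f * g) + x * (f * g)"
            by (simp only: distrib_left distrib_right)
          then show ?thesis by (rule double_cancel)
        qed
        fix k x assume x: "x \<in> A k"
        show "ad (f * g) x = 0"
        proof (cases k)
          case False then show ?thesis using ev x by (simp add: ad_def)
        next
          case True
          have "f * g * (w * x) = w * x * (f * g)" by (rule ev) (use A1_w x True in simp)
          then have "w * (f * g * x) = w * (x * (f * g))" using Cw(2)[OF fgC] by (simp add: mult.assoc)
          then have "w * (w * (f * g * x)) = w * (w * (x * (f * g)))" by simp
          then have "f * g * x = x * (f * g)" unfolding ww by (rule Z_cancel[OF sZ s0])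
          then show ?thesis by (simp add: ad_def)
        qed
      qed
      have E_add: "f + g \<in> E" if "f \<in> E" "g \<in> E" for f g
        using that C_diff(2) by (auto simp: E_def distrib_left distrib_right)
      \<comment> \<open>If all squares vanish on \<open>E\<close>, then \<open>f0 x f0 = 0\<close>
        for \<open>x\<close> in \<open>C\<close> by commutativity, for \<open>x\<close> in
        \<open>C'\<close> via \<open>a * x\<close>, and for odd \<open>x\<close> via
        \<open>w * x\<close>; primeness gives \<open>f0 = 0\<close>.\<close>
      have "\<exists>f\<in>E. f * f \<noteq> 0"
      proof (rule ccontr)
        assume "\<not> ?thesis"
        then have sq0: "f * f = 0" if "f \<in> E" for f using that by blast
        let ?f = f0
        have fg: "?f * g = 0" if g: "g \<in> E" for g
        proof -
          have "(?f + g) * (?f + g) = 0" by (rule sq0[OF E_add[OF f0(1) g]])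
          then have "?f * g + ?f * g = 0"
            using sq0[OF g] sq0[OF f0(1)] comm[OF EC[OF g] EC[OF f0(1)]]
            by (simp add: distrib_left distrib_right)
          then show ?thesis by (rule double_eq_zero)
        qed
        have fcf: "?f * c * ?f = 0" if c: "c \<in> C" for c
          using comm[OF EC[OF f0(1)] c] sq0[OF f0(1)] by (simp add: mult.assoc)
        have fbf: "?f * b * ?f = 0" if b: "b \<in> C'" for b
        proof -
          have "?f * (a * b) * ?f = 0" by (rule fcf[OF prod2[OF a b]])
          then have "a * (a * (?f * b * ?f)) = 0" using Ea'[OF f0(1)] by (simp add: mult.assoc)
          then show ?thesis unfolding aa by (rule Z_regular[OF \<alpha>Z \<alpha>0])
        qed
        have ev: "?f * x * ?f = 0" if x: "x \<in> A False" for x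
        proof -
          have "?f * ((s * x + w * x * w) + (s * x - w * x * w)) * ?f =
              ?f * (s * x + w * x * w) * ?f + ?f * (s * x - w * x * w) * ?f"
            by (simp only: distrib_left distrib_right)
          then have "?f * ((s * x + w * x * w) + (s * x - w * x * w)) * ?f = 0"
            unfolding fcf[OF s_decomp(1)[OF x]] fbf[OF s_decomp(2)[OF x]] by simp
          then have "s * (?f * x * ?f) + s * (?f * x * ?f) = 0"
            unfolding s_decomp(3)[OF x] by (simp add: distrib_left distrib_right mult.assoc sl[of ?f])
          then have "s * (?f * x * ?f) = 0" by (rule double_eq_zero)
          then show ?thesis by (rule Z_regular[OF sZ s0])
        qed
        have "?f * x * ?f = 0" for x
        proof (rule A_induct[of "\<lambda>x. ?f * x * ?f = 0"])
          fix k x assume x: "x \<in> A k"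
          show "?f * x * ?f = 0"
          proof (cases k)
            case False then show ?thesis using ev x by simp
          next
            case True
            have "?f * (w * x) * ?f = 0" by (rule ev) (use A1_w x True in simp)
            then have "w * (w * (?f * x * ?f)) = 0" using Cw(2)[OF EC[OF f0(1)]] by (simp add: mult.assoc)
            then show ?thesis unfolding ww by (rule Z_regular[OF sZ s0])
          qed
        qed (simp add: distrib_left distrib_right)
        then show False using prime_mult[OF CA[OF EC[OF f0(1)]] CA[OF EC[OF f0(1)]]] f0(2) by blast
      qed
      then obtain f where f: "f \<in> E" and ff0: "f * f \<noteq> 0" by blast
      define \<phi> where "\<phi> = f * f"
      have \<phi>Z: "\<phi> \<in> Z" using EE[OF f f] by (simp add: \<phi>_def)
      have \<phi>0: "\<phi> \<noteq> 0" using ff0 by (simp add: \<phi>_def)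
      note fw = Cw[OF EC[OF f]] and fa = Ea[OF f] Ea'[OF f]
      have fA: "f \<in> A False" by (rule CA[OF EC[OF f]])
      let ?e = "\<lambda>i::nat. if i = 0 then w else if i = 1 then w * a else w * (a * f)"
      let ?B = "{w, w * a, w * (a * f)}"
      have img: "?e ` {..<3} = ?B"
      proof -
        have "{..<3::nat} = {0, 1, 2}" by auto
        then show ?thesis by auto
      qed
      have wafA: "w * (a * f) \<in> A True" using A_mult[OF wA A_mult[OF aA fA]] by simp
      have e22: "w * (a * f) * (w * (a * f)) = s * \<alpha> * \<phi>"
        by (simp add: mult.assoc fw aw fa ww aa \<phi>_def)
      have e02: "w * (w * (a * f)) = - (w * (a * f) * w)"
        by (simp add: mult.assoc fw aw)
      have e12: "w * a * (w * (a * f)) = - (s * \<alpha> * f)" "w * (a * f) * (w * a) = s * \<alpha> * f"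
        by (simp_all add: mult.assoc fw aw fa ww aa)
      have "central_order_in_Clifford A0 A1 3"
      proof (rule central_order_criterion[OF Z0, where e = ?e])
        fix x
        \<comment> \<open>The factor \<open>\<alpha> + \<alpha>\<close> splits \<open>c\<close> into
          a central \<open>z\<close> and a \<open>g\<close> in \<open>E\<close>. The rest reaches
          \<open>g\<close>: \<open>s * \<alpha> * f\<close> is a product of two generators, and
          \<open>\<phi> * g = f * (f * g)\<close> with \<open>f * g\<close> central.\<close>
        let ?z0 = "s * \<alpha> * \<phi> * (\<alpha> + \<alpha>)"
        have s\<alpha>f: "s * \<alpha> * f \<in> Z.gen ?B"
          unfolding e12(2)[symmetric] by (intro Z.gen.intros(5) Z.gen.intros(2)) auto
        have "?z0 * c \<in> Z.gen ?B" if c: "c \<in> C" for c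
        proof -
          define z where "z = \<alpha> * c + a * c * a"
          define g where "g = \<alpha> * c - a * c * a"
          have z: "z \<in> Z" unfolding z_def by (rule C_decomp(1)[OF c])
          have g: "g \<in> E" unfolding g_def by (rule C_decomp(2)[OF c])
          have zg: "(\<alpha> + \<alpha>) * c = z + g"
            using C_decomp(3)[OF c] by (simp add: z_def g_def distrib_left distrib_right)
          have fg: "f * g \<in> Z" by (rule EE[OF f g])
          have "s * \<alpha> * \<phi> * g = s * \<alpha> * f * (f * g)"
            by (simp only: \<phi>_def mult.assoc)
          then have "s * \<alpha> * \<phi> * g \<in> Z.gen ?B"
            using Z.gen.intros(5)[OF s\<alpha>f Z.gen.intros(1)[OF fg]] by simp
          moreover have "s * \<alpha> * \<phi> * z \<in> Z.gen ?B"
            by (intro Z.gen.intros(1) Z_mult sZ \<alpha>Z \<phi>Z z)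
          ultimately have "s * \<alpha> * \<phi> * z + s * \<alpha> * \<phi> * g \<in> Z.gen ?B"
            by (intro Z.gen.intros(3))
          also have "s * \<alpha> * \<phi> * z + s * \<alpha> * \<phi> * g = ?z0 * c"
            unfolding mult.assoc[of "s * \<alpha> * \<phi>"] zg by (simp only: distrib_left)
          finally show ?thesis .
        qed
        moreover have "?z0 \<in> Z" by (intro Z_mult sZ \<alpha>Z \<phi>Z \<alpha>2)
        moreover have "?z0 \<noteq> 0"
          using Z_mult_nonzero[OF Z_mult[OF s\<alpha>(1) \<phi>Z] Z_mult_nonzero[OF s\<alpha> \<phi>0] \<alpha>2(2)] .
        moreover have "s * a \<in> Z.gen ?B"
          unfolding saw[symmetric] by (intro Z.gen.intros(5) Z.gen.intros(2)) auto
        ultimately show "\<exists>z\<in>Z - {0}. z * x \<in> Z.gen (?e ` {..<3})"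
          unfolding img by (intro span[of _ ?z0]) auto
      next
        fix i :: nat assume i3: "i < 3"
        then consider "i = 0" | "i = 1" | "i = 2" by linarith
        note i = this
        show "?e i \<in> A1" using i by cases (use wA waA wafA in simp_all)
        show "?e i * ?e i \<in> Z"
          using i by cases (use sZ wawa e22 Z_minus[OF s\<alpha>(1)] Z_mult[OF s\<alpha>(1) \<phi>Z] in \<open>simp_all add: s_def[symmetric]\<close>)
        show "?e i * ?e i \<noteq> 0"
          using i by cases (use s0 wawa e22 s\<alpha>(2) Z_mult_nonzero[OF s\<alpha> \<phi>0] in \<open>simp_all add: s_def[symmetric]\<close>)
        fix j :: nat assume j3: "j < 3" and ij: "i \<noteq> j"
        have "i = 0 \<or> i = 1 \<or> i = 2" "j = 0 \<or> j = 1 \<or> j = 2" using i3 j3 by linarith+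
        then show "?e i * ?e j = - (?e j * ?e i)"
          by (elim disjE) (use ij waw e02 e12 in simp_all)
      qed
      then show ?thesis by blast
    qed
  qed
qed

end

theorem theorem2p7:
  fixes scale :: "'k::comm_ring_1 \<Rightarrow> 'a::ring \<Rightarrow> 'a"
    and A0 A1 L V :: "'a set"
  assumes half: "\<exists>h::'k. 2 * h = 1"
    and superalgebra: "assoc_superalgebra scale A0 A1"
    and nontrivial: "A1 \<noteq> {0}"
    and prime: "prime_superalgebra scale A0 A1"
    and not_Clifford: "\<forall>n\<in>{1, 2, 3}. \<not> central_order_in_Clifford A0 A1 n"
    and L: "Lie_ideal scale A0 A1 L"
    and V: "graded_submodule scale A0 A1 V"
    and V_L: "bracket_span scale A0 A1 V L \<subseteq> V"
  shows "L \<subseteq> even_center A0 \<or> V \<subseteq> even_center A0 \<or>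
    (\<exists>M. graded_ideal scale A0 A1 M \<and> bracket_span scale A0 A1 M UNIV \<noteq> {0} \<and>
         bracket_span scale A0 A1 M UNIV \<subseteq> V)"
proof -
  interpret prime_superalgebra_locale scale A0 A1
    using superalgebra half prime nontrivial
    by (intro prime_superalgebra_locale.intro prime_superalgebra_locale_axioms.intro)
  \<comment> \<open>The exclusion of the Clifford cases enters here only. It is needed for
    \<open>UNIV\<close>, where it settles the alternatives for \<open>L\<close>, and for the ideal
    obtained from \<open>L\<close>, where it settles those for \<open>V\<close>.\<close>
  have W: "W M = {0}" if "gideal M" "M \<noteq> {0}" for M
    using W_nonisotropic[OF that] nonisotropic_central_order[OF that] not_Clifford by blast
  have UNIV: "(UNIV :: 'a set) \<noteq> {0}" using nontrivial A_zero[of True] by auto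
  have Ls: "submod L" and LA: "bracket_span scale A0 A1 L UNIV \<subseteq> L"
    using L by (auto simp: Lie_ideal_def)
  have LA': "br i j x a \<in> L" if "x \<in> L" "x \<in> A i" "a \<in> A j" for i j x a
    using subsetD[OF LA br_mem_bracket_span[OF that(1) UNIV_I that(2,3)]] .
  from Lie_ideal_dichotomy[OF Ls LA'] W[OF gideal_UNIV UNIV]
  consider "L \<subseteq> Z"
    | M where "gideal M" "M \<noteq> {0}" "\<And>i j m a. m \<in> M \<Longrightarrow> m \<in> A i \<Longrightarrow> a \<in> A j \<Longrightarrow> br i j m a \<in> L"
    by blast
  then show ?thesis
  proof cases
    case 2
    have VN: "br i (j \<noteq> k) v (br j k m a) \<in> V"
      if v: "v \<in> V" "v \<in> A i" and m: "m \<in> M" "m \<in> A j" and a: "a \<in> A k" for i j k v m a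
      using subsetD[OF V_L br_mem_bracket_span[OF v(1) 2(3)[OF m a] v(2) br_A[OF m(2) a]]] .
    from invariant_submodule_dichotomy[OF 2(1,2) V VN] W[OF 2(1,2)]
    consider "V \<subseteq> Z"
      | I where "gideal I" "I \<noteq> {0}" "\<And>i j m a. m \<in> I \<Longrightarrow> m \<in> A i \<Longrightarrow> a \<in> A j \<Longrightarrow> br i j m a \<in> V"
      by blast
    then show ?thesis
    proof cases
      case I: 2
      have "bracket_span scale A0 A1 I UNIV \<subseteq> V"
        by (rule bracket_span_subset[OF gideal_submod[OF I(1)] gideal_submod[OF gideal_UNIV] V])
          (rule I(3))
      moreover obtain i j m a where "m \<in> I" "m \<in> A i" "a \<in> A j" "br i j m a \<noteq> 0"
        using noncommutative[OF I(1,2)] .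
      then have "bracket_span scale A0 A1 I UNIV \<noteq> {0}"
        using br_mem_bracket_span[of m I a UNIV i j] by blast
      ultimately show ?thesis using I(1) by blast
    qed blast
  qed blast
qed

end
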